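(* Let $G$ be a group, let $(\{\alpha_g\}_{g\in G},\{D_g\}_{g\in G},\{w_{g,h}\}_{(g,h)\in G\times G})$ be a unital twisted partial action of $G$ on a unital ring $R$, and let $R\star_\alpha^w G$ be the associated unital partial crossed product. Then $R\star_\alpha^w G$ is not prime if and only if there are: (i) subgroups $N\lhd H\subseteq G$ with $N$ finite, (ii) an ideal $I$ of $R$ such that $\alpha_h(I1_{h^{-1}})=I1_h$ for every $h\in H$, and $I\cdot\alpha_g(I1_{g^{-1}})=\{0\}$ for every $g\in G\setminus H$, and (iii) nonzero ideals $\tilde A,\tilde B$ of $R\star_\alpha^wN$ such that $\tilde A,\tilde B\subseteq I\cdot(R\star_\alpha^wN)$ and $\tilde A\cdot1_h\delta_h\cdot\tilde B=\{0\}$ for every $h\in H$.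
   Context: Rings are associative; a unital ring has a nonzero multiplicative identity; ideals are two-sided. For subsets $U,V$ of a ring, $UV$ denotes the set of finite sums of elements $uv$ with $u\in U$, $v\in V$. A ring $T$ is prime if $\{0\}$ is a proper ideal and for all ideals $A,B$ of $T$, $AB=\{0\}$ implies $A=\{0\}$ or $B=\{0\}$. A unital twisted partial action of a group $G$ (neutral element $e$) on a unital ring $R$ is a triple $(\{\alpha_g\}_{g\in G},\{D_g\}_{g\in G},\{w_{g,h}\}_{(g,h)\in G\times G})$ where for all $g,h\in G$, $D_g$ is an ideal of $R$ having a (not necessarily nonzero) multiplicative identity element $1_g\in Z(R)$, $\alpha_g:D_{g^{-1}}\to D_g$ is a ring isomorphism, and $w_{g,h}$ is an invertible element of $D_gD_{gh}$, such that for all $g,h,l\in G$: (UP1) $\alpha_e=\mathrm{id}_R$; (UP2) $\alpha_g(D_{g^{-1}}D_h)=D_gD_{gh}$; (UP3) if $r\in D_{h^{-1}}D_{(gh)^{-1}}$, then $\alpha_g(\alpha_h(r))=w_{g,h}\alpha_{gh}(r)w_{g,h}^{-1}$; (UP4) $w_{e,g}=w_{g,e}=1_g$; (UP5) if $r\in D_{g^{-1}}D_hD_{hl}$, then $\alpha_g(rw_{h,l})w_{g,hl}=\alpha_g(r)w_{g,h}w_{gh,l}$. The unital partial crossed product is $R\star_\alpha^wG:=\bigoplus_{g\in G}D_g\delta_g$, where the $\delta_g$ are formal symbols, with multiplication determined by $(r\delta_g)(r'\delta_h)=r\alpha_g(r'1_{g^{-1}})w_{g,h}\delta_{gh}$ for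 $r\in D_g$, $r'\in D_h$; it is an associative ring. $R$ is identified with $R\delta_e$. For a subgroup $N$ of $G$, $R\star_\alpha^wN=\bigoplus_{n\in N}D_n\delta_n$, a subring of $R\star_\alpha^wG$. *)

theory Defs
  imports "HOL-Algebra.Ideal_Product" "HOL-Algebra.QuotRing"
begin

text \<open>
  The library operation \<open>ideal_prod R U V\<close>, written \<open>U \<cdot>\<^bsub>R\<^esub> V\<close>, is the set of all finite
  (nonempty) sums of elements \<open>u \<otimes> v\<close> with \<open>u \<in> U\<close> and \<open>v \<in> V\<close>; its definition makes sense for
  arbitrary nonempty subsets, and it is used in this generality below.
\<close>

text \<open>
  The library predicate \<open>ideal A T\<close> means a two-sided ideal and includes that \<open>T\<close> is an associative
  ring with (possibly zero) \<open>\<one>\<close>, so primeness is only meaningful here for unital rings.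
\<close>

definition prime_ring :: "('a, 'm) ring_scheme \<Rightarrow> bool" where
  "prime_ring T \<longleftrightarrow>
     ideal {\<zero>\<^bsub>T\<^esub>} T \<and> {\<zero>\<^bsub>T\<^esub>} \<noteq> carrier T \<and>
     (\<forall>A B. ideal A T \<longrightarrow> ideal B T \<longrightarrow> A \<cdot>\<^bsub>T\<^esub> B = {\<zero>\<^bsub>T\<^esub>} \<longrightarrow> A = {\<zero>\<^bsub>T\<^esub>} \<or> B = {\<zero>\<^bsub>T\<^esub>})"

definition is_identity_of :: "('a, 'm) ring_scheme \<Rightarrow> 'a set \<Rightarrow> 'a \<Rightarrow> bool" where
  "is_identity_of R J u \<longleftrightarrow> u \<in> J \<and> (\<forall>x\<in>J. u \<otimes>\<^bsub>R\<^esub> x = x \<and> x \<otimes>\<^bsub>R\<^esub> u = x)"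

text \<open>An identity element of \<open>J\<close> is unique if it exists.\<close>

definition identity_of :: "('a, 'm) ring_scheme \<Rightarrow> 'a set \<Rightarrow> 'a" where
  "identity_of R J = (THE u. is_identity_of R J u)"

text \<open>An ideal with an identity element, regarded as a (possibly zero) ring in its own right.\<close>

definition ideal_ring :: "('a, 'm) ring_scheme \<Rightarrow> 'a set \<Rightarrow> ('a, 'm) ring_scheme" where
  "ideal_ring R J = R\<lparr>carrier := J, one := identity_of R J\<rparr>"

text \<open>
  The maps \<open>\<alpha> g\<close> are total HOL functions; only their values on \<open>D (inv g)\<close> are meaningful.
  The condition \<open>\<alpha>\<^sub>e = id\<^sub>R\<close> comprises the equality of domains \<open>D\<^sub>e = R\<close>.
  Invertibility of \<open>w g h\<close>, and its inverse, refer to the ring \<open>D g \<cdot> D (g h)\<close>, whose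
  identity element is \<open>1\<^sub>g 1\<^sub>g\<^sub>h\<close>.
\<close>

locale unital_twisted_partial_action = G: group G + R: ring R
  for G :: "('g, 'm) monoid_scheme" (structure)
    and R :: "('r, 'n) ring_scheme" (structure) +
  fixes \<alpha> :: "'g \<Rightarrow> 'r \<Rightarrow> 'r" and D :: "'g \<Rightarrow> 'r set" and w :: "'g \<Rightarrow> 'g \<Rightarrow> 'r"
  assumes one_neq_zero: "\<one>\<^bsub>R\<^esub> \<noteq> \<zero>\<^bsub>R\<^esub>"
    and D_ideal: "g \<in> carrier G \<Longrightarrow> ideal (D g) R"
    and D_identity: "g \<in> carrier G \<Longrightarrow>
      \<exists>u. is_identity_of R (D g) u \<and> (\<forall>r\<in>carrier R. u \<otimes>\<^bsub>R\<^esub> r = r \<otimes>\<^bsub>R\<^esub> u)"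
    and alpha_iso: "g \<in> carrier G \<Longrightarrow>
      \<alpha> g \<in> ring_iso (ideal_ring R (D (inv\<^bsub>G\<^esub> g))) (ideal_ring R (D g))"
    and w_invertible: "\<lbrakk>g \<in> carrier G; h \<in> carrier G\<rbrakk> \<Longrightarrow>
      w g h \<in> Units (ideal_ring R (D g \<cdot>\<^bsub>R\<^esub> D (g \<otimes>\<^bsub>G\<^esub> h)))"
    and UP1: "D \<one>\<^bsub>G\<^esub> = carrier R" "r \<in> carrier R \<Longrightarrow> \<alpha> \<one>\<^bsub>G\<^esub> r = r"
    and UP2: "\<lbrakk>g \<in> carrier G; h \<in> carrier G\<rbrakk> \<Longrightarrow>
      \<alpha> g ` (D (inv\<^bsub>G\<^esub> g) \<cdot>\<^bsub>R\<^esub> D h) = D g \<cdot>\<^bsub>R\<^esub> D (g \<otimes>\<^bsub>G\<^esub> h)"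
    and UP3: "\<lbrakk>g \<in> carrier G; h \<in> carrier G;
        r \<in> D (inv\<^bsub>G\<^esub> h) \<cdot>\<^bsub>R\<^esub> D (inv\<^bsub>G\<^esub> (g \<otimes>\<^bsub>G\<^esub> h))\<rbrakk> \<Longrightarrow>
      \<alpha> g (\<alpha> h r) =
        w g h \<otimes>\<^bsub>R\<^esub> \<alpha> (g \<otimes>\<^bsub>G\<^esub> h) r \<otimes>\<^bsub>R\<^esub>
          inv\<^bsub>ideal_ring R (D g \<cdot>\<^bsub>R\<^esub> D (g \<otimes>\<^bsub>G\<^esub> h))\<^esub> (w g h)"
    and UP4: "g \<in> carrier G \<Longrightarrow> w \<one>\<^bsub>G\<^esub> g = identity_of R (D g)"
      "g \<in> carrier G \<Longrightarrow> w g \<one>\<^bsub>G\<^esub> = identity_of R (D g)"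
    and UP5: "\<lbrakk>g \<in> carrier G; h \<in> carrier G; l \<in> carrier G;
        r \<in> D (inv\<^bsub>G\<^esub> g) \<cdot>\<^bsub>R\<^esub> D h \<cdot>\<^bsub>R\<^esub> D (h \<otimes>\<^bsub>G\<^esub> l)\<rbrakk> \<Longrightarrow>
      \<alpha> g (r \<otimes>\<^bsub>R\<^esub> w h l) \<otimes>\<^bsub>R\<^esub> w g (h \<otimes>\<^bsub>G\<^esub> l) =
        \<alpha> g r \<otimes>\<^bsub>R\<^esub> w g h \<otimes>\<^bsub>R\<^esub> w (g \<otimes>\<^bsub>G\<^esub> h) l"

text \<open>The element \<open>r \<delta>\<^sub>g\<close>.\<close>

definition delta :: "('r, 'n) ring_scheme \<Rightarrow> 'r \<Rightarrow> 'g \<Rightarrow> 'g \<Rightarrow> 'r" where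
  "delta R r g = (\<lambda>k. if k = g then r else \<zero>\<^bsub>R\<^esub>)"

definition supp :: "('r, 'n) ring_scheme \<Rightarrow> ('g \<Rightarrow> 'r) \<Rightarrow> 'g set" where
  "supp R f = {g. f g \<noteq> \<zero>\<^bsub>R\<^esub>}"

text \<open>
  The crossed product of \<open>R\<close> with a subgroup \<open>N\<close> of \<open>G\<close>: a formal sum \<open>\<Sum>\<^sub>g f\<^sub>g \<delta>\<^sub>g\<close> is the finitely
  supported function \<open>g \<mapsto> f\<^sub>g\<close>, extended by zero outside \<open>N\<close>. Hence the crossed product with \<open>N\<close>
  is literally a subset of the one with \<open>carrier G\<close>, with the same operations. The multiplication
  is the biadditive extension of
  \<open>(r \<delta>\<^sub>g) (r' \<delta>\<^sub>h) = r \<alpha>\<^sub>g(r' 1\<^bsub>inv g\<^esub>) w\<^bsub>g,h\<^esub> \<delta>\<^sub>g\<^sub>h\<close>.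
\<close>

definition crossed_product ::
  "('g, 'm) monoid_scheme \<Rightarrow> ('r, 'n) ring_scheme \<Rightarrow> ('g \<Rightarrow> 'r \<Rightarrow> 'r) \<Rightarrow> ('g \<Rightarrow> 'r set) \<Rightarrow>
    ('g \<Rightarrow> 'g \<Rightarrow> 'r) \<Rightarrow> 'g set \<Rightarrow> ('g \<Rightarrow> 'r) ring" where
  "crossed_product G R \<alpha> D w N =
    \<lparr>carrier = {f. finite (supp R f) \<and> (\<forall>g\<in>N. f g \<in> D g) \<and> (\<forall>g. g \<notin> N \<longrightarrow> f g = \<zero>\<^bsub>R\<^esub>)},
     mult = (\<lambda>f f' k.
       \<Oplus>\<^bsub>R\<^esub>p\<in>{(g, h). g \<in> supp R f \<and> h \<in> supp R f' \<and> g \<otimes>\<^bsub>G\<^esub> h = k}.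
         (case p of (g, h) \<Rightarrow>
           f g \<otimes>\<^bsub>R\<^esub> \<alpha> g (f' h \<otimes>\<^bsub>R\<^esub> identity_of R (D (inv\<^bsub>G\<^esub> g))) \<otimes>\<^bsub>R\<^esub> w g h)),
     one = delta R \<one>\<^bsub>R\<^esub> \<one>\<^bsub>G\<^esub>,
     zero = (\<lambda>_. \<zero>\<^bsub>R\<^esub>),
     add = (\<lambda>f f' k. f k \<oplus>\<^bsub>R\<^esub> f' k)\<rparr>"

end

theory Submission
  imports Defs Complex_Main "HOL-Algebra.Generated_Groups"
begin

text \<open>
  If the crossed product is not prime, there are nonzero \<open>a\<close>, \<open>b\<close> with \<open>a s b = 0\<close> for all homogeneous \<open>s\<close>. For a
  subgroup \<open>H\<close> and \<open>j\<close> in \<open>R\<close> such that \<open>j s j = 0\<close> for homogeneous \<open>s\<close> of degree outside \<open>H\<close>, consider pairs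
  \<open>a\<close>, \<open>b\<close> in the ideal of the \<open>H\<close>-part generated by \<open>j\<close> that annihilate each other through the \<open>H\<close>-part. Choose
  \<open>(H, j, a, b)\<close> minimizing lexicographically the number of cosets of the FC center of \<open>H\<close> met by the support of
  \<open>b\<close>, the size of the part \<open>Y\<close> of the support of \<open>a\<close> in the FC center, and the number of conjugates of \<open>Y\<close>. If
  the FC parts of \<open>a\<close> and \<open>b\<close> did not annihilate each other, passing to the stabilizer of a suitable finite set
  would produce a smaller pair. So both may be taken in the FC center, and there leading terms with respect to
  rational characters of a finitely generated normal subgroup push the supports into its torsion part, which is
  finite by Dietzmann's lemma. This is the subgroup \<open>N\<close>, and \<open>I\<close> consists of the \<open>r\<close> in \<open>R\<close> lying in the ideal
  generated by \<open>j\<close>. In the converse direction, the vanishing of \<open>I\<close> against its translates outside \<open>H\<close> makes the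
  two given ideals annihilate each other through the whole crossed product.
\<close>

section \<open>Groups with finite conjugacy classes\<close>

text \<open>Homogeneous components of a partial crossed product need not contain invertible
  elements, so degrees cannot be shifted by units. The substitute is \<open>local_units\<close>: two
  elements of opposite degrees that together act as identities on a component, so that a nonzero
  homogeneous element stays nonzero after multiplication by a suitable element of opposite degree.
  Apart from the grading, the descent takes nothing else from the partial action. Passing to a
  smaller subgroup \<open>L\<close> needs a new \<open>j'\<close> with \<open>j' s j' = 0\<close> in
  degrees outside \<open>L\<close>. It comes from extremality: if the finite set attached to
  \<open>j'\<close> is smallest possible and \<open>j' s j'\<close> is nonzero for \<open>s\<close>
  of degree \<open>x\<close>, then a homogeneous multiple of \<open>j' s j'\<close> obeys both this
  set and a translate of it by \<open>x\<close>, so \<open>x\<close> stabilizes the set. Stabilizers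
  serve two opposite ends. Inside a finite orbit they have finite index, and no new FC elements
  appear. Stabilizers of finite sets of group elements may have infinite index, and then elements
  outside the FC center of \<open>H\<close> acquire finitely many conjugates, which merges
  cosets.\<close>

context group begin

lemma inv_cancel:
  "x \<in> carrier G \<Longrightarrow> y \<in> carrier G \<Longrightarrow> x \<otimes> (inv x \<otimes> y) = y"
  "x \<in> carrier G \<Longrightarrow> y \<in> carrier G \<Longrightarrow> inv x \<otimes> (x \<otimes> y) = y"
  by (simp_all add: m_assoc[symmetric])

lemmas group_word = m_assoc inv_mult_group inv_cancel

lemma subgroup_nat_pow_closed: "subgroup H G \<Longrightarrow> x \<in> H \<Longrightarrow> x [^] (k::nat) \<in> H"
  using subgroup_int_pow_closed[of H x "int k"] by (simp add: int_pow_int)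

definition list_prod :: "'a list \<Rightarrow> 'a" where
  "list_prod xs = foldr (\<otimes>) xs \<one>"

lemma list_prod_simps [simp]:
  "list_prod [] = \<one>" "list_prod (x # xs) = x \<otimes> list_prod xs"
  by (simp_all add: list_prod_def)

lemma list_prod_closed [simp]: "set xs \<subseteq> carrier G \<Longrightarrow> list_prod xs \<in> carrier G"
  by (induction xs) auto

lemma list_prod_append:
  "set xs \<subseteq> carrier G \<Longrightarrow> set ys \<subseteq> carrier G \<Longrightarrow> list_prod (xs @ ys) = list_prod xs \<otimes> list_prod ys"
  by (induction xs) (auto simp: m_assoc)

lemma list_prod_replicate: "x \<in> carrier G \<Longrightarrow> list_prod (replicate k x) = x [^] k"
proof (induction k)
  case (Suc k)
  then show ?case using nat_pow_Suc2[of x k] by simp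
qed simp

text \<open>Moving \<open>x [^] k\<close> to the left past \<open>y\<close> replaces
  \<open>y\<close> by its conjugate under \<open>inv (x [^] k)\<close>, which stays in \<Omega>.
  With \<open>k\<close> only a lower bound for the number of occurrences, the induction can pass to
  the tail in both cases.\<close>

lemma list_prod_collect:
  assumes H: "subgroup H G" and \<Omega>: "\<Omega> \<subseteq> H" "\<And>h x. h \<in> H \<Longrightarrow> x \<in> \<Omega> \<Longrightarrow> h \<otimes> x \<otimes> inv h \<in> \<Omega>"
    and x: "x \<in> \<Omega>" and "set xs \<subseteq> \<Omega>" "k \<le> count_list xs x"
  shows "\<exists>ys. set ys \<subseteq> \<Omega> \<and> length ys + k = length xs \<and> list_prod xs = x [^] k \<otimes> list_prod ys"
  using assms(5,6)
proof (induction xs arbitrary: k)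
  case Nil
  then show ?case by auto
next
  case (Cons y xs)
  have HG: "H \<subseteq> carrier G" using H by (rule subgroup.subset)
  have xG: "x \<in> carrier G" and yG: "y \<in> carrier G" using x \<Omega>(1) HG Cons.prems by auto
  show ?case
  proof (cases "y = x \<and> k > 0")
    case True
    have "k - 1 \<le> count_list xs x" "set xs \<subseteq> \<Omega>" using True Cons.prems by auto
    from Cons.IH[OF this(2,1)] obtain ys where ys: "set ys \<subseteq> \<Omega>" "length ys + (k - 1) = length xs"
      "list_prod xs = x [^] (k - 1) \<otimes> list_prod ys"
      by blast
    have "list_prod ys \<in> carrier G" using ys \<Omega>(1) HG by auto
    then have xs: "list_prod (y # xs) = x [^] Suc (k - 1) \<otimes> list_prod ys"
      using True ys xG by (simp only: nat_pow_Suc2 list_prod_simps m_assoc nat_pow_closed)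
    have "Suc (k - 1) = k" using True by simp
    with xs have "list_prod (y # xs) = x [^] k \<otimes> list_prod ys" by (simp only:)
    moreover have "length ys + k = length (y # xs)" using ys(2) conjunct2[OF True] unfolding list.size by linarith
    ultimately show ?thesis using ys(1) by (intro exI[of _ ys] conjI)
  next
    case False
    have sub: "set xs \<subseteq> \<Omega>" using Cons.prems by simp
    have "k \<le> count_list xs x"
    proof (cases "y = x")
      case True
      have "k = 0" using True False by auto
      thus ?thesis by simp
    next
      case ne: False
      have "k \<le> count_list (y # xs) x" using Cons.prems by blast
      thus ?thesis using ne by simp
    qed
    have "set xs \<subseteq> \<Omega>" "k \<le> count_list xs x" by fact+
    from Cons.IH[OF this] obtain ys where ys: "set ys \<subseteq> \<Omega>" "length ys + k = length xs"
      "list_prod xs = x [^] k \<otimes> list_prod ys"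
      by blast
    have xH: "x \<in> H" using x \<Omega>(1) by (rule subsetD[rotated])
    have "inv (x [^] k) \<in> H"
      by (intro subgroup.m_inv_closed[OF H] subgroup_nat_pow_closed[OF H] xH)
    moreover have "y \<in> \<Omega>" using Cons.prems(1) by simp
    moreover define y' where "y' = inv (x [^] k) \<otimes> y \<otimes> x [^] k"
    ultimately have y\<Omega>: "y' \<in> \<Omega>" using \<Omega>(2)[of "inv (x [^] k)" y] xG by simp
    have ysG: "list_prod ys \<in> carrier G" using ys \<Omega>(1) HG by auto
    have "list_prod (y # xs) = x [^] k \<otimes> list_prod (y' # ys)"
      unfolding list_prod_simps ys(3) y'_def using xG yG ysG by (simp add: group_word)
    moreover have "set (y' # ys) \<subseteq> \<Omega>" "length (y' # ys) + k = length (y # xs)" using ys(1,2) y\<Omega> by auto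
    ultimately show ?thesis by (intro exI[of _ "y' # ys"] conjI)
  qed
qed

text \<open>Dietzmann's lemma: in a long product some \<open>x\<close> in \<open>\<Omega>\<close> occurs as often as its order, and its occurrences can be moved to
  the left at the cost of conjugating the other factors, so shortest products are of bounded length.\<close>

lemma finite_generate_torsion:
  assumes H: "subgroup H G" and \<Omega>: "\<Omega> \<subseteq> H" "\<And>h x. h \<in> H \<Longrightarrow> x \<in> \<Omega> \<Longrightarrow> h \<otimes> x \<otimes> inv h \<in> \<Omega>"
    and fin: "finite \<Omega>" and tor: "\<And>x. x \<in> \<Omega> \<Longrightarrow> \<exists>k>0. x [^] (k::nat) = \<one>"
  shows "finite (generate G \<Omega>)"
proof -
  have HG: "H \<subseteq> carrier G" using H by (rule subgroup.subset)
  have \<Omega>G: "\<Omega> \<subseteq> carrier G" using \<Omega>(1) HG by auto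
  obtain k where k: "\<And>x. x \<in> \<Omega> \<Longrightarrow> k x > (0::nat) \<and> x [^] k x = \<one>"
    using tor by metis
  \<comment> \<open>By the pigeonhole principle, a list longer than the sum of the exponents
    contains some \<open>x\<close> at least \<open>k x\<close> times, and these factors
    cancel.\<close>
  define K where "K = (\<Sum>x\<in>\<Omega>. k x)"
  have short: "\<exists>ys. set ys \<subseteq> \<Omega> \<and> length ys \<le> K \<and> list_prod ys = list_prod xs" if "set xs \<subseteq> \<Omega>" for xs
    using that
  proof (induction "length xs" arbitrary: xs rule: less_induct)
    case less
    show ?case
    proof (cases "length xs \<le> K")
      case False
      have "length xs = (\<Sum>x\<in>\<Omega>. count_list xs x)"
        using sum_count_set[OF less.prems fin] by simp
      have "\<exists>x\<in>\<Omega>. k x \<le> count_list xs x"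
      proof (rule ccontr)
        assume "\<not> ?thesis"
        then have "(\<Sum>x\<in>\<Omega>. count_list xs x) \<le> K" unfolding K_def by (intro sum_mono) auto
        then show False using False \<open>length xs = _\<close> by simp
      qed
      then obtain x where x: "x \<in> \<Omega>" "k x \<le> count_list xs x" by blast
      obtain ys where ys: "set ys \<subseteq> \<Omega>" "length ys + k x = length xs"
          "list_prod xs = x [^] k x \<otimes> list_prod ys"
        using list_prod_collect[OF H \<Omega> x(1) less.prems x(2)] by auto
      have "list_prod ys \<in> carrier G" using ys(1) \<Omega>G by auto
      then have "list_prod xs = list_prod ys" using ys k[OF x(1)] by auto
      moreover have "length ys < length xs" using ys k[OF x(1)] by auto
      ultimately show ?thesis using less.hyps[of ys] ys(1) by auto
    qed (use less.prems in auto)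
  qed
  have gen: "\<exists>xs. set xs \<subseteq> \<Omega> \<and> g = list_prod xs" if "g \<in> generate G \<Omega>" for g
    using that
  proof (induction rule: generate.induct)
    case one
    show ?case by (intro exI[of _ "[]"]) auto
  next
    case (incl h)
    then show ?case using \<Omega>G by (intro exI[of _ "[h]"]) auto
  next
    case (inv h)
    have hG: "h \<in> carrier G" using inv \<Omega>G by auto
    \<comment> \<open>Torsion turns inverses of generators into powers, so lists of generators reach
      the whole subgroup.\<close>
    have "h [^] (k h - 1) \<otimes> h = \<one>" using k[OF inv] by (cases "k h") auto
    then have "inv h = list_prod (replicate (k h - 1) h)"
      unfolding list_prod_replicate[OF hG] by (rule inv_equality) (use hG in auto)
    moreover have "set (replicate (k h - 1) h) \<subseteq> \<Omega>" using inv by auto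
    ultimately show ?case by (intro exI conjI)
  next
    case (eng h1 h2)
    then obtain xs ys where xy: "set xs \<subseteq> \<Omega>" "h1 = list_prod xs" "set ys \<subseteq> \<Omega>" "h2 = list_prod ys" by blast
    then have "h1 \<otimes> h2 = list_prod (xs @ ys)" using list_prod_append[of xs ys] \<Omega>G by simp
    moreover have "set (xs @ ys) \<subseteq> \<Omega>" using xy by simp
    ultimately show ?case by (intro exI conjI)
  qed
  have sub: "generate G \<Omega> \<subseteq> list_prod ` {xs. set xs \<subseteq> \<Omega> \<and> length xs \<le> K}"
  proof (intro subsetI)
    fix g assume "g \<in> generate G \<Omega>"
    then obtain xs where xs: "set xs \<subseteq> \<Omega>" "g = list_prod xs" using gen by blast
    then obtain ys where "set ys \<subseteq> \<Omega>" "length ys \<le> K" "list_prod ys = g" using short[OF xs(1)] by blast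
    then show "g \<in> list_prod ` {xs. set xs \<subseteq> \<Omega> \<and> length xs \<le> K}" by (intro image_eqI[of _ _ ys]) simp_all
  qed
  show ?thesis by (rule finite_subset[OF sub]) (intro finite_imageI finite_lists_length_le[OF fin])
qed

section \<open>Rational characters\<close>

definition additive_on :: "'a set \<Rightarrow> ('a \<Rightarrow> rat) \<Rightarrow> bool" where
  "additive_on V \<phi> \<longleftrightarrow> (\<forall>x\<in>V. \<forall>y\<in>V. \<phi> (x \<otimes> y) = \<phi> x + \<phi> y)"

lemma additive_on_mult: "additive_on V \<phi> \<Longrightarrow> x \<in> V \<Longrightarrow> y \<in> V \<Longrightarrow> \<phi> (x \<otimes> y) = \<phi> x + \<phi> y"
  by (auto simp: additive_on_def)

lemma additive_on_one: "additive_on V \<phi> \<Longrightarrow> subgroup V G \<Longrightarrow> \<phi> \<one> = 0"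
  using additive_on_mult[of V \<phi> \<one> \<one>] subgroup.one_closed by fastforce

lemma additive_on_inv:
  assumes "additive_on V \<phi>" "subgroup V G" "x \<in> V" shows "\<phi> (inv x) = - \<phi> x"
proof -
  have "x \<in> carrier G" "inv x \<in> V" using assms by (auto simp: subgroup.mem_carrier subgroup.m_inv_closed)
  then show ?thesis
    using additive_on_mult[OF assms(1), of x "inv x"] additive_on_one[OF assms(1,2)] assms by auto
qed

lemma additive_on_pow:
  assumes "additive_on V \<phi>" "subgroup V G" "x \<in> V" shows "\<phi> (x [^] (k::nat)) = of_nat k * \<phi> x"
proof (induction k)
  case 0
  then show ?case using additive_on_one[OF assms(1,2)] by simp
next
  case (Suc k)
  have "x [^] k \<in> V" using assms subgroup_nat_pow_closed by blast
  then show ?case using additive_on_mult[OF assms(1)] assms Suc by (simp add: algebra_simps)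
qed

text \<open>The group of rationals is divisible, hence injective.\<close>

lemma additive_extension:
  assumes Z: "subgroup Z G" and comm: "\<And>x y. x \<in> Z \<Longrightarrow> y \<in> Z \<Longrightarrow> x \<otimes> y = y \<otimes> x"
    and z: "z \<in> Z" "\<And>k. k > 0 \<Longrightarrow> z [^] (k::nat) \<noteq> \<one>"
  shows "\<exists>\<psi>. additive_on Z \<psi> \<and> \<psi> z \<noteq> 0"
proof -
  have ZG: "Z \<subseteq> carrier G" using Z by (rule subgroup.subset)
  have Zpow: "x [^] (n::int) \<in> Z" if "x \<in> Z" for x n using that Z by (simp add: subgroup_int_pow_closed)
  have Zinv: "inv x \<in> Z" if "x \<in> Z" for x using that Z by (simp add: subgroup.m_inv_closed)
  have Zm: "x \<otimes> y \<in> Z" if "x \<in> Z" "y \<in> Z" for x y using that Z by (simp add: subgroup.m_closed)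
  \<comment> \<open>These are graphs of additive functions on subgroups of \<open>Z\<close> with
    value 1 at \<open>z\<close>. Closure under differences makes the domain a subgroup, and then the
    last clause alone expresses that the relation is single-valued.\<close>
  define ok where "ok = (\<lambda>\<Gamma>. \<Gamma> \<subseteq> Z \<times> (UNIV :: rat set) \<and> (z, 1) \<in> \<Gamma> \<and>
     (\<forall>x p y q. (x, p) \<in> \<Gamma> \<longrightarrow> (y, q) \<in> \<Gamma> \<longrightarrow> (x \<otimes> inv y, p - q) \<in> \<Gamma>) \<and>
     (\<forall>p. (\<one>, p) \<in> \<Gamma> \<longrightarrow> p = 0))"
  define \<Gamma>0 where "\<Gamma>0 = range (\<lambda>k::int. (z [^] k, rat_of_int k))"
  have zG: "z \<in> carrier G" using z ZG by auto
  have nz: "k = 0" if "z [^] (k::int) = \<one>" for k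
  proof (rule ccontr)
    assume "k \<noteq> 0"
    then consider "k > 0" | "- k > 0" by linarith
    then show False
    proof cases
      case 1
      then have "z [^] nat k = \<one>" using that by (metis int_pow_int nat_0_le order_less_imp_le)
      then show False using z(2)[of "nat k"] 1 by auto
    next
      case 2
      have "z [^] (- k) = \<one>" using that zG by (simp add: int_pow_neg)
      then have "z [^] nat (- k) = \<one>" using 2 by (metis int_pow_int nat_0_le order_less_imp_le)
      then show False using z(2)[of "nat (- k)"] 2 by auto
    qed
  qed
  have ok0: "ok \<Gamma>0"
    unfolding ok_def
  proof (intro conjI allI impI)
    show "\<Gamma>0 \<subseteq> Z \<times> UNIV" unfolding \<Gamma>0_def using Zpow z by auto
    show "(z, 1) \<in> \<Gamma>0" unfolding \<Gamma>0_def using zG by (intro image_eqI[of _ _ 1]) auto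
    fix x y p q assume "(x, p) \<in> \<Gamma>0" "(y, q) \<in> \<Gamma>0"
    then obtain m n where "x = z [^] (m::int)" "p = of_int m" "y = z [^] (n::int)" "q = of_int n" unfolding \<Gamma>0_def by auto
    then show "(x \<otimes> inv y, p - q) \<in> \<Gamma>0" unfolding \<Gamma>0_def
      using zG by (intro image_eqI[of _ _ "m - n"]) (auto simp: int_pow_diff)
  next
    fix p assume "(\<one>, p) \<in> \<Gamma>0"
    then obtain k :: int where k: "\<one> = z [^] k" "p = of_int k" unfolding \<Gamma>0_def by auto
    then show "p = 0" using nz[of k] by simp
  qed
  have "\<exists>M\<in>Collect ok. \<forall>X\<in>Collect ok. M \<subseteq> X \<longrightarrow> X = M"
  proof (rule subset_Zorn_nonempty)
    show "Collect ok \<noteq> {}" using ok0 by auto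
    fix C assume C: "C \<noteq> {}" "subset.chain (Collect ok) C"
    have okC: "ok \<Gamma>" if "\<Gamma> \<in> C" for \<Gamma> using C that by (auto simp: subset.chain_def)
    have "ok (\<Union>C)" unfolding ok_def
    proof (intro conjI allI impI)
      show "\<Union>C \<subseteq> Z \<times> UNIV" using okC unfolding ok_def by blast
      show "(z, 1) \<in> \<Union>C" using okC C(1) unfolding ok_def by blast
      fix x p y q assume "(x, p) \<in> \<Union>C" "(y, q) \<in> \<Union>C"
      then obtain \<Gamma>1 \<Gamma>2 where "\<Gamma>1 \<in> C" "(x,p) \<in> \<Gamma>1" "\<Gamma>2 \<in> C" "(y,q) \<in> \<Gamma>2" by auto
      moreover have "\<Gamma>1 \<subseteq> \<Gamma>2 \<or> \<Gamma>2 \<subseteq> \<Gamma>1" using C(2) calculation by (auto simp: subset.chain_def)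
      ultimately obtain \<Gamma> where \<Gamma>: "\<Gamma> \<in> C" "(x,p) \<in> \<Gamma>" "(y,q) \<in> \<Gamma>" by auto
      then show "(x \<otimes> inv y, p - q) \<in> \<Union>C" using okC[OF \<Gamma>(1)] unfolding ok_def by blast
    next
      fix p assume "(\<one>, p) \<in> \<Union>C"
      then show "p = 0" using okC unfolding ok_def by blast
    qed
    then show "\<Union>C \<in> Collect ok" by simp
  qed
  then obtain M where M: "ok M" and max: "\<And>X. ok X \<Longrightarrow> M \<subseteq> X \<Longrightarrow> X = M" by auto
  have MZ: "x \<in> Z" if "(x, p) \<in> M" for x p using M that unfolding ok_def by auto
  have Mz: "(z, 1) \<in> M" using M unfolding ok_def by auto
  have Md: "(x \<otimes> inv y, p - q) \<in> M" if "(x,p) \<in> M" "(y,q) \<in> M" for x y p q using M that unfolding ok_def by blast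
  have M1: "p = 0" if "(\<one>, p) \<in> M" for p using M that unfolding ok_def by blast
  have M10: "(\<one>, 0) \<in> M" using Md[OF Mz Mz] zG by simp
  have Mi: "(inv x, - p) \<in> M" if "(x,p) \<in> M" for x p
    using Md[OF M10 that] MZ[OF that] ZG by (auto simp: subset_iff)
  have Mm: "(x \<otimes> y, p + q) \<in> M" if "(x,p) \<in> M" "(y,q) \<in> M" for x y p q
    using Md[OF that(1) Mi[OF that(2)]] MZ[OF that(2)] ZG by (auto simp: subset_iff)
  have Mpn: "(x [^] (n::nat), of_nat n * p) \<in> M" if "(x,p) \<in> M" for x p n
  proof (induction n)
    case (Suc n)
    then show ?case using Mm[OF Suc that] by (simp add: algebra_simps)
  qed (use M10 in simp)
  have Mp: "(x [^] (n::int), of_int n * p) \<in> M" if xp: "(x,p) \<in> M" for x p n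
  proof (cases "n \<ge> 0")
    case True
    then show ?thesis using Mpn[OF xp, of "nat n"]
      by (metis int_pow_int of_int_of_nat_eq zero_le_imp_eq_int nat_int)
  next
    case False
    have "x [^] n = inv (x [^] nat (- n))" using False unfolding int_pow_def2 by (simp only: not_le if_True)
    moreover have "of_int n * p = - (of_nat (nat (- n)) * p)" using False by simp
    ultimately show ?thesis using Mi[OF Mpn[OF xp, of "nat (-n)"]] by (simp only:)
  qed
  have fn: "p = q" if "(x,p) \<in> M" "(x,q) \<in> M" for x p q
    using M1[of "p - q"] Md[OF that] MZ[OF that(1)] ZG by (auto simp: subset_iff)
  have total: "\<exists>p. (y, p) \<in> M" if y: "y \<in> Z" for y
  proof -
    have yG: "y \<in> carrier G" using y ZG by auto
    \<comment> \<open>The value \<open>q\<close> to be given to \<open>y\<close>: if some positive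
      power \<open>y [^] m\<close> already has a value \<open>p\<close>, divisibility allows the
      forced choice \<open>p / m\<close>; otherwise there is no constraint and 0 will do.\<close>
    have "\<exists>q. \<forall>n p. (y [^] (n::int), p) \<in> M \<longrightarrow> p = of_int n * q"
    proof (cases "\<exists>m p. m > 0 \<and> (y [^] (m::int), p) \<in> M")
      case True
      then obtain m p where m: "m > 0" "(y [^] (m::int), p) \<in> M" by auto
      have "p' = of_int n * (p / of_int m)" if n: "(y [^] (n::int), p') \<in> M" for n p'
      proof -
        have "(y [^] (m * n), of_int n * p) \<in> M" "(y [^] (m * n), of_int m * p') \<in> M"
          using Mp[OF m(2), of n] Mp[OF n, of m] yG by (simp_all add: int_pow_pow mult.commute)
        then have "of_int n * p = of_int m * p'" using fn by blast
        then show ?thesis using m by (simp add: field_simps)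
      qed
      then show ?thesis by blast
    next
      case False
      have "p = of_int n * 0" if n: "(y [^] (n::int), p) \<in> M" for n p
      proof -
        have "(y [^] (- n), - p) \<in> M" using Mi[OF n] yG by (simp add: int_pow_neg)
        then have "n = 0" using False n by (metis linorder_neqE_linordered_idom neg_0_less_iff_less)
        then show ?thesis using M1 n by simp
      qed
      then show ?thesis by blast
    qed
    then obtain q where q: "\<And>n p. (y [^] (n::int), p) \<in> M \<Longrightarrow> p = of_int n * q" by blast
    define M' where "M' = {(x \<otimes> y [^] (n::int), p + of_int n * q) | x p n. (x, p) \<in> M}"
    have sub: "M \<subseteq> M'"
    proof
      fix t assume t: "t \<in> M"
      obtain x p where xp: "t = (x, p)" by fastforce
      moreover have "x \<in> carrier G" using t xp MZ ZG by blast
      ultimately show "t \<in> M'" unfolding M'_def using t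
        by (auto intro!: exI[of _ x] exI[of _ p] exI[of _ "0::int"])
    qed
    have "ok M'" unfolding ok_def
    proof (intro conjI allI impI)
      show "M' \<subseteq> Z \<times> UNIV" unfolding M'_def using MZ Zpow[OF y] Zm by auto
      show "(z, 1) \<in> M'" using sub Mz by auto
      fix x p x' p' assume "(x, p) \<in> M'" "(x', p') \<in> M'"
      then obtain a r m b s n where ab: "(a, r) \<in> M" "(b, s) \<in> M"
        and x: "x = a \<otimes> y [^] (m::int)" "p = r + of_int m * q" and x': "x' = b \<otimes> y [^] (n::int)" "p' = s + of_int n * q"
        unfolding M'_def by blast
      have Zs: "a \<in> Z" "b \<in> Z" "y [^] m \<in> Z" "y [^] n \<in> Z" using MZ ab Zpow[OF y] by auto
      then have G: "a \<in> carrier G" "b \<in> carrier G" "y [^] m \<in> carrier G" "y [^] n \<in> carrier G" using ZG by auto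
      have "x \<otimes> inv x' = a \<otimes> (y [^] m \<otimes> inv (y [^] n) \<otimes> inv b)"
        using x x' G by (simp add: inv_mult_group m_assoc)
      also have "\<dots> = a \<otimes> (inv b \<otimes> (y [^] m \<otimes> inv (y [^] n)))"
        using comm[of "y [^] m \<otimes> inv (y [^] n)" "inv b"] Zs Zm Zinv by auto
      also have "\<dots> = (a \<otimes> inv b) \<otimes> y [^] (m - n)" using G yG by (simp add: int_pow_diff m_assoc)
      finally show "(x \<otimes> inv x', p - p') \<in> M'"
        unfolding M'_def using Md[OF ab] x x' by (intro CollectI exI[of _ "a \<otimes> inv b"] exI[of _ "r - s"] exI[of _ "m - n"])
          (auto simp: algebra_simps)
    next
      fix p assume "(\<one>, p) \<in> M'"
      then obtain a r m where a: "(a, r) \<in> M" "\<one> = a \<otimes> y [^] (m::int)" "p = r + of_int m * q" unfolding M'_def by auto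
      have aG: "a \<in> carrier G" using MZ a ZG by auto
      have "a = y [^] (- m)" using a(2) aG yG by (metis int_pow_closed int_pow_neg inv_equality)
      then have "r = of_int (- m) * q" using q a(1) by blast
      then show "p = 0" using a by simp
    qed
    then have "M' = M" using max sub by blast
    moreover have "(y, q) \<in> M'" unfolding M'_def using M10 yG
      by (intro CollectI exI[of _ \<one>] exI[of _ 0] exI[of _ "1::int"]) auto
    ultimately show ?thesis by auto
  qed
  define \<psi> where "\<psi> x = (SOME p. (x, p) \<in> M)" for x
  have \<psi>: "(x, \<psi> x) \<in> M" if "x \<in> Z" for x unfolding \<psi>_def using total[OF that] by (rule someI_ex)
  have "additive_on Z \<psi>" unfolding additive_on_def
    using fn[OF \<psi> Mm[OF \<psi> \<psi>]] Zm by blast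
  moreover have "\<psi> z = 1" using fn[OF \<psi>[OF z(1)] Mz] .
  ultimately show ?thesis by (intro exI[of _ \<psi>]) auto
qed

text \<open>The transfer to the center composed with a rational character.\<close>

lemma additive_on_generate_nonzero:
  assumes fin: "finite \<Omega>" and \<Omega>G: "\<Omega> \<subseteq> carrier G"
    and conj: "\<And>v x. v \<in> generate G \<Omega> \<Longrightarrow> x \<in> \<Omega> \<Longrightarrow> v \<otimes> x \<otimes> inv v \<in> \<Omega>"
    and x: "x \<in> generate G \<Omega>" "\<And>k. k > 0 \<Longrightarrow> x [^] (k::nat) \<noteq> \<one>"
  shows "\<exists>\<phi>. additive_on (generate G \<Omega>) \<phi> \<and> \<phi> x \<noteq> 0"
proof -
  define V where "V = generate G \<Omega>"
  have V: "subgroup V G" unfolding V_def using generate_is_subgroup[OF \<Omega>G] .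
  have VG: "v \<in> carrier G" if "v \<in> V" for v by (rule subgroup.mem_carrier[OF V that])
  have Vm: "v \<otimes> v' \<in> V" if "v \<in> V" "v' \<in> V" for v v' by (rule subgroup.m_closed[OF V that])
  have Vi: "inv v \<in> V" if "v \<in> V" for v by (rule subgroup.m_inv_closed[OF V that])
  define Z where "Z = {v \<in> V. \<forall>y\<in>\<Omega>. v \<otimes> y = y \<otimes> v}"
  have ZV: "v \<in> V" if "v \<in> Z" for v using that unfolding Z_def by auto
  have Zc: "v \<otimes> y = y \<otimes> v" if v: "v \<in> Z" and y: "y \<in> V" for v y
    using y unfolding V_def
  proof (induction rule: generate.induct)
    case one
    then show ?case using v ZV VG by auto
  next
    case (incl h)
    then show ?case using v unfolding Z_def by auto
  next
    case (inv h)
    have G: "h \<in> carrier G" "v \<in> carrier G" using inv \<Omega>G v ZV VG by auto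
    have "h \<otimes> v = v \<otimes> h" using inv v unfolding Z_def by auto
    have "v \<otimes> inv h = inv h \<otimes> (h \<otimes> v) \<otimes> inv h" using G by (simp add: group_word)
    also have "\<dots> = inv h \<otimes> (v \<otimes> h) \<otimes> inv h" using \<open>h \<otimes> v = v \<otimes> h\<close> by simp
    also have "\<dots> = inv h \<otimes> v" using G by (simp add: m_assoc)
    finally show ?case .
  next
    case (eng a b)
    have G: "a \<in> carrier G" "b \<in> carrier G" "v \<in> carrier G" using eng V VG v ZV unfolding V_def by auto
    then show ?case using eng.IH by (metis m_assoc)
  qed
  have Z: "subgroup Z G"
  proof (rule subgroupI)
    show "Z \<subseteq> carrier G" using ZV VG by auto
    show "Z \<noteq> {}" unfolding Z_def using V \<Omega>G subgroup.one_closed by fastforce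
    fix a assume a: "a \<in> Z"
    have "inv a \<otimes> y = y \<otimes> inv a" if "y \<in> \<Omega>" for y
    proof -
      have G: "a \<in> carrier G" "y \<in> carrier G" using a ZV VG that \<Omega>G by auto
      have e: "a \<otimes> y = y \<otimes> a" using a that unfolding Z_def by auto
      have "inv a \<otimes> y = inv a \<otimes> (y \<otimes> a) \<otimes> inv a" using G by (simp add: m_assoc)
      also have "\<dots> = inv a \<otimes> (a \<otimes> y) \<otimes> inv a" using e by simp
      also have "\<dots> = y \<otimes> inv a" using G by (simp add: group_word)
      finally show ?thesis .
    qed
    then show "inv a \<in> Z" unfolding Z_def using a ZV Vi by auto
    fix b assume b: "b \<in> Z"
    have "a \<otimes> b \<otimes> y = y \<otimes> (a \<otimes> b)" if "y \<in> \<Omega>" for y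

    proof -
      have G: "a \<in> carrier G" "b \<in> carrier G" "y \<in> carrier G" using a b ZV VG that \<Omega>G by auto
      have "a \<otimes> y = y \<otimes> a" "b \<otimes> y = y \<otimes> b" using a b that unfolding Z_def by auto
      then show ?thesis using G by (metis m_assoc)
    qed
    then show "a \<otimes> b \<in> Z" unfolding Z_def using a b ZV Vm by auto
  qed
  \<comment> \<open>Conjugation by \<open>v\<close> as a permutation of the finite set \<Omega>. The
    fibers of \<kappa> are the left cosets of the center \<open>Z\<close> of \<open>V\<close>, so
    \<Theta> stands for the quotient of \<open>V\<close> by \<open>Z\<close>, which is thereby
    finite.\<close>
  define \<kappa> where "\<kappa> v = (\<lambda>y\<in>\<Omega>. v \<otimes> y \<otimes> inv v)" for v
  define \<Theta> where "\<Theta> = \<kappa> ` V"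
  have "\<Theta> \<subseteq> \<Omega> \<rightarrow>\<^sub>E \<Omega>" unfolding \<Theta>_def \<kappa>_def using conj unfolding V_def by auto
  then have fin\<Theta>: "finite \<Theta>" using finite_PiE[OF fin, of "\<lambda>_. \<Omega>"] fin finite_subset by blast
  have \<kappa>m: "\<kappa> (v \<otimes> a) = (\<lambda>y\<in>\<Omega>. v \<otimes> \<kappa> a y \<otimes> inv v)" if "v \<in> V" "a \<in> V" for v a
    unfolding \<kappa>_def using VG[OF that(1)] VG[OF that(2)] \<Omega>G
    by (auto simp: m_assoc inv_mult_group subset_iff intro!: restrict_ext)
  have \<kappa>eq: "\<kappa> (v \<otimes> a) = \<kappa> (v \<otimes> b)" if "\<kappa> a = \<kappa> b" "v \<in> V" "a \<in> V" "b \<in> V" for v a b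
    using \<kappa>m that by simp
  have \<kappa>Z: "inv a \<otimes> b \<in> Z" if e: "\<kappa> a = \<kappa> b" and ab: "a \<in> V" "b \<in> V" for a b
  proof -
    have "inv a \<otimes> b \<otimes> y = y \<otimes> (inv a \<otimes> b)" if y: "y \<in> \<Omega>" for y
    proof -
      have G: "a \<in> carrier G" "b \<in> carrier G" "y \<in> carrier G" using ab VG y \<Omega>G by auto
      have "a \<otimes> y \<otimes> inv a = b \<otimes> y \<otimes> inv b" using fun_cong[OF e, of y] y unfolding \<kappa>_def by simp
      then have "inv a \<otimes> (b \<otimes> y \<otimes> inv b) \<otimes> b = inv a \<otimes> (a \<otimes> y \<otimes> inv a) \<otimes> b" by simp
      then show ?thesis using G by (simp add: group_word)
    qed
    then show ?thesis unfolding Z_def using ab Vi Vm by auto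
  qed
  \<comment> \<open>A transversal of the cosets; \<open>act\<close> below is left multiplication on
    cosets.\<close>
  define \<sigma> where "\<sigma> = inv_into V \<kappa>"
  have \<sigma>V: "\<sigma> \<theta> \<in> V" and \<kappa>\<sigma>: "\<kappa> (\<sigma> \<theta>) = \<theta>" if "\<theta> \<in> \<Theta>" for \<theta>
    using that unfolding \<sigma>_def \<Theta>_def by (auto simp: inv_into_into f_inv_into_f)
  define act where "act v \<theta> = \<kappa> (v \<otimes> \<sigma> \<theta>)" for v \<theta>
  have act\<Theta>: "act v \<theta> \<in> \<Theta>" if "v \<in> V" "\<theta> \<in> \<Theta>" for v \<theta>
    unfolding act_def \<Theta>_def using Vm[OF that(1) \<sigma>V[OF that(2)]] by auto
  have act_mult: "act (v \<otimes> w) \<theta> = act v (act w \<theta>)" if "v \<in> V" "w \<in> V" "\<theta> \<in> \<Theta>" for v w \<theta>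
  proof -
    have "\<kappa> (v \<otimes> (w \<otimes> \<sigma> \<theta>)) = \<kappa> (v \<otimes> \<sigma> (act w \<theta>))"
      by (rule \<kappa>eq) (use that act\<Theta> \<sigma>V \<kappa>\<sigma> Vm in \<open>auto simp: act_def\<close>)
    then show ?thesis unfolding act_def[of v] act_def[of "v \<otimes> w"] using that VG \<sigma>V by (simp add: m_assoc)
  qed
  have act_one: "act \<one> \<theta> = \<theta>" if "\<theta> \<in> \<Theta>" for \<theta>
    unfolding act_def using that \<kappa>\<sigma> \<sigma>V VG by simp
  have act_bij: "bij_betw (act w) \<Theta> \<Theta>" if w: "w \<in> V" for w
  proof (rule bij_betwI[of _ _ _ "act (inv w)"])
    show "act w \<in> \<Theta> \<rightarrow> \<Theta>" "act (inv w) \<in> \<Theta> \<rightarrow> \<Theta>" using act\<Theta> w Vi by auto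
    show "act (inv w) (act w \<theta>) = \<theta>" "act w (act (inv w) \<theta>) = \<theta>" if "\<theta> \<in> \<Theta>" for \<theta>
      using act_mult[OF Vi[OF w] w that] act_mult[OF w Vi[OF w] that] act_one[OF that] VG[OF w] by auto
  qed
  have "\<exists>k>0. x [^] (k::nat) \<in> Z"
  proof -
    have xV: "x \<in> V" using x V_def by auto
    have "\<not> inj (\<lambda>i. \<kappa> (x [^] (i::nat)))"
    proof
      assume "inj (\<lambda>i. \<kappa> (x [^] (i::nat)))"
      moreover have "range (\<lambda>i. \<kappa> (x [^] (i::nat))) \<subseteq> \<Theta>"
        unfolding \<Theta>_def using subgroup_nat_pow_closed[OF V xV] by auto
      ultimately show False using fin\<Theta> inj_on_finite infinite_UNIV_nat by blast
    qed
    then obtain i j where "\<kappa> (x [^] (i::nat)) = \<kappa> (x [^] (j::nat))" "i < j"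
      unfolding inj_def by (metis linorder_neqE_nat)
    then have "inv (x [^] i) \<otimes> x [^] j \<in> Z" using \<kappa>Z subgroup_nat_pow_closed[OF V xV] by blast
    moreover have "inv (x [^] i) \<otimes> x [^] j = x [^] (j - i)"
      using \<open>i < j\<close> VG[OF xV] nat_pow_mult[of x i "j - i", symmetric] by (simp add: inv_cancel)
    ultimately show ?thesis using \<open>i < j\<close> by (metis zero_less_diff)
  qed
  then obtain k where k: "k > 0" "x [^] (k::nat) \<in> Z" by auto
  have "(x [^] k) [^] m \<noteq> \<one>" if "m > 0" for m :: nat
    using x(2)[of "k * m"] k(1) that VG[of x] x(1) unfolding V_def by (simp add: nat_pow_pow)
  then obtain \<psi> where \<psi>: "additive_on Z \<psi>" "\<psi> (x [^] k) \<noteq> 0"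
    using additive_extension[OF Z _ k(2)] Zc ZV by metis
  \<comment> \<open>The transfer factor: the central element by which
    \<open>v \<otimes> \<sigma> \<theta>\<close> differs from the chosen representative of its
    coset. It satisfies a cocycle rule, and summation of its \<psi>-values over all cosets makes the
    result additive in \<open>v\<close>.\<close>
  define \<tau> where "\<tau> v \<theta> = inv (\<sigma> (act v \<theta>)) \<otimes> v \<otimes> \<sigma> \<theta>" for v \<theta>
  have \<tau>Z: "\<tau> v \<theta> \<in> Z" if "v \<in> V" "\<theta> \<in> \<Theta>" for v \<theta>
  proof -
    have "inv (\<sigma> (act v \<theta>)) \<otimes> (v \<otimes> \<sigma> \<theta>) \<in> Z"
      by (rule \<kappa>Z) (use that act\<Theta> \<sigma>V \<kappa>\<sigma> Vm in \<open>auto simp: act_def\<close>)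
    then show ?thesis unfolding \<tau>_def using that VG \<sigma>V act\<Theta> by (simp add: m_assoc)
  qed
  define \<phi> where "\<phi> v = (\<Sum>\<theta>\<in>\<Theta>. \<psi> (\<tau> v \<theta>))" for v
  have "additive_on V \<phi>" unfolding additive_on_def
  proof (intro ballI)
    fix v w assume vw: "v \<in> V" "w \<in> V"
    have "\<tau> (v \<otimes> w) \<theta> = \<tau> v (act w \<theta>) \<otimes> \<tau> w \<theta>" if \<theta>: "\<theta> \<in> \<Theta>" for \<theta>
    proof -
      define a b c where "a = \<sigma> (act v (act w \<theta>))" and "b = \<sigma> (act w \<theta>)" and "c = \<sigma> \<theta>"
      have G: "a \<in> carrier G" "b \<in> carrier G" "c \<in> carrier G" "v \<in> carrier G" "w \<in> carrier G"
        unfolding a_def b_def c_def using vw \<theta> act\<Theta> \<sigma>V VG by auto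
      have "inv a \<otimes> (v \<otimes> w) \<otimes> c = inv a \<otimes> v \<otimes> b \<otimes> (inv b \<otimes> w \<otimes> c)"
        using G by (simp add: group_word)
      then show ?thesis unfolding \<tau>_def act_mult[OF vw \<theta>] a_def b_def c_def .
    qed
    then have "\<phi> (v \<otimes> w) = (\<Sum>\<theta>\<in>\<Theta>. \<psi> (\<tau> v (act w \<theta>)) + \<psi> (\<tau> w \<theta>))"
      unfolding \<phi>_def using additive_on_mult[OF \<psi>(1)] \<tau>Z vw act\<Theta> by (intro sum.cong) auto
    also have "\<dots> = \<phi> v + \<phi> w"
      unfolding sum.distrib \<phi>_def using sum.reindex_bij_betw[OF act_bij[OF vw(2)], of "\<lambda>\<theta>. \<psi> (\<tau> v \<theta>)"] by simp
    finally show "\<phi> (v \<otimes> w) = \<phi> v + \<phi> w" .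
  qed
  \<comment> \<open>A central element fixes every coset and is its own transfer factor, so the
    transfer multiplies \<psi> by the index of the center, which is positive.\<close>
  moreover have "\<phi> (x [^] k) = of_nat (card \<Theta>) * \<psi> (x [^] k)"
  proof -
    have "\<tau> (x [^] k) \<theta> = x [^] k" if \<theta>: "\<theta> \<in> \<Theta>" for \<theta>
    proof -
      have V': "x [^] k \<in> V" "\<sigma> \<theta> \<in> V" using k ZV \<sigma>V \<theta> by auto
      then have G: "x [^] k \<in> carrier G" "\<sigma> \<theta> \<in> carrier G" using VG by auto
      have c: "x [^] k \<otimes> y = y \<otimes> x [^] k" if "y \<in> V" for y using Zc k that by auto
      have "\<kappa> (x [^] k \<otimes> \<sigma> \<theta>) = \<kappa> (\<sigma> \<theta> \<otimes> x [^] k)" using c V' by auto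
      also have "\<dots> = \<kappa> (\<sigma> \<theta> \<otimes> \<one>)"
      proof (rule \<kappa>eq)
        show "\<kappa> (x [^] k) = \<kappa> \<one>" unfolding \<kappa>_def
        proof (rule restrict_ext)
          fix y assume y: "y \<in> \<Omega>"
          then have "y \<in> V" "y \<in> carrier G" unfolding V_def using generate.incl \<Omega>G by auto
          then show "x [^] k \<otimes> y \<otimes> inv (x [^] k) = \<one> \<otimes> y \<otimes> inv \<one>" using c G by (simp add: m_assoc)
        qed
      qed (use V' V subgroup.one_closed in auto)
      also have "\<dots> = \<theta>" using G \<kappa>\<sigma> \<theta> by simp
      finally have "act (x [^] k) \<theta> = \<theta>" unfolding act_def .
      then show ?thesis unfolding \<tau>_def using G c[OF V'(2)] by (simp add: group_word)
    qed
    then show ?thesis unfolding \<phi>_def by simp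
  qed
  moreover have "card \<Theta> \<noteq> 0" using fin\<Theta> V subgroup.one_closed[OF V] unfolding \<Theta>_def by auto
  ultimately have "\<phi> (x [^] k) \<noteq> 0" using \<psi> by simp
  then have "\<phi> x \<noteq> 0" using additive_on_pow[OF \<open>additive_on V \<phi>\<close> V] x(1) unfolding V_def by auto
  then show ?thesis using \<open>additive_on V \<phi>\<close> unfolding V_def by auto
qed

text \<open>Given a character \<phi> that is nonzero on the old elements and \<psi> that is nonzero
  at the new one, \<open>\<psi> + c * \<phi>\<close> works for all but finitely many rational
  \<open>c\<close>: each element with nonzero \<phi>-value excludes one \<open>c\<close>.\<close>

lemma additive_on_avoid:
  assumes "finite D" "D \<subseteq> V" "\<And>d. d \<in> D \<Longrightarrow> \<exists>\<phi>. additive_on V \<phi> \<and> \<phi> d \<noteq> 0"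
  shows "\<exists>\<phi>. additive_on V \<phi> \<and> (\<forall>d\<in>D. \<phi> d \<noteq> 0)"
  using assms
proof (induction D rule: finite_induct)
  case empty
  then show ?case by (intro exI[of _ "\<lambda>_. 0"]) (auto simp: additive_on_def)
next
  case (insert d D)
  then obtain \<phi> where \<phi>: "additive_on V \<phi>" "\<And>x. x \<in> D \<Longrightarrow> \<phi> x \<noteq> 0" by auto
  obtain \<psi> where \<psi>: "additive_on V \<psi>" "\<psi> d \<noteq> 0" using insert.prems by auto
  have "finite ((\<lambda>x. - \<psi> x / \<phi> x) ` (insert d D))" using insert by auto
  then obtain c where c: "c \<notin> (\<lambda>x. - \<psi> x / \<phi> x) ` (insert d D)"
    using ex_new_if_finite[OF infinite_UNIV_char_0] by blast
  have "\<psi> x + c * \<phi> x \<noteq> 0" if "x \<in> insert d D" for x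
  proof (cases "\<phi> x = 0")
    case True
    then show ?thesis using \<phi>(2) \<psi>(2) that by auto
  next
    case False
    have "c \<noteq> - \<psi> x / \<phi> x" using c that by blast
    then show ?thesis using False by (auto simp: field_simps add_eq_0_iff)
  qed
  moreover have "additive_on V (\<lambda>x. \<psi> x + c * \<phi> x)"
    using \<phi>(1) \<psi>(1) unfolding additive_on_def by (auto simp: algebra_simps)
  ultimately show ?case by (intro exI[of _ "\<lambda>x. \<psi> x + c * \<phi> x"]) auto
qed

end

section \<open>Rings graded by a group\<close>

text \<open>Elements are families of coefficients with pointwise addition; \<open>mult_supp\<close>
  is all that is required of the grading. The pair in \<open>local_units\<close> replaces an
  invertible element of degree \<open>c\<close>: its product in one order is a left identity, in the
  other order a right identity on the component of degree \<open>c\<close>.\<close>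

locale graded = S: ring S + G: group G + R: abelian_group R
  for S :: "('g \<Rightarrow> 'r) ring" (structure)
    and G :: "('g, 'm) monoid_scheme" and R :: "('r, 'n) ring_scheme" +
  assumes coeff: "f \<in> carrier S \<Longrightarrow> f x \<in> carrier R"
    and finite_supp: "f \<in> carrier S \<Longrightarrow> finite (supp R f)"
    and supp_carrier: "f \<in> carrier S \<Longrightarrow> f x \<noteq> \<zero>\<^bsub>R\<^esub> \<Longrightarrow> x \<in> carrier G"
    and cut_mem: "f \<in> carrier S \<Longrightarrow> (\<lambda>x. if x \<in> E then f x else \<zero>\<^bsub>R\<^esub>) \<in> carrier S"
    and zero_fun: "\<zero> = (\<lambda>_. \<zero>\<^bsub>R\<^esub>)"
    and add_fun: "f \<in> carrier S \<Longrightarrow> g \<in> carrier S \<Longrightarrow> f \<oplus> g = (\<lambda>x. f x \<oplus>\<^bsub>R\<^esub> g x)"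
    and one_supp: "\<one> x \<noteq> \<zero>\<^bsub>R\<^esub> \<Longrightarrow> x = \<one>\<^bsub>G\<^esub>"
    and mult_supp: "f \<in> carrier S \<Longrightarrow> g \<in> carrier S \<Longrightarrow> (f \<otimes> g) p \<noteq> \<zero>\<^bsub>R\<^esub> \<Longrightarrow>
      \<exists>x y. f x \<noteq> \<zero>\<^bsub>R\<^esub> \<and> g y \<noteq> \<zero>\<^bsub>R\<^esub> \<and> p = x \<otimes>\<^bsub>G\<^esub> y"
    and local_units: "c \<in> carrier G \<Longrightarrow>
      \<exists>s\<in>carrier S. \<exists>t\<in>carrier S. supp R s \<subseteq> {c} \<and> supp R t \<subseteq> {inv\<^bsub>G\<^esub> c} \<and>
        (\<forall>f\<in>carrier S. supp R f \<subseteq> {c} \<longrightarrow> s \<otimes> (t \<otimes> f) = f \<and> f \<otimes> t \<otimes> s = f)"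
begin

abbreviation gm (infixl "\<star>" 70) where "x \<star> y \<equiv> x \<otimes>\<^bsub>G\<^esub> y"
abbreviation gi ("\<iota>") where "gi x \<equiv> inv\<^bsub>G\<^esub> x"
abbreviation ge ("\<e>") where "ge \<equiv> \<one>\<^bsub>G\<^esub>"
abbreviation rz ("\<z>") where "rz \<equiv> \<zero>\<^bsub>R\<^esub>"

definition homog :: "'g \<Rightarrow> ('g \<Rightarrow> 'r) set" where
  "homog x = {s \<in> carrier S. supp R s \<subseteq> {x}}"

definition cut :: "'g set \<Rightarrow> ('g \<Rightarrow> 'r) \<Rightarrow> 'g \<Rightarrow> 'r" where
  "cut E f = (\<lambda>x. if x \<in> E then f x else \<z>)"

lemma in_supp: "(x :: 'g) \<in> supp R f \<longleftrightarrow> f x \<noteq> \<z>" by (simp add: supp_def)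

lemma homog_carrier [simp, intro]: "s \<in> homog x \<Longrightarrow> s \<in> carrier S" by (simp add: homog_def)

lemma homogD: "s \<in> homog x \<Longrightarrow> s y \<noteq> \<z> \<Longrightarrow> y = x"
  unfolding homog_def supp_def by blast

lemma homogI: "s \<in> carrier S \<Longrightarrow> (\<And>y. s y \<noteq> \<z> \<Longrightarrow> y = x) \<Longrightarrow> s \<in> homog x"
  unfolding homog_def supp_def by blast

lemma zero_apply: "\<zero> x = \<z>" by (simp add: zero_fun)

lemma add_apply: "f \<in> carrier S \<Longrightarrow> g \<in> carrier S \<Longrightarrow> (f \<oplus> g) x = f x \<oplus>\<^bsub>R\<^esub> g x"
  by (simp add: add_fun)

lemma minus_apply: "f \<in> carrier S \<Longrightarrow> (\<ominus> f) x = \<ominus>\<^bsub>R\<^esub> f x"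
proof -
  assume f: "f \<in> carrier S"
  have "(\<ominus> f \<oplus> f) x = \<z>" using f by (simp add: S.l_neg zero_apply)
  then have "(\<ominus> f) x \<oplus>\<^bsub>R\<^esub> f x = \<z>" using f by (simp add: add_apply)
  then show ?thesis using f R.minus_equality coeff by (metis S.a_inv_closed)
qed

lemma minus_apply_eq_zero: "f \<in> carrier S \<Longrightarrow> (\<ominus> f) x = \<z> \<longleftrightarrow> f x = \<z>"
  using minus_apply[of f x] coeff[of f x] R.minus_minus[of "f x"] R.minus_equality[of \<z> \<z>] by fastforce

lemma zeroI: "f \<in> carrier S \<Longrightarrow> (\<And>x. f x = \<z>) \<Longrightarrow> f = \<zero>"
  by (auto simp: zero_fun)

lemma nonzeroE:
  assumes "f \<in> carrier S" "f \<noteq> \<zero>" obtains x where "x \<in> carrier G" "f x \<noteq> \<z>"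
  using assms zeroI supp_carrier by blast

lemma nonzeroI: "f x \<noteq> \<z> \<Longrightarrow> f \<noteq> \<zero>" by (auto simp: zero_fun)

lemma homog_nonzero: "s \<in> homog x \<Longrightarrow> s \<noteq> \<zero> \<Longrightarrow> s x \<noteq> \<z>"
  using homogD zeroI homog_carrier by metis

lemma homog_nonzero_carrier: "s \<in> homog x \<Longrightarrow> s \<noteq> \<zero> \<Longrightarrow> x \<in> carrier G"
  using homog_nonzero supp_carrier homog_carrier by metis

lemma cut_closed [simp, intro]: "f \<in> carrier S \<Longrightarrow> cut E f \<in> carrier S"
  using cut_mem by (simp add: cut_def)

lemma cut_apply: "cut E f x = (if x \<in> E then f x else \<z>)" by (simp add: cut_def)

lemma cut_split: "f \<in> carrier S \<Longrightarrow> f = cut E f \<oplus> cut (- E) f"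
proof -
  assume f: "f \<in> carrier S"
  have "f x = (cut E f \<oplus> cut (- E) f) x" for x
    unfolding add_apply[OF cut_closed[OF f] cut_closed[OF f]] using coeff[OF f] by (simp add: cut_apply)
  then show ?thesis by auto
qed

lemma cut_add:
  assumes "f \<in> carrier S" "g \<in> carrier S" shows "cut E (f \<oplus> g) = cut E f \<oplus> cut E g"
proof
  fix x show "cut E (f \<oplus> g) x = (cut E f \<oplus> cut E g) x"
    unfolding add_apply[OF cut_closed[OF assms(1)] cut_closed[OF assms(2)]]
    by (simp add: cut_apply add_apply[OF assms])
qed

lemma cut_id: "f \<in> carrier S \<Longrightarrow> (\<And>x. f x \<noteq> \<z> \<Longrightarrow> x \<in> E) \<Longrightarrow> cut E f = f"
  unfolding cut_def by (rule ext) metis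

lemma cut_homog: "f \<in> carrier S \<Longrightarrow> cut {x} f \<in> homog x"
  by (rule homogI) (auto simp: cut_apply split: if_splits)

lemma homog_zero [simp, intro]: "\<zero> \<in> homog x" by (rule homogI) (simp, simp add: zero_fun)

lemma homog_one [simp, intro]: "\<one> \<in> homog \<e>" using one_supp by (intro homogI) auto

lemma homog_mult [simp, intro]: "s \<in> homog x \<Longrightarrow> t \<in> homog y \<Longrightarrow> s \<otimes> t \<in> homog (x \<star> y)"
proof (rule homogI)
  assume st: "s \<in> homog x" "t \<in> homog y"
  then show "s \<otimes> t \<in> carrier S" by simp
  fix p assume "(s \<otimes> t) p \<noteq> \<z>"
  then obtain u v where "s u \<noteq> \<z>" "t v \<noteq> \<z>" "p = u \<star> v" using mult_supp st homog_carrier by metis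
  then show "p = x \<star> y" using st homogD by metis
qed

lemma homog_mult_eq: "s \<in> homog x \<Longrightarrow> t \<in> homog y \<Longrightarrow> x \<star> y = w \<Longrightarrow> s \<otimes> t \<in> homog w"
  using homog_mult by blast

lemma homog_minus: "s \<in> homog x \<Longrightarrow> \<ominus> s \<in> homog x"
  by (rule homogI) (auto simp: minus_apply_eq_zero dest: homogD)

lemma mult_supp3:
  assumes "f \<in> carrier S" "s \<in> homog u" "g \<in> carrier S" "(f \<otimes> s \<otimes> g) p \<noteq> \<z>"
  obtains x y where "f x \<noteq> \<z>" "g y \<noteq> \<z>" "p = x \<star> u \<star> y" "x \<in> carrier G" "y \<in> carrier G"
proof -
  obtain v y where v: "(f \<otimes> s) v \<noteq> \<z>" "g y \<noteq> \<z>" "p = v \<star> y"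
    using mult_supp[of "f \<otimes> s" g p] assms by auto
  obtain x u' where "f x \<noteq> \<z>" "s u' \<noteq> \<z>" "v = x \<star> u'"
    using mult_supp[of f s v] v assms by auto
  then show thesis using that v homogD assms supp_carrier by metis
qed

text \<open>Only pairs of degrees with \<open>x \<star> u \<star> y = p\<close> contribute to the
  coefficient at \<open>p\<close>. Through this, an identity
  \<open>a \<otimes> s \<otimes> b = \<zero>\<close> passes to parts of \<open>a\<close> and
  \<open>b\<close> whenever the other degrees cannot combine to \<open>p\<close>.\<close>

lemma mult_cut3:
  assumes f: "f \<in> carrier S" and s: "s \<in> homog u" and g: "g \<in> carrier S"
    and only: "\<And>x y. f x \<noteq> \<z> \<Longrightarrow> g y \<noteq> \<z> \<Longrightarrow> x \<star> u \<star> y = p \<Longrightarrow> x \<in> D \<and> y \<in> E"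
  shows "(f \<otimes> s \<otimes> g) p = (cut D f \<otimes> s \<otimes> cut E g) p"
proof -
  let ?f = "cut D f" and ?f' = "cut (- D) f" and ?g = "cut E g" and ?g' = "cut (- E) g"
  have c: "?f \<in> carrier S" "?f' \<in> carrier S" "?g \<in> carrier S" "?g' \<in> carrier S" "s \<in> carrier S"
    using f g s by auto
  have "f \<otimes> s \<otimes> g = ?f \<otimes> s \<otimes> g \<oplus> ?f' \<otimes> s \<otimes> g"
    using c g by (subst cut_split[OF f, of D]) (simp add: S.l_distr)
  also have "?f \<otimes> s \<otimes> g = ?f \<otimes> s \<otimes> ?g \<oplus> ?f \<otimes> s \<otimes> ?g'"
    using c g by (subst cut_split[OF g, of E]) (simp add: S.r_distr)
  finally have e: "f \<otimes> s \<otimes> g = (?f \<otimes> s \<otimes> ?g \<oplus> ?f \<otimes> s \<otimes> ?g') \<oplus> ?f' \<otimes> s \<otimes> g" .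
  have "(?f \<otimes> s \<otimes> ?g') p = \<z>"
  proof (rule ccontr)
    assume "\<not> ?thesis"
    from mult_supp3[OF c(1) s c(4) this] obtain x y
      where "?f x \<noteq> \<z>" "?g' y \<noteq> \<z>" "p = x \<star> u \<star> y" by metis
    then show False using only[of x y] by (auto simp: cut_apply split: if_splits)
  qed
  moreover have "(?f' \<otimes> s \<otimes> g) p = \<z>"
  proof (rule ccontr)
    assume "\<not> ?thesis"
    from mult_supp3[OF c(2) s g this] obtain x y
      where "?f' x \<noteq> \<z>" "g y \<noteq> \<z>" "p = x \<star> u \<star> y" by metis
    then show False using only[of x y] by (auto simp: cut_apply split: if_splits)
  qed
  moreover have "(?f \<otimes> s \<otimes> ?g) p \<in> carrier R" using c coeff by simp
  ultimately show ?thesis unfolding e using c g by (simp add: add_apply)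
qed

lemma mult_cut:
  assumes "f \<in> carrier S" "g \<in> carrier S"
    and only: "\<And>x y. f x \<noteq> \<z> \<Longrightarrow> g y \<noteq> \<z> \<Longrightarrow> x \<star> y = p \<Longrightarrow> x \<in> D \<and> y \<in> E"
  shows "(f \<otimes> g) p = (cut D f \<otimes> cut E g) p"
  using mult_cut3[OF assms(1) homog_one assms(2), of p D E] only assms supp_carrier by simp

lemma carrier_induct [consumes 1, case_names zero homog add]:
  assumes "f \<in> carrier S" and "P \<zero>"
    and "\<And>x s. x \<in> carrier G \<Longrightarrow> s \<in> homog x \<Longrightarrow> P s"
    and "\<And>f g. f \<in> carrier S \<Longrightarrow> g \<in> carrier S \<Longrightarrow> P f \<Longrightarrow> P g \<Longrightarrow> P (f \<oplus> g)"
  shows "P f"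
  using assms(1)
proof (induction "card (supp R f)" arbitrary: f rule: less_induct)
  case less
  show ?case
  proof (cases "f = \<zero>")
    case False
    then obtain x where x: "x \<in> carrier G" "f x \<noteq> \<z>" using less.prems nonzeroE by blast
    have "supp R (cut (- {x}) f) \<subseteq> supp R f - {x}" unfolding supp_def cut_def by auto
    then have "supp R (cut (- {x}) f) \<subset> supp R f" using x unfolding supp_def by blast
    then have "P (cut (- {x}) f)"
      using less.hyps[OF psubset_card_mono[OF finite_supp[OF less.prems]]] cut_closed[OF less.prems] by simp
    moreover have "P (cut {x} f)" using assms(3)[OF x(1) cut_homog[OF less.prems]] .
    ultimately show ?thesis
      using assms(4)[of "cut {x} f" "cut (- {x}) f"] cut_split[OF less.prems, of "{x}"] less.prems by simp
  qed (use assms(2) in simp)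
qed

text \<open>If \<open>s \<otimes> t\<close> vanished, so would
  \<open>s = s \<otimes> t \<otimes> a\<close>. The grading is nondegenerate in this sense.\<close>

lemma homog_ex_right:
  assumes "s \<in> homog x" "s \<noteq> \<zero>" obtains t where "t \<in> homog (\<iota> x)" "s \<otimes> t \<noteq> \<zero>"
proof -
  obtain a t where "a \<in> carrier S" "t \<in> carrier S" "supp R t \<subseteq> {\<iota> x}"
      "\<forall>f\<in>carrier S. supp R f \<subseteq> {x} \<longrightarrow> a \<otimes> (t \<otimes> f) = f \<and> f \<otimes> t \<otimes> a = f"
    using local_units[OF homog_nonzero_carrier[OF assms]] by blast
  then have t: "t \<in> homog (\<iota> x)" "s \<otimes> t \<otimes> a = s" "a \<in> carrier S"
    using assms(1) unfolding homog_def by simp_all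
  moreover have "s \<otimes> t \<noteq> \<zero>" using t(2) assms(2) S.l_null[OF t(3)] by metis
  ultimately show thesis using that by simp
qed

lemma homog_ex_left:
  assumes "s \<in> homog x" "s \<noteq> \<zero>" obtains t where "t \<in> homog (\<iota> x)" "t \<otimes> s \<noteq> \<zero>"
proof -
  obtain a t where "a \<in> carrier S" "t \<in> carrier S" "supp R t \<subseteq> {\<iota> x}"
      "\<forall>f\<in>carrier S. supp R f \<subseteq> {x} \<longrightarrow> a \<otimes> (t \<otimes> f) = f \<and> f \<otimes> t \<otimes> a = f"
    using local_units[OF homog_nonzero_carrier[OF assms]] by blast
  then have t: "t \<in> homog (\<iota> x)" "a \<otimes> (t \<otimes> s) = s" "a \<in> carrier S"
    using assms(1) unfolding homog_def by simp_all
  moreover have "t \<otimes> s \<noteq> \<zero>" using t(2) assms(2) S.r_null[OF t(3)] by metis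
  ultimately show thesis using that by simp
qed

lemma apply_mult_right:
  assumes "f \<in> carrier S" "t \<in> homog y" "x \<in> carrier G" "y \<in> carrier G"
  shows "(f \<otimes> t) (x \<star> y) = (cut {x} f \<otimes> t) (x \<star> y)"
proof -
  have "(f \<otimes> t) (x \<star> y) = (cut {x} f \<otimes> cut UNIV t) (x \<star> y)"
  proof (rule mult_cut)
    fix u v assume "f u \<noteq> \<z>" "t v \<noteq> \<z>" "u \<star> v = x \<star> y"
    moreover have "u \<in> carrier G" "v = y" using calculation supp_carrier[OF assms(1)] homogD[OF assms(2)] by blast+
    ultimately show "u \<in> {x} \<and> v \<in> UNIV" using assms by simp
  qed (use assms in auto)
  then show ?thesis by (simp add: cut_def)
qed

lemma apply_mult_left:
  assumes "f \<in> carrier S" "t \<in> homog y" "x \<in> carrier G" "y \<in> carrier G"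
  shows "(t \<otimes> f) (y \<star> x) = (t \<otimes> cut {x} f) (y \<star> x)"
proof -
  have "(t \<otimes> f) (y \<star> x) = (cut UNIV t \<otimes> cut {x} f) (y \<star> x)"
  proof (rule mult_cut)
    fix v u assume "f u \<noteq> \<z>" "t v \<noteq> \<z>" "v \<star> u = y \<star> x"
    moreover have "u \<in> carrier G" "v = y" using calculation supp_carrier[OF assms(1)] homogD[OF assms(2)] by blast+
    ultimately show "v \<in> UNIV \<and> u \<in> {x}" using assms by simp
  qed (use assms in auto)
  then show ?thesis by (simp add: cut_def)
qed

lemma cut_single_nonzero: "f x \<noteq> \<z> \<Longrightarrow> cut {x} f \<noteq> \<zero>"
  by (rule nonzeroI[of _ x]) (simp add: cut_apply)

text \<open>Right multiplication by a homogeneous element translates degrees without mixing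
  coefficients, so it suffices to keep the chosen coefficient nonzero while it moves to the
  identity.\<close>

lemma shift_right:
  assumes f: "f \<in> carrier S" "f x \<noteq> \<z>"
  obtains t where "t \<in> homog (\<iota> x)" "(f \<otimes> t) \<e> \<noteq> \<z>"
proof -
  have x: "x \<in> carrier G" using f supp_carrier by blast
  obtain t where t: "t \<in> homog (\<iota> x)" "cut {x} f \<otimes> t \<noteq> \<zero>"
    using homog_ex_right[OF cut_homog[OF f(1)] cut_single_nonzero[of f x]] f(2) by metis
  have "cut {x} f \<otimes> t \<in> homog \<e>" by (rule homog_mult_eq[OF cut_homog[OF f(1)] t(1)]) (simp add: x)
  then have "(cut {x} f \<otimes> t) \<e> \<noteq> \<z>" using homog_nonzero t by blast
  then show thesis using that[OF t(1)] apply_mult_right[OF f(1) t(1) x] x by simp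
qed

section \<open>Ideals generated by a separating element\<close>

definition separating :: "'g set \<Rightarrow> ('g \<Rightarrow> 'r) \<Rightarrow> bool" where
  "separating H j \<longleftrightarrow> subgroup H G \<and> j \<in> homog \<e> \<and>
    (\<forall>x\<in>carrier G - H. \<forall>s\<in>homog x. j \<otimes> s \<otimes> j = \<zero>)"

text \<open>The multipliers are homogeneous, so each generator is homogeneous of degree in
  \<open>H\<close>. Closure under projections to sets of degrees rests on this.\<close>

inductive_set gen :: "'g set \<Rightarrow> ('g \<Rightarrow> 'r) \<Rightarrow> ('g \<Rightarrow> 'r) set" for H j where
  gen_zero: "\<zero> \<in> gen H j"
| gen_incl: "s \<in> homog h \<Longrightarrow> t \<in> homog k \<Longrightarrow> h \<in> H \<Longrightarrow> k \<in> H \<Longrightarrow> s \<otimes> j \<otimes> t \<in> gen H j"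
| gen_add: "a \<in> gen H j \<Longrightarrow> b \<in> gen H j \<Longrightarrow> a \<oplus> b \<in> gen H j"

context
  fixes H j assumes separating: "separating H j"
begin

lemma H_sub: "subgroup H G" using separating by (simp add: separating_def)
lemma H_carrier: "x \<in> H \<Longrightarrow> x \<in> carrier G" using subgroup.mem_carrier[OF H_sub] .
lemma j_homog: "j \<in> homog \<e>" using separating by (simp add: separating_def)
lemma j_carrier: "j \<in> carrier S" using j_homog by blast
lemma j_kill: "x \<in> carrier G \<Longrightarrow> x \<notin> H \<Longrightarrow> s \<in> homog x \<Longrightarrow> j \<otimes> s \<otimes> j = \<zero>"
  using separating by (simp add: separating_def)

lemma gen_carrier: "a \<in> gen H j \<Longrightarrow> a \<in> carrier S"
  by (induction rule: gen.induct) (use j_carrier in auto)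

lemma gen_incl_homog:
  assumes "s \<in> homog h" "t \<in> homog k" "h \<in> H" "k \<in> H" shows "s \<otimes> j \<otimes> t \<in> homog (h \<star> k)"
proof -
  have "s \<otimes> j \<in> homog h" by (rule homog_mult_eq[OF assms(1) j_homog]) (simp add: assms H_carrier)
  then show ?thesis using assms by auto
qed

lemma gen_supp: "a \<in> gen H j \<Longrightarrow> a x \<noteq> \<z> \<Longrightarrow> x \<in> H"
proof (induction arbitrary: x rule: gen.induct)
  case (gen_incl s h t k)
  then have "x = h \<star> k" using gen_incl_homog homogD by blast
  then show ?case using gen_incl subgroup.m_closed[OF H_sub] by simp
next
  case (gen_add a b)
  then have "a x \<noteq> \<z> \<or> b x \<noteq> \<z>" using gen_carrier by (auto simp: add_apply)
  then show ?case using gen_add by auto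
qed (simp add: zero_apply)

lemma gen_left: "a \<in> gen H j \<Longrightarrow> r \<in> homog u \<Longrightarrow> u \<in> H \<Longrightarrow> r \<otimes> a \<in> gen H j"
proof (induction rule: gen.induct)
  case gen_zero
  then show ?case using gen.gen_zero by auto
next
  case (gen_incl s h t k)
  have "r \<otimes> (s \<otimes> j \<otimes> t) = (r \<otimes> s) \<otimes> j \<otimes> t"
    using gen_incl j_carrier by (simp add: S.m_assoc homog_carrier)
  then show ?case using gen.gen_incl[OF homog_mult[OF gen_incl(5,1)] gen_incl(2)] gen_incl
      subgroup.m_closed[OF H_sub] by simp
next
  case (gen_add a b)
  then show ?case using gen.gen_add gen_carrier by (simp add: S.r_distr homog_carrier)
qed

lemma gen_right: "a \<in> gen H j \<Longrightarrow> r \<in> homog u \<Longrightarrow> u \<in> H \<Longrightarrow> a \<otimes> r \<in> gen H j"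
proof (induction rule: gen.induct)
  case gen_zero
  then show ?case using gen.gen_zero by auto
next
  case (gen_incl s h t k)
  have "(s \<otimes> j \<otimes> t) \<otimes> r = s \<otimes> j \<otimes> (t \<otimes> r)"
    using gen_incl j_carrier by (simp add: S.m_assoc homog_carrier)
  then show ?case using gen.gen_incl[OF gen_incl(1) homog_mult[OF gen_incl(2,5)]] gen_incl
      subgroup.m_closed[OF H_sub] by simp
next
  case (gen_add a b)
  then show ?case using gen.gen_add gen_carrier by (simp add: S.l_distr homog_carrier)
qed

lemma gen_minus: "a \<in> gen H j \<Longrightarrow> \<ominus> a \<in> gen H j"
proof -
  assume a: "a \<in> gen H j"
  have "(\<ominus> \<one>) \<otimes> a \<in> gen H j"
    by (rule gen_left[OF a homog_minus[OF homog_one] subgroup.one_closed[OF H_sub]])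
  then show ?thesis using gen_carrier[OF a] by (simp add: S.l_minus)
qed

lemma gen_cut: "a \<in> gen H j \<Longrightarrow> cut E a \<in> gen H j"
proof (induction rule: gen.induct)
  case gen_zero
  have "cut E \<zero> = \<zero>" by (auto simp: cut_def zero_fun)
  then show ?case using gen.gen_zero by simp
next
  case (gen_incl s h t k)
  have "cut E (s \<otimes> j \<otimes> t) = s \<otimes> j \<otimes> t \<or> cut E (s \<otimes> j \<otimes> t) = \<zero>"
  proof (cases "h \<star> k \<in> E")
    case True
    have "s \<otimes> j \<otimes> t \<in> carrier S" using gen_incl_homog[OF gen_incl] by simp
    then have "cut E (s \<otimes> j \<otimes> t) = s \<otimes> j \<otimes> t"
      using True homogD[OF gen_incl_homog[OF gen_incl]] by (intro cut_id) auto
    then show ?thesis by simp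
  next
    case False
    have "cut E (s \<otimes> j \<otimes> t) = \<zero>" unfolding cut_def zero_fun
      using False homogD[OF gen_incl_homog[OF gen_incl]] by (intro ext) metis
    then show ?thesis by simp
  qed
  then show ?case using gen_incl gen.intros by metis
next
  case (gen_add a b)
  have "cut E (a \<oplus> b) = cut E a \<oplus> cut E b"
    using gen_carrier[OF gen_add(1)] gen_carrier[OF gen_add(2)] by (rule cut_add)
  then show ?case using gen_add gen.gen_add by simp
qed

lemma gen_mult: "a \<in> gen H j \<Longrightarrow> b \<in> gen H j \<Longrightarrow> a \<otimes> b \<in> gen H j"
proof (induction rule: gen.induct)
  case gen_zero
  then show ?case using gen.gen_zero gen_carrier by simp
next
  case (gen_incl s h t k)
  have "s \<otimes> (j \<otimes> (t \<otimes> b)) \<in> gen H j"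
    using gen_left[OF gen_left[OF gen_left[OF gen_incl(5,2,4)] j_homog subgroup.one_closed[OF H_sub]] gen_incl(1,3)] .
  then show ?case using gen_incl gen_carrier[OF gen_incl(5)] j_carrier by (simp add: S.m_assoc homog_carrier)
next
  case (gen_add a c)
  then show ?case using gen.gen_add gen_carrier by (simp add: S.l_distr)
qed

lemma gen_kill1: "b \<in> gen H j \<Longrightarrow> x \<in> carrier G \<Longrightarrow> x \<notin> H \<Longrightarrow> r \<in> homog x \<Longrightarrow> j \<otimes> r \<otimes> b = \<zero>"
proof (induction rule: gen.induct)
  case (gen_incl s h t k)
  have "x \<star> h \<notin> H" using gen_incl H_carrier subgroup.m_inv_closed[OF H_sub] subgroup.m_closed[OF H_sub]
    by (metis G.inv_closed G.m_assoc G.r_inv G.r_one)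
  then have "j \<otimes> (r \<otimes> s) \<otimes> j = \<zero>"
    using j_kill[of "x \<star> h" "r \<otimes> s"] gen_incl H_carrier by auto
  then have "j \<otimes> (r \<otimes> s) \<otimes> j \<otimes> t = \<zero>" using gen_incl by (simp add: homog_carrier)
  then show ?case using gen_incl j_carrier by (simp add: S.m_assoc homog_carrier)
next
  case (gen_add a b)
  then show ?case using gen_carrier j_carrier by (simp add: S.r_distr homog_carrier)
qed (use j_carrier in \<open>simp add: homog_carrier\<close>)

text \<open>Multiplying \<open>x\<close> by elements of \<open>H\<close> on either side does not
  bring it into \<open>H\<close>, so an element of degree outside \<open>H\<close> always stands
  between the two factors \<open>j\<close>. Elements of \<open>gen H j\<close> that annihilate each
  other through the \<open>H\<close>-part therefore do so through the whole ring.\<close>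

lemma gen_kill: "a \<in> gen H j \<Longrightarrow> b \<in> gen H j \<Longrightarrow> x \<in> carrier G \<Longrightarrow> x \<notin> H \<Longrightarrow> r \<in> homog x \<Longrightarrow> a \<otimes> r \<otimes> b = \<zero>"
proof (induction rule: gen.induct)
  case (gen_incl s h t k)
  have "k \<star> x \<notin> H" using gen_incl H_carrier subgroup.m_inv_closed[OF H_sub] subgroup.m_closed[OF H_sub]
    by (metis G.inv_closed G.m_assoc G.l_inv G.l_one)
  then have "j \<otimes> (t \<otimes> r) \<otimes> b = \<zero>"
    using gen_kill1[of b "k \<star> x" "t \<otimes> r"] gen_incl H_carrier by auto
  then have "s \<otimes> (j \<otimes> (t \<otimes> r) \<otimes> b) = \<zero>" using gen_incl by (simp add: homog_carrier)
  then show ?case using gen_incl j_carrier gen_carrier by (simp add: S.m_assoc homog_carrier)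
next
  case (gen_add a b)
  then show ?case using gen_carrier j_carrier by (simp add: S.l_distr homog_carrier)
qed (use j_carrier gen_carrier in \<open>simp add: homog_carrier\<close>)

end

end

section \<open>The FC center\<close>

context group begin

definition conj_by :: "'a \<Rightarrow> 'a \<Rightarrow> 'a" where "conj_by h x = h \<otimes> x \<otimes> inv h"

lemma conj_by_closed [simp, intro]: "h \<in> carrier G \<Longrightarrow> x \<in> carrier G \<Longrightarrow> conj_by h x \<in> carrier G"
  by (simp add: conj_by_def)

lemma conj_by_mult:
  "h \<in> carrier G \<Longrightarrow> x \<in> carrier G \<Longrightarrow> y \<in> carrier G \<Longrightarrow> conj_by h (x \<otimes> y) = conj_by h x \<otimes> conj_by h y"
  by (simp add: conj_by_def group_word)

lemma conj_by_inv: "h \<in> carrier G \<Longrightarrow> x \<in> carrier G \<Longrightarrow> conj_by h (inv x) = inv (conj_by h x)"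
  by (simp add: conj_by_def group_word)

lemma conj_by_conj_by:
  "h \<in> carrier G \<Longrightarrow> k \<in> carrier G \<Longrightarrow> x \<in> carrier G \<Longrightarrow> conj_by h (conj_by k x) = conj_by (h \<otimes> k) x"
  by (simp add: conj_by_def group_word)

lemma conj_by_one [simp]: "h \<in> carrier G \<Longrightarrow> conj_by h \<one> = \<one>" by (simp add: conj_by_def)

lemma one_conj_by [simp]: "x \<in> carrier G \<Longrightarrow> conj_by \<one> x = x" by (simp add: conj_by_def)

text \<open>Unlike the FC center, this set is not confined to \<open>H\<close> and only grows when
  \<open>H\<close> shrinks. It can hold elements outside a subgroup \<open>L\<close> that have
  finitely many conjugates under \<open>L\<close>.\<close>

definition almost_centralizer :: "'a set \<Rightarrow> 'a set" where
  "almost_centralizer H = {x \<in> carrier G. finite ((\<lambda>h. conj_by h x) ` H)}"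

lemma almost_centralizer_I: "x \<in> carrier G \<Longrightarrow> finite F \<Longrightarrow> (\<And>h. h \<in> H \<Longrightarrow> conj_by h x \<in> F) \<Longrightarrow> x \<in> almost_centralizer H"
  unfolding almost_centralizer_def using finite_subset[of "(\<lambda>h. conj_by h x) ` H" F] by blast

lemma almost_centralizer_carrier: "x \<in> almost_centralizer H \<Longrightarrow> x \<in> carrier G" by (simp add: almost_centralizer_def)

lemma almost_centralizer_antimono: "L \<subseteq> H \<Longrightarrow> almost_centralizer H \<subseteq> almost_centralizer L"
  unfolding almost_centralizer_def using finite_subset[OF image_mono[of L H]] by blast

definition FC :: "'a set \<Rightarrow> 'a set" where
  "FC H = {x \<in> H. finite ((\<lambda>h. conj_by h x) ` H)}"

lemma FC_I: "x \<in> H \<Longrightarrow> finite F \<Longrightarrow> (\<And>h. h \<in> H \<Longrightarrow> conj_by h x \<in> F) \<Longrightarrow> x \<in> FC H"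
  unfolding FC_def using finite_subset[of "(\<lambda>h. conj_by h x) ` H" F] by blast

lemma FC_finite: "x \<in> FC H \<Longrightarrow> finite ((\<lambda>h. conj_by h x) ` H)" by (simp add: FC_def)

lemma FC_subset: "x \<in> FC H \<Longrightarrow> x \<in> H" by (simp add: FC_def)

context
  fixes H assumes H: "subgroup H G"
begin

lemma sub_mem: "h \<in> H \<Longrightarrow> h \<in> carrier G" by (rule subgroup.mem_carrier[OF H])
lemma sub_mult: "h \<in> H \<Longrightarrow> k \<in> H \<Longrightarrow> h \<otimes> k \<in> H" by (rule subgroup.m_closed[OF H])
lemma sub_inv: "h \<in> H \<Longrightarrow> inv h \<in> H" by (rule subgroup.m_inv_closed[OF H])
lemma sub_one: "\<one> \<in> H" by (rule subgroup.one_closed[OF H])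
lemma sub_conj: "h \<in> H \<Longrightarrow> k \<in> H \<Longrightarrow> conj_by h k \<in> H" unfolding conj_by_def by (intro sub_mult sub_inv)

lemma almost_centralizer_mult: assumes "x \<in> almost_centralizer H" "y \<in> almost_centralizer H" shows "x \<otimes> y \<in> almost_centralizer H"
proof (rule almost_centralizer_I)
  show "finite ((\<lambda>(u,v). u \<otimes> v) ` (((\<lambda>h. conj_by h x) ` H) \<times> ((\<lambda>h. conj_by h y) ` H)))"
    using assms unfolding almost_centralizer_def by blast
  show "conj_by h (x \<otimes> y) \<in> (\<lambda>(u,v). u \<otimes> v) ` (((\<lambda>h. conj_by h x) ` H) \<times> ((\<lambda>h. conj_by h y) ` H))" if "h \<in> H" for h
    using that assms[THEN almost_centralizer_carrier] sub_mem[OF that]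
    by (intro image_eqI[of _ _ "(conj_by h x, conj_by h y)"]) (simp_all add: conj_by_mult)
qed (use assms[THEN almost_centralizer_carrier] in simp)

lemma almost_centralizer_inv: assumes "x \<in> almost_centralizer H" shows "inv x \<in> almost_centralizer H"
proof (rule almost_centralizer_I)
  show "finite ((\<lambda>u. inv u) ` ((\<lambda>h. conj_by h x) ` H))" using assms unfolding almost_centralizer_def by blast
  show "conj_by h (inv x) \<in> (\<lambda>u. inv u) ` ((\<lambda>h. conj_by h x) ` H)" if "h \<in> H" for h
    using that assms[THEN almost_centralizer_carrier] sub_mem[OF that] by (simp add: conj_by_inv)
qed (use assms[THEN almost_centralizer_carrier] in simp)

lemma FC_eq: "FC H = H \<inter> almost_centralizer H"
  using sub_mem unfolding FC_def almost_centralizer_def by blast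

lemma FC_mult: "x \<in> FC H \<Longrightarrow> y \<in> FC H \<Longrightarrow> x \<otimes> y \<in> FC H"
  using almost_centralizer_mult sub_mult unfolding FC_eq by simp

lemma FC_inv: "x \<in> FC H \<Longrightarrow> inv x \<in> FC H"
  using almost_centralizer_inv sub_inv unfolding FC_eq by simp

lemma FC_one: "\<one> \<in> FC H"
  by (rule FC_I[of _ _ "{\<one>}"]) (use sub_one sub_mem in auto)

lemma FC_conj: assumes "x \<in> FC H" "k \<in> H" shows "conj_by k x \<in> FC H"
proof (rule FC_I)
  show "finite ((\<lambda>h. conj_by h x) ` H)" using FC_finite assms by blast
  show "conj_by h (conj_by k x) \<in> (\<lambda>h. conj_by h x) ` H" if "h \<in> H" for h
    using that assms FC_subset[THEN sub_mem] sub_mem sub_mult by (simp add: conj_by_conj_by)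
qed (use assms FC_subset sub_conj in simp)

lemma FC_subgroup: "subgroup (FC H) G"
  by (rule subgroupI) (use FC_subset sub_mem FC_one FC_mult FC_inv in auto)

text \<open>The union of finitely many finite conjugacy classes. The last clause transports
  conjugation invariant properties from \<open>X\<close> to all of \<Omega>.\<close>

lemma FC_closure:
  assumes "finite X" "X \<subseteq> FC H"
  obtains \<Omega> where "finite \<Omega>" "X \<subseteq> \<Omega>" "\<Omega> \<subseteq> H" "\<And>h x. h \<in> H \<Longrightarrow> x \<in> \<Omega> \<Longrightarrow> conj_by h x \<in> \<Omega>"
    "\<And>x. x \<in> \<Omega> \<Longrightarrow> \<exists>h\<in>H. \<exists>y\<in>X. x = conj_by h y"
proof
  let ?\<Omega> = "\<Union>x\<in>X. (\<lambda>h. conj_by h x) ` H"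
  show "finite ?\<Omega>" using assms FC_finite by blast
  have XG: "x \<in> carrier G" if "x \<in> X" for x using that assms(2) FC_subset sub_mem by blast
  show "X \<subseteq> ?\<Omega>"
  proof
    fix x assume "x \<in> X"
    then have "x = conj_by \<one> x" "\<one> \<in> H" using XG sub_one by auto
    then show "x \<in> ?\<Omega>" using \<open>x \<in> X\<close> by blast
  qed
  have XH: "x \<in> H" if "x \<in> X" for x using that assms(2) FC_subset by blast
  show "?\<Omega> \<subseteq> H" using XH sub_conj by blast
  show "conj_by h x \<in> ?\<Omega>" if h: "h \<in> H" and x: "x \<in> ?\<Omega>" for h x
  proof -
    obtain y k where "y \<in> X" "k \<in> H" "x = conj_by k y" using x by blast
    then have "conj_by h x = conj_by (h \<otimes> k) y" "h \<otimes> k \<in> H" using h XG sub_mem sub_mult by (auto simp: conj_by_conj_by)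
    then show ?thesis using \<open>y \<in> X\<close> by blast
  qed
  show "\<exists>h\<in>H. \<exists>y\<in>X. x = conj_by h y" if "x \<in> ?\<Omega>" for x using that by blast
qed

lemma generate_sub: "\<Omega> \<subseteq> H \<Longrightarrow> generate G \<Omega> \<subseteq> H"
  using generate_subgroup_incl[OF _ H] .

lemma generate_conj:
  assumes \<Omega>: "\<Omega> \<subseteq> H" "\<And>x. x \<in> \<Omega> \<Longrightarrow> conj_by h x \<in> \<Omega>" and h: "h \<in> H"
    and v: "v \<in> generate G \<Omega>"
  shows "conj_by h v \<in> generate G \<Omega>"
  using v
proof (induction rule: generate.induct)
  case one
  then show ?case using sub_mem[OF h] generate.one by simp
next
  case (incl x)
  then show ?case using \<Omega>(2) generate.incl by metis
next
  case (inv x)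
  then have "conj_by h (inv x) = inv (conj_by h x)" using \<Omega>(1) h sub_mem by (intro conj_by_inv) blast+
  then show ?case using \<Omega>(2)[OF inv] generate.inv by metis
next
  case (eng a b)
  then have "a \<in> carrier G" "b \<in> carrier G" using generate_sub[OF \<Omega>(1)] sub_mem by blast+
  then have "conj_by h (a \<otimes> b) = conj_by h a \<otimes> conj_by h b" using sub_mem[OF h] by (simp add: conj_by_mult)
  then show ?case using generate.eng[OF eng.IH] by metis
qed

end

end

section \<open>From the FC center to a finite normal subgroup\<close>

context graded begin

abbreviation cj where "cj \<equiv> G.conj_by"

definition ann :: "'g set \<Rightarrow> ('g \<Rightarrow> 'r) \<Rightarrow> ('g \<Rightarrow> 'r) \<Rightarrow> bool" where
  "ann H a b \<longleftrightarrow> (\<forall>h\<in>H. \<forall>s\<in>homog h. a \<otimes> s \<otimes> b = \<zero>)"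

lemma annD: "ann H a b \<Longrightarrow> h \<in> H \<Longrightarrow> s \<in> homog h \<Longrightarrow> a \<otimes> s \<otimes> b = \<zero>" by (simp add: ann_def)

lemma ann_left:
  assumes "ann H a b" "a \<in> carrier S" "b \<in> carrier S" "c \<in> carrier S" shows "ann H (c \<otimes> a) b"
  unfolding ann_def
proof (intro ballI)
  fix h s assume s: "h \<in> H" "s \<in> homog h"
  have "c \<otimes> a \<otimes> s \<otimes> b = c \<otimes> (a \<otimes> s \<otimes> b)" using assms s by (simp add: S.m_assoc homog_carrier)
  then show "c \<otimes> a \<otimes> s \<otimes> b = \<zero>" using assms annD[OF assms(1) s] by simp
qed

lemma ann_right:
  assumes "ann H a b" "a \<in> carrier S" "b \<in> carrier S" "c \<in> carrier S" shows "ann H a (b \<otimes> c)"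
  unfolding ann_def
proof (intro ballI)
  fix h s assume s: "h \<in> H" "s \<in> homog h"
  have "a \<otimes> s \<otimes> (b \<otimes> c) = a \<otimes> s \<otimes> b \<otimes> c" using assms s by (simp add: S.m_assoc homog_carrier)
  then show "a \<otimes> s \<otimes> (b \<otimes> c) = \<zero>" using assms annD[OF assms(1) s] by simp
qed

text \<open>The components of \<open>c\<close> have degrees in \<open>H\<close>, and each is
  absorbed into \<open>s\<close>. The induction on \<open>c\<close> also meets components of other
  degrees; \<open>cut H\<close> discards them.\<close>

lemma ann_mid:
  assumes H: "subgroup H G" and ab: "ann H a b" "a \<in> carrier S" "b \<in> carrier S"
    and c: "c \<in> carrier S" "\<And>x. c x \<noteq> \<z> \<Longrightarrow> x \<in> H"
  shows "ann H a (c \<otimes> b)" "ann H (a \<otimes> c) b"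
proof -
  have *: "a \<otimes> s \<otimes> cut H c \<otimes> b = \<zero> \<and> a \<otimes> cut H c \<otimes> s \<otimes> b = \<zero>" if s: "h \<in> H" "s \<in> homog h" for h s
    using c(1)
  proof (induction c rule: carrier_induct)
    case zero
    have "cut H \<zero> = \<zero>" by (auto simp: cut_def zero_fun)
    then show ?case using ab s by (simp add: homog_carrier)
  next
    case (homog x t)
    show ?case
    proof (cases "x \<in> H")
      case True
      then have "cut H t = t" using homog homogD by (intro cut_id) auto
      moreover have "a \<otimes> (s \<otimes> t) \<otimes> b = \<zero>" "a \<otimes> (t \<otimes> s) \<otimes> b = \<zero>"
        using annD[OF ab(1)] homog_mult[OF s(2) homog(2)] homog_mult[OF homog(2) s(2)] True s G.sub_mult[OF H] by blast+
      ultimately show ?thesis using ab s homog by (simp add: S.m_assoc homog_carrier)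
    next
      case False
      have "cut H t = \<zero>" unfolding cut_def zero_fun using False homogD[OF homog(2)] by (intro ext) metis
      then show ?thesis using ab s by (simp add: homog_carrier)
    qed
  next
    case (add f g)
    then show ?case using ab s by (simp add: cut_add S.l_distr S.r_distr homog_carrier)
  qed
  have "cut H c = c" using c by (rule cut_id)
  then show "ann H a (c \<otimes> b)" "ann H (a \<otimes> c) b"
    unfolding ann_def using * ab c by (auto simp: S.m_assoc[symmetric] homog_carrier)
qed

text \<open>The data of the theorem in terms of elements: \<open>j\<close> stands for the ideal of
  \<open>R\<close>, normality of \<open>N\<close> in \<open>H\<close> is expressed by conjugation,
  and the two ideals will be recovered as annihilators.\<close>

definition finite_annihilating_pair :: bool where
  "finite_annihilating_pair \<longleftrightarrow> (\<exists>N H j a b. separating H j \<and> subgroup N G \<and> N \<subseteq> H \<and> finite N \<and>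
     (\<forall>h\<in>H. \<forall>n\<in>N. cj h n \<in> N) \<and> a \<in> gen H j \<and> b \<in> gen H j \<and> a \<noteq> \<zero> \<and> b \<noteq> \<zero> \<and>
     supp R a \<subseteq> N \<and> supp R b \<subseteq> N \<and> ann H a b)"

text \<open>Leading terms with respect to a rational character of the group generated by the supports again annihilate
  each other. A pair whose supports meet the fewest fibers of all characters therefore has, after a translation,
  supports on which every character vanishes, and these consist of torsion elements.\<close>

lemma finite_annihilating_pair_FC:
  assumes separating: "separating H j" and a0: "a0 \<in> gen H j" "a0 \<noteq> \<zero>" "supp R a0 \<subseteq> G.FC H"
    and b0: "b0 \<in> gen H j" "b0 \<noteq> \<zero>" "supp R b0 \<subseteq> G.FC H" and ann0: "ann H a0 b0"
  shows finite_annihilating_pair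
proof -
  note H = H_sub[OF separating]
  note HG = G.sub_mem[OF H] and Hm = G.sub_mult[OF H] and Hi = G.sub_inv[OF H]
  note gc = gen_carrier[OF separating]
  have "finite (supp R a0 \<union> supp R b0)" "supp R a0 \<union> supp R b0 \<subseteq> G.FC H"
    using finite_supp gc a0 b0 by auto
  from G.FC_closure[OF H this] obtain \<Omega> where \<Omega>: "finite \<Omega>" "supp R a0 \<union> supp R b0 \<subseteq> \<Omega>" "\<Omega> \<subseteq> H"
    "\<And>h x. h \<in> H \<Longrightarrow> x \<in> \<Omega> \<Longrightarrow> cj h x \<in> \<Omega>" by metis
  define V where "V = generate G \<Omega>"
  have V: "subgroup V G" unfolding V_def using \<Omega>(3) HG by (intro G.generate_is_subgroup) blast
  note Vm = G.sub_mult[OF V] and Vi = G.sub_inv[OF V] and VG = G.sub_mem[OF V]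
  have VH: "v \<in> H" if "v \<in> V" for v using that G.generate_sub[OF H \<Omega>(3)] unfolding V_def by blast
  have Vc: "cj h v \<in> V" if "h \<in> H" "v \<in> V" for h v
    unfolding V_def by (rule G.generate_conj[OF H \<Omega>(3) \<Omega>(4)[OF that(1)] that(1)]) (use that V_def in auto)
  have \<Omega>V: "\<Omega> \<subseteq> V" unfolding V_def using generate.incl by (rule subsetI)
  let ?A = "G.additive_on V"
  have A_conj: "?A (\<lambda>x. \<phi> (cj h x))" if "?A \<phi>" "h \<in> H" for \<phi> h
    unfolding G.additive_on_def
    using G.additive_on_mult[OF that(1)] Vc[OF that(2)] G.conj_by_mult[OF HG[OF that(2)]] VG by simp
  \<comment> \<open>The values of all rational characters of \<open>V\<close> at \<open>x\<close>.
    Two elements of \<open>V\<close> agree here exactly if they are congruent modulo the common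
    kernel of the characters. The default 0 makes \<open>cl x\<close> a total function.\<close>
  define cl :: "'g \<Rightarrow> ('g \<Rightarrow> rat) \<Rightarrow> rat" where "cl x = (\<lambda>\<phi>. if ?A \<phi> then \<phi> x else 0)" for x
  have clD: "\<phi> x = \<phi> y" if "cl x = cl y" "?A \<phi>" for \<phi> x y
    using fun_cong[OF that(1), of \<phi>] that(2) by (simp add: cl_def)
  have clI: "cl x = cl y" if "\<And>\<phi>. ?A \<phi> \<Longrightarrow> \<phi> x = \<phi> y" for x y
    unfolding cl_def using that by (intro ext) simp
  define \<nu> where "\<nu> f = card (cl ` supp R f)" for f :: "'g \<Rightarrow> 'r"
  define P where "P = (\<lambda>(a, b). a \<in> gen H j \<and> b \<in> gen H j \<and> a \<noteq> \<zero> \<and> b \<noteq> \<zero> \<and>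
    supp R a \<subseteq> V \<and> supp R b \<subseteq> V \<and> ann H a b)"
  have "P (a0, b0)" unfolding P_def using a0 b0 ann0 \<Omega>(2) \<Omega>V by auto
  from ex_has_least_nat[of P, OF this, of "\<lambda>(a, b). \<nu> a + \<nu> b"]
  obtain a b where ab: "P (a, b)" and min: "\<And>a' b'. P (a', b') \<Longrightarrow> \<nu> a + \<nu> b \<le> \<nu> a' + \<nu> b'"
    by auto
  have ag: "a \<in> gen H j" "a \<noteq> \<zero>" "supp R a \<subseteq> V" and bg: "b \<in> gen H j" "b \<noteq> \<zero>" "supp R b \<subseteq> V"
    and anab: "ann H a b" using ab unfolding P_def by auto
  have ac: "a \<in> carrier S" and bc: "b \<in> carrier S" using gc ag bg by auto
  have fa: "finite (supp R a)" and fb: "finite (supp R b)" using finite_supp ac bc by auto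
  obtain x0 where x0: "x0 \<in> supp R a" using nonzeroE[OF ac ag(2)] in_supp by metis
  obtain y1 where y1: "y1 \<in> supp R b" using nonzeroE[OF bc bg(2)] in_supp by metis
  \<comment> \<open>A character that is nonzero at these finitely many quotients separates all
    classes met by the support of \<open>a\<close>, so its top level in this support is a single
    class.\<close>
  define D where "D = {\<iota> x \<star> y | x y. x \<in> supp R a \<and> y \<in> supp R a \<and> cl x \<noteq> cl y}"
  have "D \<subseteq> (\<lambda>(x, y). \<iota> x \<star> y) ` (supp R a \<times> supp R a)" unfolding D_def by auto
  then have "finite D" using fa finite_subset by blast
  moreover have "D \<subseteq> V" unfolding D_def using ag(3) Vm Vi by blast
  moreover have "\<exists>\<phi>. ?A \<phi> \<and> \<phi> d \<noteq> 0" if d: "d \<in> D" for d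
  proof -
    obtain x y where xy: "d = \<iota> x \<star> y" "x \<in> V" "y \<in> V" "cl x \<noteq> cl y" using d ag(3) unfolding D_def by blast
    then obtain \<phi> where \<phi>: "?A \<phi>" "\<phi> x \<noteq> \<phi> y" using clI by blast
    then have "\<phi> d = \<phi> y - \<phi> x"
      unfolding xy(1) using G.additive_on_mult[OF \<phi>(1) Vi[OF xy(2)] xy(3)] G.additive_on_inv[OF \<phi>(1) V xy(2)] by simp
    then show ?thesis using \<phi> by auto
  qed
  ultimately obtain \<phi> where \<phi>: "?A \<phi>" "\<And>d. d \<in> D \<Longrightarrow> \<phi> d \<noteq> 0" using G.additive_on_avoid[of D V] by blast
  have \<phi>cl: "cl x = cl y" if xy: "x \<in> supp R a" "y \<in> supp R a" "\<phi> x = \<phi> y" for x y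
  proof (rule ccontr)
    assume "cl x \<noteq> cl y"
    then have "\<phi> (\<iota> x \<star> y) \<noteq> 0" using \<phi>(2) xy unfolding D_def by blast
    moreover have "x \<in> V" "y \<in> V" using xy ag(3) by auto
    ultimately show False using xy(3) G.additive_on_mult[OF \<phi>(1) Vi[OF \<open>x \<in> V\<close>] \<open>y \<in> V\<close>]
        G.additive_on_inv[OF \<phi>(1) V \<open>x \<in> V\<close>] by simp
  qed
  define m where "m = Max (\<phi> ` supp R a)"
  have m: "\<phi> x \<le> m" if "x \<in> supp R a" for x unfolding m_def using fa that by simp
  have "m \<in> \<phi> ` supp R a" unfolding m_def using fa x0 by (intro Max_in) auto
  then obtain xm where xm: "xm \<in> supp R a" "\<phi> xm = m" by blast
  define aM where "aM = cut {x. \<phi> x = m} a"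
  have atg: "aM \<in> gen H j" unfolding aM_def by (rule gen_cut[OF separating ag(1)])
  have atc: "aM \<in> carrier S" using gc[OF atg] .
  have at0: "aM \<noteq> \<zero>" unfolding aM_def using xm in_supp by (intro nonzeroI[of _ xm]) (simp add: cut_apply)
  have ats: "x \<in> supp R a \<and> \<phi> x = m" if "aM x \<noteq> \<z>" for x
    using that unfolding aM_def by (auto simp: cut_apply in_supp split: if_splits)
  have atann: "ann H aM b"
  proof (rule ccontr)
    assume "\<not> ann H aM b"
    then obtain h s where h: "h \<in> H" and s: "s \<in> homog h" and nz: "aM \<otimes> s \<otimes> b \<noteq> \<zero>" unfolding ann_def by blast
    note hG = HG[OF h]
    \<comment> \<open>Because \<open>x \<star> h \<star> y = x \<star> cj h y \<star> h\<close>, the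
      level of \<open>y\<close> behind \<open>s\<close> is measured by \<phi> after conjugation by
      \<open>h\<close>.\<close>
    define m' where "m' = Max ((\<lambda>y. \<phi> (cj h y)) ` supp R b)"
    have m': "\<phi> (cj h y) \<le> m'" if "y \<in> supp R b" for y unfolding m'_def using fb that by simp
    have "m' \<in> (\<lambda>y. \<phi> (cj h y)) ` supp R b" unfolding m'_def using fb y1 by (intro Max_in) auto
    then obtain ym where ym: "ym \<in> supp R b" "\<phi> (cj h ym) = m'" by blast
    define T where "T = {y. \<phi> (cj h y) = m'}"
    define br where "br = cut (- T) b"
    have brc: "br \<in> carrier S" unfolding br_def using bc by simp
    have brs: "y \<in> supp R b \<and> y \<notin> T" if "br y \<noteq> \<z>" for y
      using that unfolding br_def by (auto simp: cut_apply in_supp split: if_splits)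
    have sc: "s \<in> carrier S" using s by simp
    have eqn: "x' \<star> cj h y' = x \<star> cj h y" if "x' \<star> h \<star> y' = x \<star> h \<star> y"
      "x \<in> carrier G" "y \<in> carrier G" "x' \<in> carrier G" "y' \<in> carrier G" for x y x' y'
    proof -
      have "x' \<star> cj h y' = (x' \<star> h \<star> y') \<star> \<iota> h" "x \<star> cj h y = (x \<star> h \<star> y) \<star> \<iota> h"
        unfolding G.conj_by_def using that(2-5) hG by (simp_all add: G.m_assoc)
      then show ?thesis using that(1) by simp
    qed
    \<comment> \<open>Levels add up: a degree at level \<open>m + m'\<close> can only come from the
      two leading parts, so the coefficient there is the one of
      \<open>a \<otimes> s \<otimes> b\<close>, which is zero.\<close>
    have top: "aM \<otimes> s \<otimes> cut T b = \<zero>"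
    proof (rule zeroI)
      show "aM \<otimes> s \<otimes> cut T b \<in> carrier S" using atc sc bc by simp
      fix p
      show "(aM \<otimes> s \<otimes> cut T b) p = \<z>"
      proof (rule ccontr)
        assume ne: "(aM \<otimes> s \<otimes> cut T b) p \<noteq> \<z>"
        from mult_supp3[OF atc s cut_closed[OF bc] this] obtain x y where
          xy: "aM x \<noteq> \<z>" "cut T b y \<noteq> \<z>" "p = x \<star> h \<star> y" "x \<in> carrier G" "y \<in> carrier G" by metis
        have x: "x \<in> V" "\<phi> x = m" using ats[OF xy(1)] ag(3) by auto
        have y: "y \<in> V" "\<phi> (cj h y) = m'" using xy(2) bg(3) unfolding T_def by (auto simp: cut_apply in_supp split: if_splits)
        have "(a \<otimes> s \<otimes> b) p = (cut {x. \<phi> x = m} a \<otimes> s \<otimes> cut T b) p"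
        proof (rule mult_cut3[OF ac s bc])
          fix x' y' assume *: "a x' \<noteq> \<z>" "b y' \<noteq> \<z>" "x' \<star> h \<star> y' = p"
          have V': "x' \<in> V" "y' \<in> V" using * ag(3) bg(3) in_supp by blast+
          have "x' \<star> cj h y' = x \<star> cj h y" by (rule eqn) (use * xy V' VG in auto)
          then have "\<phi> x' + \<phi> (cj h y') = m + m'"
            using G.additive_on_mult[OF \<phi>(1)] V' x y Vc[OF h] by metis
          moreover have "\<phi> x' \<le> m" "\<phi> (cj h y') \<le> m'" using m m' * in_supp by blast+
          ultimately show "x' \<in> {x. \<phi> x = m} \<and> y' \<in> T" unfolding T_def by simp
        qed
        then show False using ne annD[OF anab h s] unfolding aM_def by (simp add: zero_apply)
      qed
    qed
    have "aM \<otimes> s \<otimes> b = aM \<otimes> s \<otimes> cut T b \<oplus> aM \<otimes> s \<otimes> br"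
      unfolding br_def using atc sc bc by (subst cut_split[OF bc, of T]) (simp add: S.r_distr)
    then have e: "aM \<otimes> s \<otimes> b = aM \<otimes> s \<otimes> br" using top atc sc brc by simp
    \<comment> \<open>The leading part of \<open>b\<close> has dropped out of \<open>c\<close>, yet
      \<open>c\<close> is nonzero and still annihilated by \<open>a\<close>. Translated back into
      \<open>V\<close>, it meets fewer classes than \<open>b\<close>, against minimality.\<close>
    define c where "c = aM \<otimes> s \<otimes> b"
    have cc: "c \<in> carrier S" unfolding c_def using atc sc bc by simp
    obtain q where q: "q \<in> carrier G" "c q \<noteq> \<z>" using nonzeroE[OF cc] nz unfolding c_def by blast
    from mult_supp3[OF atc s brc q(2)[unfolded c_def e]] obtain x2 y2 where
      xy2: "aM x2 \<noteq> \<z>" "br y2 \<noteq> \<z>" "q = x2 \<star> h \<star> y2" "x2 \<in> carrier G" "y2 \<in> carrier G" by metis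
    have xy2V: "x2 \<in> V" "y2 \<in> V" using ats[OF xy2(1)] brs[OF xy2(2)] ag(3) bg(3) by auto
    have qH: "q \<in> H" unfolding xy2(3) using xy2V VH h Hm by blast
    from shift_right[OF cc q(2)] obtain t where t: "t \<in> homog (\<iota> q)" "(c \<otimes> t) \<e> \<noteq> \<z>" by metis
    have tc: "t \<in> carrier S" using t by simp
    define b1 where "b1 = c \<otimes> t"
    have "c \<in> gen H j" unfolding c_def by (intro gen_mult[OF separating] gen_right[OF separating _ s h] atg bg(1))
    then have b1g: "b1 \<in> gen H j" unfolding b1_def by (rule gen_right[OF separating _ t(1) Hi[OF qH]])
    have b1s: "\<exists>x y. aM x \<noteq> \<z> \<and> br y \<noteq> \<z> \<and> z = x \<star> h \<star> y \<star> \<iota> q" if z: "b1 z \<noteq> \<z>" for z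
    proof -
      obtain v w where v: "c v \<noteq> \<z>" "t w \<noteq> \<z>" "z = v \<star> w" using mult_supp[OF cc tc] z unfolding b1_def by blast
      have "w = \<iota> q" using homogD[OF t(1) v(2)] .
      from mult_supp3[OF atc s brc v(1)[unfolded c_def e]] show ?thesis using v(3) \<open>w = \<iota> q\<close> by metis
    qed
    have b1z: "z = x \<star> (cj h y \<star> \<iota> (cj h y2)) \<star> \<iota> x2" if "z = x \<star> h \<star> y \<star> \<iota> q" "x \<in> V" "y \<in> V" for x y z
      unfolding that(1) xy2(3) G.conj_by_def using that(2,3)[THEN VG] xy2(4,5) hG by (simp add: G.group_word)
    have b1V: "supp R b1 \<subseteq> V"
    proof
      fix z assume "z \<in> supp R b1"
      then obtain x y where xy: "aM x \<noteq> \<z>" "br y \<noteq> \<z>" "z = x \<star> h \<star> y \<star> \<iota> q" using b1s in_supp by metis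
      have V': "x \<in> V" "y \<in> V" using ats[OF xy(1)] brs[OF xy(2)] ag(3) bg(3) by auto
      show "z \<in> V" unfolding b1z[OF xy(3) V'] using V' xy2V h by (intro Vm Vi Vc)
    qed
    \<comment> \<open>All degrees of \<open>aM\<close> lie in one class, so the class of a degree of
      \<open>b1\<close> depends only on the class of the degree of \<open>br\<close> from which it
      arises; \<open>F\<close> is this dependence.\<close>
    define F :: "(('g \<Rightarrow> rat) \<Rightarrow> rat) \<Rightarrow> ('g \<Rightarrow> rat) \<Rightarrow> rat" where
      "F k = (\<lambda>\<phi>'. if ?A \<phi>' then k (\<lambda>x. \<phi>' (cj h x)) - \<phi>' (cj h y2) else 0)" for k
    have "cl ` supp R b1 \<subseteq> F ` (cl ` supp R br)"
    proof
      fix k assume "k \<in> cl ` supp R b1"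
      then obtain z where z: "b1 z \<noteq> \<z>" "k = cl z" using in_supp by blast
      then obtain x y where xy: "aM x \<noteq> \<z>" "br y \<noteq> \<z>" "z = x \<star> h \<star> y \<star> \<iota> q" using b1s by metis
      have V': "x \<in> V" "y \<in> V" using ats[OF xy(1)] brs[OF xy(2)] ag(3) bg(3) by auto
      have "cl z \<phi>' = F (cl y) \<phi>'" for \<phi>'
      proof (cases "?A \<phi>'")
        case True
        note add = G.additive_on_mult[OF True] and inv = G.additive_on_inv[OF True V]
        have "\<phi>' x = \<phi>' x2" using \<phi>cl[of x x2] ats[OF xy(1)] ats[OF xy2(1)] clD True by metis
        moreover have "\<phi>' z = \<phi>' x + (\<phi>' (cj h y) - \<phi>' (cj h y2)) - \<phi>' x2"
          unfolding b1z[OF xy(3) V'] using V' xy2V Vc[OF h] Vm Vi by (simp add: add inv)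
        ultimately show ?thesis using True A_conj[OF True h] unfolding F_def cl_def by simp
      qed (simp add: cl_def F_def)
      then have "k = F (cl y)" using z by auto
      then show "k \<in> F ` (cl ` supp R br)" using xy(2) in_supp by blast
    qed
    then have "\<nu> b1 \<le> card (cl ` supp R br)" unfolding \<nu>_def
      using surj_card_le[of "cl ` supp R br"] finite_supp[OF brc] by blast
    also have "\<dots> < \<nu> b" unfolding \<nu>_def
    proof (rule psubset_card_mono)
      have "cl ym \<notin> cl ` supp R br"
      proof
        assume "cl ym \<in> cl ` supp R br"
        then obtain y where y: "br y \<noteq> \<z>" "cl ym = cl y" using in_supp by blast
        then have "\<phi> (cj h ym) = \<phi> (cj h y)" using clD[OF y(2) A_conj[OF \<phi>(1) h]] by simp
        then show False using brs[OF y(1)] ym unfolding T_def by simp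
      qed
      moreover have "supp R br \<subseteq> supp R b" using brs in_supp by blast
      ultimately show "cl ` supp R br \<subset> cl ` supp R b" using ym(1) by blast
    qed (use fb in simp)
    finally have "\<nu> b1 < \<nu> b" .
    moreover have "P (a, b1)"
    proof -
      have "ann H a (aM \<otimes> s \<otimes> b)"
      proof (rule ann_mid(1)[OF H anab ac bc])
        show "aM \<otimes> s \<in> carrier S" using atc sc by simp
        show "x \<in> H" if "(aM \<otimes> s) x \<noteq> \<z>" for x
          using gen_supp[OF separating gen_right[OF separating atg s h] that] .
      qed
      then have "ann H a b1" unfolding b1_def c_def using ac atc sc bc tc by (intro ann_right[of H a "aM \<otimes> s \<otimes> b" t]) auto
      then show ?thesis unfolding P_def using ag b1g b1V nonzeroI[of "c \<otimes> t" \<e>, OF t(2)] unfolding b1_def by simp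
    qed
    ultimately show False using min by fastforce
  qed
  \<comment> \<open>The leading part meets a single class. Since \<open>(aM, b)\<close> competes
    with the minimal pair, \<open>a\<close> meets at most one class as well.\<close>
  have "P (aM, b)" unfolding P_def using atg at0 bg atann ats ag(3) in_supp by auto
  moreover have "\<nu> aM \<le> 1"
  proof -
    have "cl ` supp R aM \<subseteq> {cl xm}" using \<phi>cl ats xm in_supp by blast
    then show ?thesis unfolding \<nu>_def using card_mono[of "{cl xm}"] by fastforce
  qed
  ultimately have "\<nu> a \<le> 1" using min by fastforce
  have acl: "cl x = cl y" if "x \<in> supp R a" "y \<in> supp R a" for x y
  proof -
    have "card (cl ` supp R a) \<le> Suc 0" using \<open>\<nu> a \<le> 1\<close> unfolding \<nu>_def by simp
    then show ?thesis using that unfolding card_le_Suc0_iff_eq[OF finite_imageI[OF fa]] by blast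
  qed
  \<comment> \<open>With a single class on the left, equal degrees of products force equal classes
    on the right. So \<open>a\<close> annihilates the part of \<open>b\<close> in each class
    separately, and one class can be kept.\<close>
  define b' where "b' = cut {y. cl y = cl y1} b"
  have b'g: "b' \<in> gen H j" unfolding b'_def by (rule gen_cut[OF separating bg(1)])
  have b'c: "b' \<in> carrier S" using gc[OF b'g] .
  have b'1: "b' y1 \<noteq> \<z>" unfolding b'_def using y1 by (simp add: cut_apply in_supp)
  have b's: "y \<in> V \<and> cl y = cl y1" if "b' y \<noteq> \<z>" for y
    using that bg(3) unfolding b'_def by (auto simp: cut_apply in_supp split: if_splits)
  have ann': "ann H a b'"
    unfolding ann_def
  proof (intro ballI)
    fix h s assume h: "h \<in> H" and s: "s \<in> homog h"
    note hG = HG[OF h]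
    show "a \<otimes> s \<otimes> b' = \<zero>"
    proof (rule zeroI)
      show "a \<otimes> s \<otimes> b' \<in> carrier S" using ac s b'c by (simp add: homog_carrier)
      fix p
      show "(a \<otimes> s \<otimes> b') p = \<z>"
      proof (rule ccontr)
        assume ne: "(a \<otimes> s \<otimes> b') p \<noteq> \<z>"
        from mult_supp3[OF ac s b'c this] obtain x y where
          xy: "a x \<noteq> \<z>" "b' y \<noteq> \<z>" "p = x \<star> h \<star> y" "x \<in> carrier G" "y \<in> carrier G" by metis
        have "(a \<otimes> s \<otimes> b) p = (cut UNIV a \<otimes> s \<otimes> cut {y. cl y = cl y1} b) p"
        proof (rule mult_cut3[OF ac s bc])
          fix x' y' assume *: "a x' \<noteq> \<z>" "b y' \<noteq> \<z>" "x' \<star> h \<star> y' = p"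
          have V': "x' \<in> V" "y' \<in> V" "x \<in> V" "y \<in> V" using * ag(3) bg(3) xy b's in_supp by blast+
          then have G': "x' \<in> carrier G" "y' \<in> carrier G" using VG by auto
          have "\<iota> x' \<star> (x' \<star> h \<star> y') = \<iota> x' \<star> (x \<star> h \<star> y)" using * xy by simp
          then have "h \<star> y' = \<iota> x' \<star> (x \<star> h \<star> y)" using G' hG by (simp add: G.group_word)
          then have "\<iota> h \<star> (h \<star> y') = \<iota> h \<star> (\<iota> x' \<star> (x \<star> h \<star> y))" by simp
          then have y': "y' = cj (\<iota> h) (\<iota> x' \<star> x) \<star> y" using G' hG xy
            unfolding G.conj_by_def by (simp add: G.group_word)
          have "cl y' = cl y"
          proof (rule clI)
            fix \<phi>' assume A: "?A \<phi>'"
            note A' = A_conj[OF A Hi[OF h]]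
            have "\<phi>' (cj (\<iota> h) (\<iota> x' \<star> x)) = \<phi>' (cj (\<iota> h) x) - \<phi>' (cj (\<iota> h) x')"
              using G.additive_on_mult[OF A' Vi[OF V'(1)] V'(3)] G.additive_on_inv[OF A' V V'(1)] by simp
            also have "\<dots> = 0" using clD[OF acl[of x x'] A'] * xy in_supp by simp
            finally show "\<phi>' y' = \<phi>' y"
              unfolding y' using G.additive_on_mult[OF A Vc[OF Hi[OF h] Vm[OF Vi[OF V'(1)] V'(3)]] V'(4)] by simp
          qed
          then show "x' \<in> UNIV \<and> y' \<in> {y. cl y = cl y1}" using b's[OF xy(2)] by simp
        qed
        then show False using ne annD[OF anab h s] unfolding b'_def by (simp add: zero_apply cut_def)
      qed
    qed
  qed
  obtain t where t: "t \<in> homog (\<iota> x0)" "(a \<otimes> t) \<e> \<noteq> \<z>" using shift_right[OF ac, of x0] x0 in_supp by metis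
  obtain t' where t': "t' \<in> homog (\<iota> y1)" "(b' \<otimes> t') \<e> \<noteq> \<z>" using shift_right[OF b'c b'1] by metis
  have x0V: "x0 \<in> V" and y1V: "y1 \<in> V" using x0 y1 ag(3) bg(3) by auto
  define a2 b2 where "a2 = a \<otimes> t" and "b2 = b' \<otimes> t'"
  have a2g: "a2 \<in> gen H j" unfolding a2_def by (rule gen_right[OF separating ag(1) t(1) Hi[OF VH[OF x0V]]])
  have b2g: "b2 \<in> gen H j" unfolding b2_def by (rule gen_right[OF separating b'g t'(1) Hi[OF VH[OF y1V]]])
  have a20: "a2 \<noteq> \<zero>" "b2 \<noteq> \<zero>" unfolding a2_def b2_def using nonzeroI[of "a \<otimes> t" \<e>, OF t(2)] nonzeroI[of "b' \<otimes> t'" \<e>, OF t'(2)] by simp_all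
  have ann2: "ann H a2 b2"
    unfolding a2_def b2_def
  proof (rule ann_right)
    show "ann H (a \<otimes> t) b'"
      by (rule ann_mid(2)[OF H ann' ac b'c]) (use t homogD VH[OF x0V] Hi in auto)
  qed (use ac b'c t t' in auto)
  \<comment> \<open>The common kernel of the rational characters of \<open>V\<close>. It contains
    the quotients of elements of one class, hence the supports after translation.\<close>
  define N0 where "N0 = {v \<in> V. \<forall>\<phi>. ?A \<phi> \<longrightarrow> \<phi> v = 0}"
  have diff: "x \<star> \<iota> y \<in> N0" if "cl x = cl y" "x \<in> V" "y \<in> V" for x y
    unfolding N0_def
  proof (intro CollectI conjI allI impI)
    fix \<phi>' assume A: "?A \<phi>'"
    show "\<phi>' (x \<star> \<iota> y) = 0"
      using G.additive_on_mult[OF A that(2) Vi[OF that(3)]] G.additive_on_inv[OF A V that(3)] clD[OF that(1) A] by simp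
  qed (use that Vm Vi in blast)
  have a2s: "supp R a2 \<subseteq> N0"
  proof
    fix z assume "z \<in> supp R a2"
    then obtain x w where "a x \<noteq> \<z>" "t w \<noteq> \<z>" "z = x \<star> w"
      using mult_supp[OF ac homog_carrier[OF t(1)]] unfolding a2_def in_supp by blast
    then show "z \<in> N0" using diff[OF acl[of x x0]] x0 homogD[OF t(1)] ag(3) x0V in_supp by blast
  qed
  have b2s: "supp R b2 \<subseteq> N0"
  proof
    fix z assume "z \<in> supp R b2"
    then obtain x w where "b' x \<noteq> \<z>" "t' w \<noteq> \<z>" "z = x \<star> w"
      using mult_supp[OF b'c homog_carrier[OF t'(1)]] unfolding b2_def in_supp by blast
    then show "z \<in> N0" using diff[of x y1] b's homogD[OF t'(1)] y1V by blast
  qed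
  have N0c: "cj h v \<in> N0" if "h \<in> H" "v \<in> N0" for h v
    using that A_conj Vc unfolding N0_def by blast
  have N0t: "\<exists>k>0. v [^]\<^bsub>G\<^esub> (k::nat) = \<e>" if v: "v \<in> N0" for v
  proof (rule ccontr)
    assume nt: "\<not> ?thesis"
    have "\<exists>\<phi>. G.additive_on (generate G \<Omega>) \<phi> \<and> \<phi> v \<noteq> 0"
    proof (rule G.additive_on_generate_nonzero[OF \<Omega>(1)])
      show "\<Omega> \<subseteq> carrier G" using \<Omega>(3) HG by blast
      show "x \<star> y \<star> \<iota> x \<in> \<Omega>" if "x \<in> generate G \<Omega>" "y \<in> \<Omega>" for x y
        using \<Omega>(4)[of x y] VH[of x] that by (simp add: G.conj_by_def V_def)
      show "v \<in> generate G \<Omega>" using v by (simp add: N0_def V_def)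
      show "v [^]\<^bsub>G\<^esub> k \<noteq> \<e>" if "k > 0" for k :: nat using nt that by blast
    qed
    then show False using v unfolding N0_def V_def by blast
  qed
  have "v \<in> G.FC H" if "v \<in> V" for v
  proof -
    have "\<Omega> \<subseteq> G.FC H"
    proof
      fix x assume "x \<in> \<Omega>"
      then show "x \<in> G.FC H" using \<Omega> by (intro G.FC_I[of _ _ \<Omega>]) auto
    qed
    then show ?thesis using that G.generate_subgroup_incl[OF _ G.FC_subgroup[OF H]] unfolding V_def by blast
  qed
  then have "supp R a2 \<union> supp R b2 \<subseteq> G.FC H" using a2s b2s unfolding N0_def by blast
  moreover have "finite (supp R a2 \<union> supp R b2)" using finite_supp gc a2g b2g by auto
  ultimately obtain \<Omega>1 where \<Omega>1: "finite \<Omega>1" "supp R a2 \<union> supp R b2 \<subseteq> \<Omega>1" "\<Omega>1 \<subseteq> H"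
    "\<And>h x. h \<in> H \<Longrightarrow> x \<in> \<Omega>1 \<Longrightarrow> cj h x \<in> \<Omega>1"
    "\<And>x. x \<in> \<Omega>1 \<Longrightarrow> \<exists>h\<in>H. \<exists>y\<in>supp R a2 \<union> supp R b2. x = cj h y"
    using G.FC_closure[OF H] by metis
  \<comment> \<open>The generators are conjugates of elements of \<open>N0\<close>, hence torsion,
    and form a finite set invariant under \<open>H\<close>, so Dietzmann's lemma applies.\<close>
  define N where "N = generate G \<Omega>1"
  have "finite N"
    unfolding N_def
  proof (rule G.finite_generate_torsion[OF H \<Omega>1(3) _ \<Omega>1(1)])
    show "h \<star> x \<star> \<iota> h \<in> \<Omega>1" if "h \<in> H" "x \<in> \<Omega>1" for h x using \<Omega>1(4)[OF that] by (simp add: G.conj_by_def)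
    show "\<exists>k>0. x [^]\<^bsub>G\<^esub> (k::nat) = \<e>" if "x \<in> \<Omega>1" for x
      using \<Omega>1(5)[OF that] a2s b2s N0c N0t by blast
  qed
  moreover have "subgroup N G" unfolding N_def using \<Omega>1(3) HG by (intro G.generate_is_subgroup) blast
  moreover have "N \<subseteq> H" unfolding N_def using G.generate_sub[OF H \<Omega>1(3)] .
  moreover have "\<forall>h\<in>H. \<forall>n\<in>N. cj h n \<in> N" unfolding N_def
    by (intro ballI G.generate_conj[OF H \<Omega>1(3) \<Omega>1(4)])
  moreover have "\<Omega>1 \<subseteq> N" unfolding N_def using generate.incl by (rule subsetI)
  then have "supp R a2 \<subseteq> N" "supp R b2 \<subseteq> N" using \<Omega>1(2) by auto
  ultimately show ?thesis unfolding finite_annihilating_pair_def using separating a2g b2g a20 ann2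
    by (intro exI[of _ N] exI[of _ H] exI[of _ j] exI[of _ a2] exI[of _ b2] conjI)
qed

end

section \<open>Annihilating pairs\<close>

text \<open>On \<open>A\<close>, the map \<open>p\<close> factors through \<open>q\<close> after
  \<open>g\<close>. In this form numbers of cosets of different subgroups are compared along a
  conjugation.\<close>

lemma card_image_factor:
  assumes "finite B" "\<And>z. z \<in> A \<Longrightarrow> g z \<in> B"
    and "\<And>z z'. z \<in> A \<Longrightarrow> z' \<in> A \<Longrightarrow> q (g z) = q (g z') \<Longrightarrow> p z = p z'"
  shows "card (p ` A) \<le> card (q ` B)"
proof (rule surj_card_le)
  show "finite (q ` B)" using assms(1) by simp
  show "p ` A \<subseteq> (\<lambda>c. p (SOME z. z \<in> A \<and> q (g z) = c)) ` (q ` B)"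
  proof
    fix k assume "k \<in> p ` A"
    then obtain z where z: "z \<in> A" "k = p z" by blast
    have "(SOME z'. z' \<in> A \<and> q (g z') = q (g z)) \<in> A \<and> q (g (SOME z'. z' \<in> A \<and> q (g z') = q (g z))) = q (g z)"
      by (rule someI[of "\<lambda>z'. z' \<in> A \<and> q (g z') = q (g z)" z]) (use z in simp)
    then have "k = p (SOME z'. z' \<in> A \<and> q (g z') = q (g z))" using assms(3) z by metis
    then show "k \<in> (\<lambda>c. p (SOME z. z \<in> A \<and> q (g z) = c)) ` (q ` B)" using assms(2)[OF z(1)] by blast
  qed
qed

context group begin

definition FC_coset :: "'a set \<Rightarrow> 'a \<Rightarrow> 'a set" where "FC_coset H x = (\<lambda>d. d \<otimes> x) ` FC H"

lemma FC_coset_eq: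
  assumes H: "subgroup H G" and x: "x \<in> carrier G" and y: "y \<in> carrier G"
  shows "FC_coset H x = FC_coset H y \<longleftrightarrow> x \<otimes> inv y \<in> FC H"
proof
  note FCG = sub_mem[OF FC_subgroup[OF H]]
  have "x \<in> FC_coset H x" unfolding FC_coset_def using FC_one[OF H] x by (intro image_eqI[of _ _ \<one>]) simp_all
  moreover assume "FC_coset H x = FC_coset H y"
  ultimately obtain d where "d \<in> FC H" "x = d \<otimes> y" unfolding FC_coset_def by blast
  then show "x \<otimes> inv y \<in> FC H" using y FCG by (simp add: m_assoc)
next
  note FCG = sub_mem[OF FC_subgroup[OF H]]
  have sub: "FC_coset H x \<subseteq> FC_coset H y" if d: "x \<otimes> inv y \<in> FC H" and x: "x \<in> carrier G" and y: "y \<in> carrier G" for x y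
  proof
    fix z assume "z \<in> FC_coset H x"
    then obtain e where e: "e \<in> FC H" "z = e \<otimes> x" unfolding FC_coset_def by blast
    then have "z = (e \<otimes> (x \<otimes> inv y)) \<otimes> y" using FCG[OF e(1)] x y by (simp add: m_assoc)
    then show "z \<in> FC_coset H y" unfolding FC_coset_def using FC_mult[OF H e(1) d] by blast
  qed
  assume d: "x \<otimes> inv y \<in> FC H"
  have "y \<otimes> inv x = inv (x \<otimes> inv y)" using x y by (simp add: inv_mult_group)
  then have "y \<otimes> inv x \<in> FC H" using FC_inv[OF H d] by simp
  then show "FC_coset H x = FC_coset H y" using sub[OF d x y] sub[OF _ y x] by blast
qed

text \<open>The action is left abstract because two are used: conjugation of group elements, and
  conjugation of the values of maps on a finite set.\<close>

lemma stabilizer_subgroup: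
  assumes H: "subgroup H G" and PX: "P \<subseteq> X"
    and one: "\<And>f. f \<in> X \<Longrightarrow> act \<one> f = f"
    and mult: "\<And>h k f. h \<in> H \<Longrightarrow> k \<in> H \<Longrightarrow> f \<in> X \<Longrightarrow> act (h \<otimes> k) f = act h (act k f)"
  shows "subgroup {l \<in> H. act l ` P = P} G"
proof (rule subgroupI)
  have one': "act \<one> ` P = P" using one PX by (auto simp: subset_iff image_iff)
  show "{l \<in> H. act l ` P = P} \<noteq> {}" using one' sub_one[OF H] by blast
  have m: "act (h \<otimes> k) ` P = act h ` (act k ` P)" if "h \<in> H" "k \<in> H" for h k
    unfolding image_image by (rule image_cong) (use mult that PX in auto)
  fix a assume a: "a \<in> {l \<in> H. act l ` P = P}"
  then have i: "inv a \<in> H" using sub_inv[OF H] by simp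
  then have "act (inv a) ` P = act (inv a) ` (act a ` P)" using a by simp
  also have "\<dots> = act (inv a \<otimes> a) ` P" using m i a by simp
  also have "\<dots> = P" using one' a sub_mem[OF H] by simp
  finally show "inv a \<in> {l \<in> H. act l ` P = P}" using i by simp
  fix b assume b: "b \<in> {l \<in> H. act l ` P = P}"
  then have "act (a \<otimes> b) ` P = P" using m[of a b] a by simp
  then show "a \<otimes> b \<in> {l \<in> H. act l ` P = P}" using a b sub_mult[OF H] by simp
qed (use sub_mem[OF H] in blast)

text \<open>Acting by \<open>x\<close> is injective, so on a finite set inclusion already gives
  equality.\<close>

lemma stabilizer_memI:
  assumes H: "subgroup H G" and PX: "P \<subseteq> X" "finite P"
    and one: "\<And>f. f \<in> X \<Longrightarrow> act \<one> f = f"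
    and mult: "\<And>h k f. h \<in> H \<Longrightarrow> k \<in> H \<Longrightarrow> f \<in> X \<Longrightarrow> act (h \<otimes> k) f = act h (act k f)"
    and x: "x \<in> H" "act x ` P \<subseteq> P"
  shows "x \<in> {l \<in> H. act l ` P = P}"
proof -
  have "inj_on (act x) P"
  proof (rule inj_on_inverseI[of _ "act (inv x)"])
    fix f assume "f \<in> P"
    then have f: "f \<in> X" using PX by blast
    have "act (inv x) (act x f) = act (inv x \<otimes> x) f" using mult[OF sub_inv[OF H x(1)] x(1) f] by simp
    then show "act (inv x) (act x f) = f" using one[OF f] sub_mem[OF H x(1)] by simp
  qed
  then have "act x ` P = P" by (intro endo_inj_surj PX x(2))
  then show ?thesis using x by simp
qed

text \<open>\<open>P\<close> has finitely many translates, so its stabilizer has finite index in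
  \<open>H\<close>. Conjugation by finitely many coset representatives turns the conjugates under
  the stabilizer into all conjugates under \<open>H\<close>.\<close>

lemma almost_centralizer_finite_orbit:
  assumes H: "subgroup H G" and PX: "P \<subseteq> X" "finite X" and act: "\<And>h f. h \<in> H \<Longrightarrow> f \<in> X \<Longrightarrow> act h f \<in> X"
    and one: "\<And>f. f \<in> X \<Longrightarrow> act \<one> f = f"
    and mult: "\<And>h k f. h \<in> H \<Longrightarrow> k \<in> H \<Longrightarrow> f \<in> X \<Longrightarrow> act (h \<otimes> k) f = act h (act k f)"
  shows "almost_centralizer {l \<in> H. act l ` P = P} \<subseteq> almost_centralizer H"
proof
  define L where "L = {l \<in> H. act l ` P = P}"
  fix x assume x: "x \<in> almost_centralizer {l \<in> H. act l ` P = P}"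
  then have xG: "x \<in> carrier G" and fin: "finite ((\<lambda>h. conj_by h x) ` L)" unfolding almost_centralizer_def L_def by auto
  have "(\<lambda>h. act h ` P) ` H \<subseteq> Pow X" using act PX by blast
  then have "finite ((\<lambda>h. act h ` P) ` H)" using PX(2) finite_subset by blast
  then obtain T where T: "T \<subseteq> H" "finite T" "(\<lambda>h. act h ` P) ` H = (\<lambda>h. act h ` P) ` T"
    using finite_subset_image[of "(\<lambda>h. act h ` P) ` H" "\<lambda>h. act h ` P" H] by blast
  have "(\<lambda>h. conj_by h x) ` H \<subseteq> (\<lambda>(t, y). conj_by t y) ` (T \<times> (\<lambda>h. conj_by h x) ` L)"
  proof
    fix z assume "z \<in> (\<lambda>h. conj_by h x) ` H"
    then obtain h where h: "h \<in> H" "z = conj_by h x" by blast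
    then obtain t where t: "t \<in> T" "act h ` P = act t ` P" using T(3) by (metis (no_types, lifting) imageE imageI)
    then have tH: "t \<in> H" using T(1) by blast
    have m: "act (a \<otimes> b) ` P = act a ` (act b ` P)" if "a \<in> H" "b \<in> H" for a b
      unfolding image_image by (rule image_cong) (use mult that PX in auto)
    have "act (inv t \<otimes> h) ` P = act (inv t \<otimes> t) ` P" using m t(2) h(1) tH sub_inv[OF H] by simp
    also have "\<dots> = P" using one PX(1) sub_mem[OF H tH] by (auto simp: subset_iff image_iff)
    finally have l: "inv t \<otimes> h \<in> L" unfolding L_def using sub_mult[OF H] sub_inv[OF H tH] h by simp
    have "z = conj_by t (conj_by (inv t \<otimes> h) x)"
      using h xG sub_mem[OF H] tH by (simp add: conj_by_def group_word)
    then show "z \<in> (\<lambda>(t, y). conj_by t y) ` (T \<times> (\<lambda>h. conj_by h x) ` L)" using t l by blast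
  qed
  then have "finite ((\<lambda>h. conj_by h x) ` H)" using T(2) fin by (meson finite_SigmaI finite_imageI finite_subset)
  then show "x \<in> almost_centralizer H" unfolding almost_centralizer_def using xG by simp
qed

end

section \<open>Restriction of annihilating pairs to smaller subgroups\<close>

context graded begin

lemma sandwich_cut:
  assumes x: "x \<in> homog u" and f: "f \<in> carrier S" and y: "y \<in> homog w"
    and only: "\<And>z. f z \<noteq> \<z> \<Longrightarrow> u \<star> z \<star> w = p \<Longrightarrow> z \<in> E"
  shows "(x \<otimes> f \<otimes> y) p = (x \<otimes> cut E f \<otimes> y) p"
proof -
  have c: "x \<in> carrier S" "y \<in> carrier S" "cut E f \<in> carrier S" "cut (- E) f \<in> carrier S" using x y f by auto
  have "x \<otimes> f \<otimes> y = x \<otimes> cut E f \<otimes> y \<oplus> x \<otimes> cut (- E) f \<otimes> y"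
    using c by (subst cut_split[OF f, of E]) (simp add: S.l_distr S.r_distr)
  moreover have "(x \<otimes> cut (- E) f \<otimes> y) p = \<z>"
  proof (rule ccontr)
    assume "\<not> ?thesis"
    then obtain v y' where v: "(x \<otimes> cut (- E) f) v \<noteq> \<z>" "y y' \<noteq> \<z>" "p = v \<star> y'"
      using mult_supp[of "x \<otimes> cut (- E) f" y p] c by auto
    then obtain x' z where z: "x x' \<noteq> \<z>" "cut (- E) f z \<noteq> \<z>" "v = x' \<star> z"
      using mult_supp[of x "cut (- E) f" v] c by auto
    have "x' = u" "y' = w" using homogD[OF x z(1)] homogD[OF y v(2)] by auto
    then show False using only[of z] z v by (auto simp: cut_apply split: if_splits)
  qed
  moreover have "(x \<otimes> cut E f \<otimes> y) p \<in> carrier R" using c coeff by simp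
  ultimately show ?thesis using c by (simp add: add_apply)
qed

lemma sandwich_supp:
  assumes x: "x \<in> homog u" and f: "f \<in> carrier S" and y: "y \<in> homog w" and "(x \<otimes> f \<otimes> y) p \<noteq> \<z>"
  obtains z where "f z \<noteq> \<z>" "p = u \<star> z \<star> w" "z \<in> carrier G"
proof -
  have c: "x \<in> carrier S" "y \<in> carrier S" using x y by auto
  obtain v y' where v: "(x \<otimes> f) v \<noteq> \<z>" "y y' \<noteq> \<z>" "p = v \<star> y'"
    using mult_supp[of "x \<otimes> f" y p] c f assms(4) by auto
  obtain x' z where z: "x x' \<noteq> \<z>" "f z \<noteq> \<z>" "v = x' \<star> z"
    using mult_supp[of x f v] c f v(1) by auto
  have "x' = u" "y' = w" using homogD[OF x z(1)] homogD[OF y v(2)] by auto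
  then show thesis using that[of z] z v supp_carrier[OF f] by simp
qed

lemma ann_antimono: "L \<subseteq> H \<Longrightarrow> ann H a b \<Longrightarrow> ann L a b" unfolding ann_def by blast

lemma ann_sub:
  assumes "ann H a b" "ann H a' b" "a \<in> carrier S" "a' \<in> carrier S" "b \<in> carrier S"
  shows "ann H (a \<ominus> a') b"
  unfolding ann_def
proof (intro ballI)
  fix h s assume s: "h \<in> H" "s \<in> homog h"
  have "(a \<ominus> a') \<otimes> s \<otimes> b = a \<otimes> s \<otimes> b \<ominus> a' \<otimes> s \<otimes> b"
    using assms homog_carrier[OF s(2)] by (simp add: a_minus_def S.l_distr S.l_minus)
  then show "(a \<ominus> a') \<otimes> s \<otimes> b = \<zero>" using annD[OF assms(1) s] annD[OF assms(2) s] by (simp add: a_minus_def)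
qed

lemma ann_sandwich:
  assumes H: "subgroup H G" and ab: "ann H a b" "a \<in> carrier S" "b \<in> carrier S"
    and x: "x \<in> homog u" "u \<in> H" and y: "y \<in> homog w" "w \<in> H"
  shows "ann H (x \<otimes> a \<otimes> y) b" "ann H a (x \<otimes> b \<otimes> y)"
proof -
  have c: "x \<in> carrier S" "y \<in> carrier S" using x y by auto
  have "ann H (x \<otimes> a) b" by (rule ann_left[OF ab(1-3) c(1)])
  then show "ann H (x \<otimes> a \<otimes> y) b"
    by (rule ann_mid(2)[OF H]) (use c ab y homogD in auto)
  have "ann H a (x \<otimes> b)" by (rule ann_mid(1)[OF H ab]) (use x homogD in auto)
  then show "ann H a (x \<otimes> b \<otimes> y)" by (rule ann_right) (use c ab in auto)
qed

text \<open>Nonzero coefficients at the identity can be arranged by \<open>shift_right\<close>. They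
  make both supports meet the FC center, and restriction to a subgroup is aimed at preserving
  them.\<close>

definition annihilating_pair :: "'g set \<Rightarrow> ('g \<Rightarrow> 'r) \<Rightarrow> ('g \<Rightarrow> 'r) \<Rightarrow> ('g \<Rightarrow> 'r) \<Rightarrow> bool" where
  "annihilating_pair H j a b \<longleftrightarrow> separating H j \<and> a \<in> gen H j \<and> b \<in> gen H j \<and> a \<e> \<noteq> \<z> \<and> b \<e> \<noteq> \<z> \<and> ann H a b"

definition graded_prime :: bool where
  "graded_prime \<longleftrightarrow> (\<forall>a\<in>homog \<e>. \<forall>b\<in>homog \<e>. a \<noteq> \<zero> \<longrightarrow> b \<noteq> \<zero> \<longrightarrow>
     (\<exists>x\<in>carrier G. \<exists>s\<in>homog x. a \<otimes> s \<otimes> b \<noteq> \<zero>))"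

context
  assumes graded_prime: graded_prime
begin

text \<open>The shifts of \<open>a\<close> and \<open>b\<close> to degree \<open>\<e>\<close> are
  made on their inner sides and become part of the middle element.\<close>

lemma graded_primeE:
  assumes a: "a \<in> homog x" "a \<noteq> \<zero>" and b: "b \<in> homog y" "b \<noteq> \<zero>"
  obtains w s where "w \<in> carrier G" "s \<in> homog w" "a \<otimes> s \<otimes> b \<noteq> \<zero>"
proof -
  have G: "x \<in> carrier G" "y \<in> carrier G" using homog_nonzero_carrier a b by blast+
  obtain t where t: "t \<in> homog (\<iota> x)" "a \<otimes> t \<noteq> \<zero>" using homog_ex_right[OF a] by blast
  obtain t' where t': "t' \<in> homog (\<iota> y)" "t' \<otimes> b \<noteq> \<zero>" using homog_ex_left[OF b] by blast
  have "a \<otimes> t \<in> homog \<e>" by (rule homog_mult_eq[OF a(1) t(1)]) (simp add: G)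
  moreover have "t' \<otimes> b \<in> homog \<e>" by (rule homog_mult_eq[OF t'(1) b(1)]) (simp add: G)
  ultimately obtain w s where s: "w \<in> carrier G" "s \<in> homog w" "(a \<otimes> t) \<otimes> s \<otimes> (t' \<otimes> b) \<noteq> \<zero>"
    using graded_prime t t' unfolding graded_prime_def by blast
  have "(a \<otimes> t) \<otimes> s \<otimes> (t' \<otimes> b) = a \<otimes> (t \<otimes> s \<otimes> t') \<otimes> b"
    using a b t t' s by (simp add: S.m_assoc homog_carrier)
  then show thesis using s t t' G by (intro that[of "\<iota> x \<star> w \<star> \<iota> y" "t \<otimes> s \<otimes> t'"]) auto
qed

text \<open>With \<open>x = j' \<otimes> s0\<close> and
  \<open>y = s1 \<otimes> j' \<otimes> t\<close>, each homogeneous component \<open>g\<close> of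
  \<open>f\<close> is enclosed as
  \<open>j' \<otimes> (s0 \<otimes> g \<otimes> s1) \<otimes> j'\<close>, which vanishes unless the
  degree in the middle lies in \<open>L\<close>. The opposite degrees of \<open>x\<close> and
  \<open>y\<close> conjugate the support and keep the identity in place, where \<open>s1\<close> and
  \<open>t\<close> are chosen to preserve the coefficient.\<close>

lemma restrict_sandwich:
  assumes separating: "separating H j" and j': "j' \<in> gen H j" "j' \<in> homog \<e>"
    and L: "subgroup L G" "L \<subseteq> H" "\<forall>x\<in>H. \<forall>s\<in>homog x. j' \<otimes> s \<otimes> j' \<noteq> \<zero> \<longrightarrow> x \<in> L"
    and f: "f \<in> carrier S" and u: "u \<in> H" "s0 \<in> homog u" "j' \<otimes> s0 \<otimes> cut {\<e>} f \<noteq> \<zero>"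
  obtains x y where "x \<in> homog u" "y \<in> homog (\<iota> u)" "x \<otimes> f \<otimes> y \<in> gen L j'" "(x \<otimes> f \<otimes> y) \<e> \<noteq> \<z>"
proof -
  note H = H_sub[OF separating]
  have uG: "u \<in> carrier G" using G.sub_mem[OF H u(1)] .
  have fe: "cut {\<e>} f \<in> homog \<e>" using cut_homog[OF f] .
  have kill: "x \<in> L" if x: "x \<in> carrier G" "s \<in> homog x" "j' \<otimes> s \<otimes> j' \<noteq> \<zero>" for x s
  proof (cases "x \<in> H")
    case True
    then show ?thesis using L(3) x by blast
  next
    case False
    then show ?thesis using gen_kill[OF separating j'(1) j'(1) x(1) _ x(2)] x(3) by blast
  qed
  define c where "c = j' \<otimes> s0 \<otimes> cut {\<e>} f"
  have c1: "j' \<otimes> s0 \<in> homog u" by (rule homog_mult_eq[OF j'(2) u(2)]) (simp add: uG)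
  have c: "c \<in> homog u" unfolding c_def by (rule homog_mult_eq[OF c1 fe]) (simp add: uG)
  have c0: "c \<noteq> \<zero>" using u(3) unfolding c_def .
  have cc: "j' \<in> carrier S" "s0 \<in> carrier S" "cut {\<e>} f \<in> carrier S" using j' u f by auto
  have j'0: "j' \<noteq> \<zero>" using u(3) cc by auto
  obtain v s1 where v: "v \<in> carrier G" "s1 \<in> homog v" "c \<otimes> s1 \<otimes> j' \<noteq> \<zero>"
    using graded_primeE[OF c c0 j'(2) j'0] by blast
  have s1c: "s1 \<in> carrier S" using v by auto
  have m1: "s0 \<otimes> cut {\<e>} f \<in> homog u" by (rule homog_mult_eq[OF u(2) fe]) (simp add: uG)
  \<comment> \<open>This puts the degree of the right multiplier \<open>t\<close> into
    \<open>L\<close>, as required by \<open>gen L j'\<close>. It holds because the nonzero product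
    \<open>c \<otimes> s1 \<otimes> j'\<close> contains \<open>j'\<close> twice.\<close>
  have uvL: "u \<star> v \<in> L"
  proof (rule kill)
    show "u \<star> v \<in> carrier G" using uG v by simp
    show "s0 \<otimes> cut {\<e>} f \<otimes> s1 \<in> homog (u \<star> v)" using homog_mult[OF m1 v(2)] .
    show "j' \<otimes> (s0 \<otimes> cut {\<e>} f \<otimes> s1) \<otimes> j' \<noteq> \<zero>" using v(3) cc s1c unfolding c_def by (simp add: S.m_assoc)
  qed
  have uv: "u \<star> v \<in> carrier G" using uG v by simp
  have d: "c \<otimes> s1 \<otimes> j' \<in> homog (u \<star> v)"
    by (rule homog_mult_eq[OF homog_mult[OF c v(2)] j'(2)]) (simp add: uG v)
  obtain t where t: "t \<in> homog (\<iota> (u \<star> v))" "c \<otimes> s1 \<otimes> j' \<otimes> t \<noteq> \<zero>" using homog_ex_right[OF d v(3)] by blast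
  have tc: "t \<in> carrier S" using t by auto
  define x y where "x = j' \<otimes> s0" and "y = s1 \<otimes> j' \<otimes> t"
  have x: "x \<in> homog u" unfolding x_def using c1 .
  have "s1 \<otimes> j' \<in> homog v" by (rule homog_mult_eq[OF v(2) j'(2)]) (simp add: v)
  then have y: "y \<in> homog (\<iota> u)" unfolding y_def
    by (rule homog_mult_eq[OF _ t(1)]) (simp add: uG v G.inv_mult_group G.group_word)
  have "x \<otimes> g \<otimes> y \<in> gen L j'" if "g \<in> carrier S" for g
    using that
  proof (induction g rule: carrier_induct)
    case zero
    then show ?case using x y gen.gen_zero by (simp add: homog_carrier)
  next
    case (homog z g)
    have gc: "g \<in> carrier S" using homog by auto
    have r: "s0 \<otimes> g \<otimes> s1 \<in> homog (u \<star> z \<star> v)" using u(2) homog(2) v(2) by auto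
    have e: "x \<otimes> g \<otimes> y = (j' \<otimes> (s0 \<otimes> g \<otimes> s1)) \<otimes> j' \<otimes> t"
      unfolding x_def y_def using cc gc s1c tc by (simp add: S.m_assoc)
    have uzv: "u \<star> z \<star> v \<in> carrier G" using uG v homog by simp
    show ?case
    proof (cases "u \<star> z \<star> v \<in> L")
      case True
      have "j' \<otimes> (s0 \<otimes> g \<otimes> s1) \<in> homog (u \<star> z \<star> v)" by (rule homog_mult_eq[OF j'(2) r]) (simp add: uzv)
      then show ?thesis unfolding e using gen.gen_incl[OF _ t(1) True G.sub_inv[OF L(1) uvL]] by blast
    next
      case False
      then have "j' \<otimes> (s0 \<otimes> g \<otimes> s1) \<otimes> j' = \<zero>" using kill[OF uzv r] by blast
      then show ?thesis unfolding e using tc gen.gen_zero by simp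
    qed
  next
    case (add f g)
    have "x \<otimes> (f \<oplus> g) \<otimes> y = x \<otimes> f \<otimes> y \<oplus> x \<otimes> g \<otimes> y"
      using add x y by (simp add: S.l_distr S.r_distr homog_carrier)
    then show ?case using add gen.gen_add by simp
  qed
  moreover have "(x \<otimes> f \<otimes> y) \<e> \<noteq> \<z>"
  proof -
    have "(x \<otimes> f \<otimes> y) \<e> = (x \<otimes> cut {\<e>} f \<otimes> y) \<e>"
    proof (rule sandwich_cut[OF x f y])
      fix z assume z: "f z \<noteq> \<z>" "u \<star> z \<star> \<iota> u = \<e>"
      have zG: "z \<in> carrier G" using z supp_carrier[OF f] by simp
      have "z = \<iota> u \<star> (u \<star> z \<star> \<iota> u) \<star> u" using zG uG by (simp add: G.group_word)
      then show "z \<in> {\<e>}" using z uG by simp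
    qed
    moreover have "x \<otimes> cut {\<e>} f \<otimes> y = c \<otimes> s1 \<otimes> j' \<otimes> t"
      unfolding x_def y_def c_def using cc s1c tc by (simp add: S.m_assoc)
    moreover have "c \<otimes> s1 \<otimes> j' \<otimes> t \<in> homog \<e>" by (rule homog_mult_eq[OF d t(1)]) (use uv in simp)
    ultimately show ?thesis using homog_nonzero t(2) by metis
  qed
  ultimately show thesis using that x y f by blast
qed

text \<open>The enclosing elements have degrees in \<open>H\<close>, so annihilation through
  \<open>H\<close>, and then through \<open>L\<close>, persists. As the supports are only conjugated
  and thinned out, the counts of the new pair can be bounded by those of the old one.\<close>

lemma restrict_pair:
  assumes annihilating_pair: "annihilating_pair H j a b" and j': "j' \<in> gen H j" "j' \<in> homog \<e>"
    and L: "subgroup L G" "L \<subseteq> H" "\<forall>x\<in>H. \<forall>s\<in>homog x. j' \<otimes> s \<otimes> j' \<noteq> \<zero> \<longrightarrow> x \<in> L"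
    and u: "u \<in> H" "s0 \<in> homog u" "j' \<otimes> s0 \<otimes> cut {\<e>} a \<noteq> \<zero>"
    and v: "v \<in> H" "s1 \<in> homog v" "j' \<otimes> s1 \<otimes> cut {\<e>} b \<noteq> \<zero>"
  obtains a' b' where "annihilating_pair L j' a' b'" "supp R a' \<subseteq> cj u ` supp R a" "supp R b' \<subseteq> cj v ` supp R b"
proof -
  have separating: "separating H j" and a: "a \<in> gen H j" and b: "b \<in> gen H j" and an: "ann H a b" using annihilating_pair unfolding annihilating_pair_def by auto
  note H = H_sub[OF separating]
  have ac: "a \<in> carrier S" and bc: "b \<in> carrier S" using gen_carrier[OF separating] a b by auto
  obtain x y where xy: "x \<in> homog u" "y \<in> homog (\<iota> u)" "x \<otimes> a \<otimes> y \<in> gen L j'" "(x \<otimes> a \<otimes> y) \<e> \<noteq> \<z>"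
    using restrict_sandwich[OF separating j' L ac u] by blast
  obtain x' y' where xy': "x' \<in> homog v" "y' \<in> homog (\<iota> v)" "x' \<otimes> b \<otimes> y' \<in> gen L j'" "(x' \<otimes> b \<otimes> y') \<e> \<noteq> \<z>"
    using restrict_sandwich[OF separating j' L bc v] by blast
  have "separating L j'" unfolding separating_def
  proof (intro conjI ballI)
    fix x s assume x: "x \<in> carrier G - L" "s \<in> homog x"
    show "j' \<otimes> s \<otimes> j' = \<zero>"
    proof (cases "x \<in> H")
      case True
      then show ?thesis using L(3) x by blast
    next
      case False
      then show ?thesis using gen_kill[OF separating j'(1) j'(1) _ False x(2)] x(1) by blast
    qed
  qed (use L j' in auto)
  moreover have "ann H (x \<otimes> a \<otimes> y) (x' \<otimes> b \<otimes> y')"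
  proof (rule ann_sandwich(1)[OF H _ ac _ xy(1) u(1) xy(2) G.sub_inv[OF H u(1)]])
    show "ann H a (x' \<otimes> b \<otimes> y')" by (rule ann_sandwich(2)[OF H an ac bc xy'(1) v(1) xy'(2) G.sub_inv[OF H v(1)]])
  qed (use bc xy' in \<open>simp add: homog_carrier\<close>)
  ultimately have "annihilating_pair L j' (x \<otimes> a \<otimes> y) (x' \<otimes> b \<otimes> y')"
    unfolding annihilating_pair_def using xy xy' ann_antimono[OF L(2)] by blast
  moreover have "supp R (x \<otimes> a \<otimes> y) \<subseteq> cj u ` supp R a"
  proof
    fix p assume "p \<in> supp R (x \<otimes> a \<otimes> y)"
    then obtain z where "a z \<noteq> \<z>" "p = u \<star> z \<star> \<iota> u" using sandwich_supp[OF xy(1) ac xy(2)] in_supp by metis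
    then show "p \<in> cj u ` supp R a" unfolding G.conj_by_def using in_supp by blast
  qed
  moreover have "supp R (x' \<otimes> b \<otimes> y') \<subseteq> cj v ` supp R b"
  proof
    fix p assume "p \<in> supp R (x' \<otimes> b \<otimes> y')"
    then obtain z where "b z \<noteq> \<z>" "p = v \<star> z \<star> \<iota> v" using sandwich_supp[OF xy'(1) bc xy'(2)] in_supp by metis
    then show "p \<in> cj v ` supp R b" unfolding G.conj_by_def using in_supp by blast
  qed
  ultimately show thesis using that by blast
qed

lemma gen_reach:
  assumes separating: "separating H j" and k: "k \<in> gen H j" "k \<in> homog \<e>" "k \<noteq> \<zero>"
    and f: "f \<in> gen H j" "f \<e> \<noteq> \<z>"
  obtains u s where "u \<in> H" "s \<in> homog u" "k \<otimes> s \<otimes> cut {\<e>} f \<noteq> \<zero>"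
proof -
  have fc: "f \<in> carrier S" using gen_carrier[OF separating f(1)] .
  have "cut {\<e>} f \<noteq> \<zero>" using cut_single_nonzero[of f \<e>] f(2) by simp
  then obtain u s where u: "u \<in> carrier G" "s \<in> homog u" "k \<otimes> s \<otimes> cut {\<e>} f \<noteq> \<zero>"
    using graded_primeE[OF k(2,3) cut_homog[OF fc]] by blast
  moreover have "u \<in> H"
    using gen_kill[OF separating k(1) gen_cut[OF separating f(1)] u(1) _ u(2)] u(3) by blast
  ultimately show thesis using that by blast
qed

end

end

section \<open>Minimal pairs\<close>

context graded begin

definition coset_count :: "'g set \<Rightarrow> ('g \<Rightarrow> 'r) \<Rightarrow> nat" where "coset_count H b = card (G.FC_coset H ` supp R b)"
definition FC_count :: "'g set \<Rightarrow> ('g \<Rightarrow> 'r) \<Rightarrow> nat" where "FC_count H a = card (supp R a \<inter> G.FC H)"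
text \<open>Conjugates of the FC part are counted as maps and not as sets, so this is the index in
  \<open>H\<close> of the centralizer of the FC part.\<close>

definition conj_count :: "'g set \<Rightarrow> ('g \<Rightarrow> 'r) \<Rightarrow> nat" where
  "conj_count H a = card ((\<lambda>h. restrict (cj h) (supp R a \<inter> G.FC H)) ` H)"

definition minimal_pair :: "'g set \<Rightarrow> ('g \<Rightarrow> 'r) \<Rightarrow> ('g \<Rightarrow> 'r) \<Rightarrow> ('g \<Rightarrow> 'r) \<Rightarrow> bool" where
  "minimal_pair H j a b \<longleftrightarrow> annihilating_pair H j a b \<and>
     (\<forall>H' j' a' b'. annihilating_pair H' j' a' b' \<longrightarrow> coset_count H b \<le> coset_count H' b' \<and>
       (coset_count H' b' \<le> coset_count H b \<longrightarrow> FC_count H a \<le> FC_count H' a' \<and>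
         (FC_count H' a' \<le> FC_count H a \<longrightarrow> conj_count H a \<le> conj_count H' a')))"

lemma ex_minimal_pair:
  assumes "annihilating_pair H0 j0 a0 b0" obtains H j a b where "minimal_pair H j a b"
proof -
  define f where "f = (\<lambda>(H, j :: 'g \<Rightarrow> 'r, a :: 'g \<Rightarrow> 'r, b). coset_count H b)"
  define g where "g = (\<lambda>(H, j :: 'g \<Rightarrow> 'r, a, b :: 'g \<Rightarrow> 'r). FC_count H a)"
  define k where "k = (\<lambda>(H, j :: 'g \<Rightarrow> 'r, a, b :: 'g \<Rightarrow> 'r). conj_count H a)"
  define P where "P = {(H, j, a, b). annihilating_pair H j a b}"
  have "wf (measures [f, g, k])" by simp
  moreover have "(H0, j0, a0, b0) \<in> P" using assms unfolding P_def by simp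
  ultimately obtain z where z: "z \<in> P" "\<And>y. (y, z) \<in> measures [f, g, k] \<Longrightarrow> y \<notin> P"
    using wfE_min by metis
  obtain H j a b where zz: "z = (H, j, a, b)" by (cases z) auto
  have "minimal_pair H j a b" unfolding minimal_pair_def
  proof (intro conjI allI impI)
    show "annihilating_pair H j a b" using z(1) zz unfolding P_def by simp
    fix H' j' a' b' assume p: "annihilating_pair H' j' a' b'"
    have n: "((H', j', a', b'), z) \<notin> measures [f, g, k]" using z(2) p unfolding P_def by blast
    show "coset_count H b \<le> coset_count H' b'" using n unfolding zz f_def by simp
    assume le: "coset_count H' b' \<le> coset_count H b"
    then have e: "coset_count H' b' = coset_count H b" using \<open>coset_count H b \<le> coset_count H' b'\<close> by simp
    show "FC_count H a \<le> FC_count H' a'" using n e unfolding zz f_def g_def by simp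
    assume "FC_count H' a' \<le> FC_count H a"
    then have "FC_count H' a' = FC_count H a" using \<open>FC_count H a \<le> FC_count H' a'\<close> by simp
    then show "conj_count H a \<le> conj_count H' a'" using n e unfolding zz f_def g_def k_def by simp
  qed
  then show thesis using that by blast
qed

text \<open>Elements of \<open>L\<close> that are congruent modulo the FC center of \<open>H\<close>
  are congruent modulo that of \<open>L\<close>, where fewer conjugations have to be controlled.
  Cosets can merge but not split.\<close>

lemma coset_count_restrict:
  assumes H: "subgroup H G" and L: "subgroup L G" "L \<subseteq> H" and u: "u \<in> H"
    and b: "finite (supp R b)" "supp R b \<subseteq> H" and b': "supp R b' \<subseteq> cj u ` supp R b" "supp R b' \<subseteq> L"
  shows "coset_count L b' \<le> coset_count H b"
  unfolding coset_count_def
proof (rule card_image_factor[where g = "cj (\<iota> u)"])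
  have uG: "u \<in> carrier G" using G.sub_mem[OF H u] .
  have g: "cj (\<iota> u) z \<in> supp R b \<and> cj u (cj (\<iota> u) z) = z" if z: "z \<in> supp R b'" for z
  proof -
    obtain x where x: "x \<in> supp R b" "z = cj u x" using z b' by blast
    then have "x \<in> carrier G" using b(2) G.sub_mem[OF H] by blast
    then show ?thesis using x uG by (simp add: G.conj_by_conj_by)
  qed
  show "finite (supp R b)" using b by simp
  show "cj (\<iota> u) z \<in> supp R b" if "z \<in> supp R b'" for z using g[OF that] by simp
  fix z z' assume z: "z \<in> supp R b'" "z' \<in> supp R b'" and e: "G.FC_coset H (cj (\<iota> u) z) = G.FC_coset H (cj (\<iota> u) z')"
  have xG: "cj (\<iota> u) z \<in> carrier G" "cj (\<iota> u) z' \<in> carrier G"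
    using g[OF z(1)] g[OF z(2)] b(2) G.sub_mem[OF H] by blast+
  have zL: "z \<in> L" "z' \<in> L" using z b'(2) by auto
  have zG: "z \<in> carrier G" "z' \<in> carrier G" using zL G.sub_mem[OF L(1)] by auto
  have "cj (\<iota> u) z \<star> \<iota> (cj (\<iota> u) z') \<in> G.FC H" using e G.FC_coset_eq[OF H xG] by simp
  then have "cj u (cj (\<iota> u) z \<star> \<iota> (cj (\<iota> u) z')) \<in> G.FC H" using G.FC_conj[OF H _ u] by blast
  then have "z \<star> \<iota> z' \<in> G.FC H"
    using g[OF z(1)] g[OF z(2)] xG uG by (simp add: G.conj_by_mult G.conj_by_inv)
  then have "z \<star> \<iota> z' \<in> G.FC L"
    unfolding G.FC_eq[OF H] G.FC_eq[OF L(1)] using G.almost_centralizer_antimono[OF L(2)] zL G.sub_mult[OF L(1)] G.sub_inv[OF L(1)] by blast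
  then show "G.FC_coset L z = G.FC_coset L z'" using G.FC_coset_eq[OF L(1) zG] by simp
qed

text \<open>If no such \<open>z\<close> existed, then for a \<open>k\<close> reaching the fewest conjugates of \<open>Y\<close>, the stabilizer of the set of these would carry a pair with a smaller
  \<open>conj_count\<close>.\<close>

lemma minimal_reach:
  assumes graded_prime: graded_prime and min: "minimal_pair H j a b"
    and k: "k \<in> gen H j" "k \<in> homog \<e>" "k \<noteq> \<zero>" and z0: "z0 \<in> H"
  defines "Y \<equiv> supp R a \<inter> G.FC H"
  shows "\<exists>z\<in>H. \<exists>s\<in>homog z. restrict (cj z) Y = restrict (cj z0) Y \<and> k \<otimes> s \<otimes> cut {\<e>} a \<noteq> \<zero>"
proof (rule ccontr)
  assume neg: "\<not> ?thesis"
  have annihilating_pair: "annihilating_pair H j a b" using min unfolding minimal_pair_def by simp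
  have separating: "separating H j" and a: "a \<in> gen H j" "a \<e> \<noteq> \<z>" and b: "b \<in> gen H j" "b \<e> \<noteq> \<z>"
    using annihilating_pair unfolding annihilating_pair_def by auto
  note H = H_sub[OF separating]
  note HG = G.sub_mem[OF H] and Hm = G.sub_mult[OF H] and Hi = G.sub_inv[OF H]
  have ac: "a \<in> carrier S" and bc: "b \<in> carrier S" using gen_carrier[OF separating] a b by auto
  have YG: "y \<in> carrier G" if "y \<in> Y" for y using that HG G.FC_subset unfolding Y_def by blast
  have finY: "finite Y" unfolding Y_def using finite_supp[OF ac] by simp
  define \<kappa> where "\<kappa> h = restrict (cj h) Y" for h
  have conj_count: "conj_count H a = card (\<kappa> ` H)" unfolding conj_count_def \<kappa>_def Y_def ..
  define Orb where "Orb = \<kappa> ` H"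
  have finO: "finite Orb"
  proof -
    have "Orb \<subseteq> Y \<rightarrow>\<^sub>E (\<Union>y\<in>Y. (\<lambda>h. cj h y) ` H)" unfolding Orb_def \<kappa>_def by (intro image_subsetI restrict_PiE_iff[THEN iffD2]) blast
    moreover have "finite (\<Union>y\<in>Y. (\<lambda>h. cj h y) ` H)" using finY G.FC_finite unfolding Y_def by blast
    ultimately show ?thesis using finite_PiE[OF finY] finite_subset by metis
  qed
  define act where "act x f = (\<lambda>y\<in>Y. cj x (f y))" for x f
  have act\<kappa>: "act x (\<kappa> h) = \<kappa> (x \<star> h)" if "x \<in> H" "h \<in> H" for x h
    unfolding act_def \<kappa>_def using that HG YG by (intro restrict_ext) (simp add: G.conj_by_conj_by)
  have actO: "act x f \<in> Orb" if "x \<in> H" "f \<in> Orb" for x f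
    using that act\<kappa> Hm unfolding Orb_def by auto
  have act1: "act \<e> f = f" if f: "f \<in> Orb" for f
  proof -
    obtain h where "h \<in> H" "f = \<kappa> h" using f unfolding Orb_def by blast
    then show ?thesis using act\<kappa>[OF G.sub_one[OF H], of h] HG by simp
  qed
  have actm: "act (x \<star> y) f = act x (act y f)" if xy: "x \<in> H" "y \<in> H" "f \<in> Orb" for x y f
  proof -
    obtain h where "h \<in> H" "f = \<kappa> h" using xy unfolding Orb_def by blast
    then show ?thesis using xy act\<kappa> Hm HG by (simp add: G.m_assoc)
  qed
  \<comment> \<open>The maps \<open>\<kappa> z\<close> that \<open>j1\<close> reaches: some element
    of degree \<open>z\<close> links \<open>j1\<close> to the identity component of \<open>a\<close>
    with nonzero product.\<close>
  define P where "P j1 = {\<kappa> z | z. z \<in> H \<and> (\<exists>s\<in>homog z. j1 \<otimes> s \<otimes> cut {\<e>} a \<noteq> \<zero>)}" for j1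
  have PO: "P j1 \<subseteq> Orb" for j1 unfolding P_def Orb_def by blast
  define ok where "ok j1 \<longleftrightarrow> j1 \<in> gen H j \<and> j1 \<in> homog \<e> \<and> j1 \<noteq> \<zero> \<and> \<kappa> z0 \<notin> P j1" for j1
  have "ok k" unfolding ok_def P_def using k neg unfolding \<kappa>_def by auto
  from ex_has_least_nat[of ok, OF this, of "\<lambda>j1. card (P j1)"]
  obtain j1 where j1: "ok j1" and least: "\<And>j2. ok j2 \<Longrightarrow> card (P j1) \<le> card (P j2)" by blast
  have j1': "j1 \<in> gen H j" "j1 \<in> homog \<e>" "j1 \<noteq> \<zero>" using j1 unfolding ok_def by auto
  have j1c: "j1 \<in> carrier S" using j1' by auto
  have finP: "finite (P j1)" using PO finO finite_subset by blast
  define L where "L = {l \<in> H. act l ` P j1 = P j1}"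
  have L: "subgroup L G" unfolding L_def by (rule G.stabilizer_subgroup[OF H PO act1 actm])
  have LH: "L \<subseteq> H" unfolding L_def by blast
  have TL: "\<forall>x\<in>H. \<forall>s\<in>homog x. j1 \<otimes> s \<otimes> j1 \<noteq> \<zero> \<longrightarrow> x \<in> L"
  proof (intro ballI impI)
    fix x s assume x: "x \<in> H" "s \<in> homog x" "j1 \<otimes> s \<otimes> j1 \<noteq> \<zero>"
    have xG: "x \<in> carrier G" using HG x by simp
    have sc: "s \<in> carrier S" using x by auto
    have m1: "j1 \<otimes> s \<in> homog x" by (rule homog_mult_eq[OF j1'(2) x(2)]) (simp add: xG)
    have m: "j1 \<otimes> s \<otimes> j1 \<in> homog x" by (rule homog_mult_eq[OF m1 j1'(2)]) (simp add: xG)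
    obtain t where t: "t \<in> homog (\<iota> x)" "t \<otimes> (j1 \<otimes> s \<otimes> j1) \<noteq> \<zero>" using homog_ex_left[OF m x(3)] by blast
    have tc: "t \<in> carrier S" using t by auto
    \<comment> \<open>As \<open>j3\<close> contains \<open>j1\<close> twice, whatever it reaches at
      \<open>z\<close> is reached by \<open>j1\<close> at \<open>z\<close> and at
      \<open>x \<star> z\<close>. Minimality turns \<open>P j3 \<subseteq> P j1\<close> into
      equality, so \<open>x\<close> maps \<open>P j1\<close> into itself.\<close>
    define j3 where "j3 = t \<otimes> (j1 \<otimes> s \<otimes> j1)"
    have P3: "\<kappa> z \<in> P j1 \<and> \<kappa> (x \<star> z) \<in> P j1" if z: "z \<in> H" "s' \<in> homog z" "j3 \<otimes> s' \<otimes> cut {\<e>} a \<noteq> \<zero>" for z s'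
    proof -
      have s'c: "s' \<in> carrier S" and ca: "cut {\<e>} a \<in> carrier S" using z ac by auto
      have "j3 \<otimes> s' \<otimes> cut {\<e>} a = (t \<otimes> j1 \<otimes> s) \<otimes> (j1 \<otimes> s' \<otimes> cut {\<e>} a)"
        unfolding j3_def using j1c sc tc s'c ca by (simp add: S.m_assoc)
      then have "j1 \<otimes> s' \<otimes> cut {\<e>} a \<noteq> \<zero>" using z(3) j1c sc tc by auto
      moreover have "j3 \<otimes> s' \<otimes> cut {\<e>} a = t \<otimes> (j1 \<otimes> (s \<otimes> j1 \<otimes> s') \<otimes> cut {\<e>} a)"
        unfolding j3_def using j1c sc tc s'c ca by (simp add: S.m_assoc)
      then have "j1 \<otimes> (s \<otimes> j1 \<otimes> s') \<otimes> cut {\<e>} a \<noteq> \<zero>" using z(3) tc by auto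
      moreover have "s \<otimes> j1 \<in> homog x" by (rule homog_mult_eq[OF x(2) j1'(2)]) (simp add: xG)
      then have "s \<otimes> j1 \<otimes> s' \<in> homog (x \<star> z)" using z(2) by (rule homog_mult)
      ultimately show ?thesis unfolding P_def using z Hm[OF x(1) z(1)] by blast
    qed
    have sub: "P j3 \<subseteq> P j1"
    proof
      fix f assume "f \<in> P j3"
      then obtain z s' where "z \<in> H" "s' \<in> homog z" "j3 \<otimes> s' \<otimes> cut {\<e>} a \<noteq> \<zero>" "f = \<kappa> z" unfolding P_def by blast
      then show "f \<in> P j1" using P3 by simp
    qed
    have "ok j3" unfolding ok_def
    proof (intro conjI)
      show "j3 \<in> gen H j" unfolding j3_def
        by (rule gen_left[OF separating gen_mult[OF separating gen_right[OF separating j1'(1) x(2,1)] j1'(1)] t(1) Hi[OF x(1)]])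
      show "j3 \<in> homog \<e>" unfolding j3_def by (rule homog_mult_eq[OF t(1) m]) (simp add: xG)
      show "j3 \<noteq> \<zero>" unfolding j3_def using t(2) .
      show "\<kappa> z0 \<notin> P j3" using sub j1 unfolding ok_def by blast
    qed
    then have eq: "P j3 = P j1" using least card_seteq[OF finP sub] by blast
    have "act x ` P j1 \<subseteq> P j1"
    proof
      fix f assume "f \<in> act x ` P j1"
      then obtain f' where f': "f' \<in> P j3" "f = act x f'" unfolding eq by blast
      then obtain z s' where "z \<in> H" "s' \<in> homog z" "j3 \<otimes> s' \<otimes> cut {\<e>} a \<noteq> \<zero>" "f' = \<kappa> z" unfolding P_def by blast
      then show "f \<in> P j1" using P3 f' act\<kappa>[OF x(1)] by simp
    qed
    then show "x \<in> L" unfolding L_def using G.stabilizer_memI[OF H PO finP act1 actm x(1)] by blast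
  qed
  obtain z s where z: "z \<in> H" "s \<in> homog z" "j1 \<otimes> s \<otimes> cut {\<e>} a \<noteq> \<zero>"
    using gen_reach[OF graded_prime separating j1' a] by blast
  obtain v s' where v: "v \<in> H" "s' \<in> homog v" "j1 \<otimes> s' \<otimes> cut {\<e>} b \<noteq> \<zero>"
    using gen_reach[OF graded_prime separating j1' b] by blast
  obtain a' b' where new: "annihilating_pair L j1 a' b'" "supp R a' \<subseteq> cj z ` supp R a" "supp R b' \<subseteq> cj v ` supp R b"
    using restrict_pair[OF graded_prime annihilating_pair j1'(1,2) L LH TL z v] by blast
  have good': "separating L j1" "a' \<in> gen L j1" "b' \<in> gen L j1" using new(1) unfolding annihilating_pair_def by auto
  have zG: "z \<in> carrier G" using z HG by simp
  have a'L: "supp R a' \<subseteq> L" "supp R b' \<subseteq> L" using gen_supp[OF good'(1)] good'(2,3) in_supp by blast+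
  have bH: "supp R b \<subseteq> H" and aH: "supp R a \<subseteq> H" using gen_supp[OF separating] a b in_supp by blast+
  have "coset_count L b' \<le> coset_count H b" by (rule coset_count_restrict[OF H L LH v(1) finite_supp[OF bc] bH new(3) a'L(2)])
  \<comment> \<open>\<open>L\<close> stabilizes a subset of a finite orbit, so elements that are FC
    in \<open>L\<close> are FC in \<open>H\<close>. The FC part of \<open>a'\<close> thus arises
    from \<open>Y\<close> by conjugation and has not grown.\<close>
  moreover have Y': "supp R a' \<inter> G.FC L \<subseteq> cj z ` Y"
  proof
    fix p assume p: "p \<in> supp R a' \<inter> G.FC L"
    then obtain x where x: "x \<in> supp R a" "p = cj z x" using new(2) by blast
    have "p \<in> G.almost_centralizer L" using p G.FC_eq[OF L] by blast
    then have "p \<in> G.almost_centralizer H" unfolding L_def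
      using G.almost_centralizer_finite_orbit[OF H PO finO actO act1 actm] by blast
    moreover have "p \<in> H" using p a'L LH by blast
    ultimately have "p \<in> G.FC H" using G.FC_eq[OF H] by blast
    then have "cj (\<iota> z) p \<in> G.FC H" by (rule G.FC_conj[OF H _ Hi[OF z(1)]])
    moreover have "x \<in> carrier G" using x aH HG by blast
    then have "cj (\<iota> z) p = x" using x zG by (simp add: G.conj_by_conj_by)
    ultimately show "p \<in> cj z ` Y" using x unfolding Y_def by blast
  qed
  have "FC_count L a' \<le> FC_count H a"
    unfolding FC_count_def using surj_card_le[OF finY Y'] unfolding Y_def .
  ultimately have "conj_count H a \<le> conj_count L a'" using min new(1) unfolding minimal_pair_def by blast
  \<comment> \<open>Conjugation by \<open>l\<close> on the FC part of \<open>a'\<close> is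
    determined by \<open>\<kappa> (l \<star> z)\<close>, which lies in \<open>P j1\<close> because
    \<open>\<kappa> z\<close> does and \<open>l\<close> stabilizes this set. Since
    \<open>P j1\<close> misses \<open>\<kappa> z0\<close>, the count drops strictly.\<close>
  moreover have "conj_count L a' \<le> card (P j1)"
    unfolding conj_count_def
  proof (rule surj_card_le[OF finP])
    let ?Y' = "supp R a' \<inter> G.FC L"
    let ?\<Psi> = "\<lambda>f. \<lambda>y\<in>?Y'. f (cj (\<iota> z) y)"
    show "(\<lambda>h. restrict (cj h) ?Y') ` L \<subseteq> ?\<Psi> ` P j1"
    proof
      fix f assume "f \<in> (\<lambda>h. restrict (cj h) ?Y') ` L"
      then obtain l where l: "l \<in> L" "f = restrict (cj l) ?Y'" by blast
      have lH: "l \<in> H" using l LH by blast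
      have "\<kappa> z \<in> P j1" unfolding P_def using z by blast
      then have "act l (\<kappa> z) \<in> P j1" using l unfolding L_def by blast
      then have mem: "\<kappa> (l \<star> z) \<in> P j1" using act\<kappa>[OF lH z(1)] by simp
      have "f = ?\<Psi> (\<kappa> (l \<star> z))" unfolding l(2)
      proof (rule restrict_ext)
        fix y assume "y \<in> ?Y'"
        then obtain x where x: "x \<in> Y" "y = cj z x" using Y' by blast
        then have "cj (\<iota> z) y = x" using YG zG by (simp add: G.conj_by_conj_by)
        then show "cj l y = \<kappa> (l \<star> z) (cj (\<iota> z) y)"
          unfolding \<kappa>_def using x YG zG HG[OF lH] by (simp add: G.conj_by_conj_by)
      qed
      then show "f \<in> ?\<Psi> ` P j1" using mem by blast
    qed
  qed
  moreover have "card (P j1) < card Orb"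
  proof (rule psubset_card_mono[OF finO])
    have "\<kappa> z0 \<in> Orb" unfolding Orb_def using z0 by blast
    then show "P j1 \<subset> Orb" using PO j1 unfolding ok_def by blast
  qed
  ultimately show False unfolding conj_count Orb_def by simp
qed

end

section \<open>Exclusion of minimal pairs\<close>

context graded begin

text \<open>Translating a nonzero coefficient at \<open>d\<close> to the identity would give a pair
  with the same \<open>b\<close>. As \<open>d\<close> is in the FC center, the FC part of
  \<open>a1\<close> is only translated, so \<open>FC_count\<close> would be undercut.\<close>

lemma minimal_cut_zero:
  assumes min: "minimal_pair H j a b" and a1: "a1 \<in> gen H j" "ann H a1 b"
    and less: "card (supp R a1 \<inter> G.FC H) < FC_count H a" and d: "d \<in> G.FC H"
  shows "a1 d = \<z>"
proof (rule ccontr)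
  assume nz: "a1 d \<noteq> \<z>"
  have annihilating_pair: "annihilating_pair H j a b" using min unfolding minimal_pair_def by simp
  have separating: "separating H j" and b: "b \<in> gen H j" "b \<e> \<noteq> \<z>" using annihilating_pair unfolding annihilating_pair_def by auto
  note H = H_sub[OF separating]
  have a1c: "a1 \<in> carrier S" and bc: "b \<in> carrier S" using gen_carrier[OF separating] a1 b by auto
  have dH: "d \<in> H" using G.FC_subset[OF d] .
  have dG: "d \<in> carrier G" using G.sub_mem[OF H dH] .
  obtain t where t: "t \<in> homog (\<iota> d)" "(a1 \<otimes> t) \<e> \<noteq> \<z>" using shift_right[OF a1c nz] by blast
  have new: "a1 \<otimes> t \<in> gen H j" by (rule gen_right[OF separating a1(1) t(1) G.sub_inv[OF H dH]])
  have "ann H (a1 \<otimes> t) b"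
    by (rule ann_mid(2)[OF H a1(2) a1c bc]) (use t homogD G.sub_inv[OF H dH] in auto)
  then have "annihilating_pair H j (a1 \<otimes> t) b" unfolding annihilating_pair_def using separating new b t by simp
  then have "FC_count H a \<le> FC_count H (a1 \<otimes> t)" using min unfolding minimal_pair_def by blast
  also have "\<dots> \<le> card (supp R a1 \<inter> G.FC H)"
    unfolding FC_count_def
  proof (rule surj_card_le)
    show "finite (supp R a1 \<inter> G.FC H)" using finite_supp[OF a1c] by simp
    show "supp R (a1 \<otimes> t) \<inter> G.FC H \<subseteq> (\<lambda>x. x \<star> \<iota> d) ` (supp R a1 \<inter> G.FC H)"
    proof
      fix p assume p: "p \<in> supp R (a1 \<otimes> t) \<inter> G.FC H"
      then have "(a1 \<otimes> t) p \<noteq> \<z>" by (simp add: in_supp)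
      then obtain x w where x: "a1 x \<noteq> \<z>" "t w \<noteq> \<z>" "p = x \<star> w"
        using mult_supp[OF a1c homog_carrier[OF t(1)]] by blast
      have w: "w = \<iota> d" using homogD[OF t(1) x(2)] .
      have "x \<in> carrier G" using x supp_carrier[OF a1c] by simp
      then have "x = p \<star> d" using x w dG by (simp add: G.m_assoc)
      then have "x \<in> G.FC H" using p d G.FC_mult[OF H] by simp
      then show "p \<in> (\<lambda>x. x \<star> \<iota> d) ` (supp R a1 \<inter> G.FC H)" using x w by (auto simp: in_supp)
    qed
  qed
  finally show False using less by simp
qed

text \<open>Let \<open>\<gamma>\<close> be the identity component of the FC part of \<open>a\<close> times a translate of \<open>b\<close>. The \<open>u\<close> in \<open>H\<close> for which \<open>k s \<gamma> \<noteq> 0\<close> for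
  some \<open>s\<close> of degree \<open>u\<close> are covered by finitely many sets of the form \<open>cj u q \<in> F\<close> with \<open>q\<close> outside the FC center. In a minimal cover, the stabilizer of one of
  these \<open>F\<close> carries a pair in which the cosets of the FC center through some \<open>x\<close> and \<open>q x\<close> have merged, so that
  \<open>coset_count\<close> drops.\<close>

lemma minimal_pair_False:
  assumes graded_prime: graded_prime and no_pair: "\<not> finite_annihilating_pair" and min: "minimal_pair H j a b"
  shows False
proof -
  have annihilating_pair: "annihilating_pair H j a b" using min unfolding minimal_pair_def by simp
  have separating: "separating H j" and a: "a \<in> gen H j" "a \<e> \<noteq> \<z>" and b: "b \<in> gen H j" "b \<e> \<noteq> \<z>" and anab: "ann H a b"
    using annihilating_pair unfolding annihilating_pair_def by auto
  note H = H_sub[OF separating]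
  note HG = G.sub_mem[OF H] and Hm = G.sub_mult[OF H] and Hi = G.sub_inv[OF H]
  have ac: "a \<in> carrier S" and bc: "b \<in> carrier S" using gen_carrier[OF separating] a b by auto
  have bH: "supp R b \<subseteq> H" and aH: "supp R a \<subseteq> H" using gen_supp[OF separating] a b in_supp by blast+
  define D where "D = G.FC H"
  have D: "subgroup D G" unfolding D_def using G.FC_subgroup[OF H] .
  note Dm = G.sub_mult[OF D] and Di = G.sub_inv[OF D] and D1 = G.sub_one[OF D] and DG = G.sub_mem[OF D]
  have DH: "d \<in> H" if "d \<in> D" for d using that G.FC_subset unfolding D_def by blast
  have Dc: "cj h d \<in> D" if "d \<in> D" "h \<in> H" for h d using G.FC_conj[OF H] that unfolding D_def by blast
  have Dcan: "x \<in> D" if "h \<in> H" "x \<in> carrier G" "cj h x \<in> D" for h x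
  proof -
    have "cj (\<iota> h) (cj h x) \<in> D" by (rule Dc[OF that(3) Hi[OF that(1)]])
    then show ?thesis using that HG by (simp add: G.conj_by_conj_by)
  qed
  define Y where "Y = supp R a \<inter> D"
  have finY: "finite Y" unfolding Y_def using finite_supp[OF ac] by simp
  have YG: "y \<in> carrier G" if "y \<in> Y" for y using that DG unfolding Y_def by blast
  define \<alpha> where "\<alpha> = cut {\<e>} a"
  have \<alpha>: "\<alpha> \<in> homog \<e>" unfolding \<alpha>_def by (rule cut_homog[OF ac])
  have \<alpha>c: "\<alpha> \<in> carrier S" using \<alpha> by auto
  have \<alpha>0: "\<alpha> \<noteq> \<zero>" unfolding \<alpha>_def using cut_single_nonzero[of a \<e>] a(2) by simp
  have \<alpha>g: "\<alpha> \<in> gen H j" unfolding \<alpha>_def by (rule gen_cut[OF separating a(1)])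
  define aD where "aD = cut D a"
  define bD where "bD = cut D b"
  have aDg: "aD \<in> gen H j" and bDg: "bD \<in> gen H j" unfolding aD_def bD_def using gen_cut[OF separating] a b by auto
  have aDc: "aD \<in> carrier S" and bDc: "bD \<in> carrier S" using gen_carrier[OF separating] aDg bDg by auto
  have aDs: "x \<in> Y" if "aD x \<noteq> \<z>" for x
    using that unfolding aD_def Y_def by (auto simp: cut_apply in_supp split: if_splits)
  have "\<not> ann H aD bD"
  proof
    assume "ann H aD bD"
    moreover have "aD \<noteq> \<zero>" "bD \<noteq> \<zero>" unfolding aD_def bD_def
      using a b D1 by (auto intro!: nonzeroI[of _ \<e>] simp: cut_apply)
    moreover have "supp R aD \<subseteq> G.FC H" "supp R bD \<subseteq> G.FC H"
      unfolding aD_def bD_def D_def[symmetric] by (auto simp: cut_apply in_supp split: if_splits)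
    ultimately have finite_annihilating_pair using finite_annihilating_pair_FC[OF separating aDg _ _ bDg] by blast
    then show False using no_pair by simp
  qed
  then obtain y s where ys: "y \<in> H" "s \<in> homog y" "aD \<otimes> s \<otimes> bD \<noteq> \<zero>" unfolding ann_def by blast
  have yG: "y \<in> carrier G" using HG ys by simp
  have sc: "s \<in> carrier S" using ys by auto
  have "aD \<otimes> s \<otimes> bD \<in> carrier S" using aDc bDc sc by simp
  then obtain c0 where c0: "c0 \<in> carrier G" "(aD \<otimes> s \<otimes> bD) c0 \<noteq> \<z>" using nonzeroE ys(3) by blast
  obtain d1 d2 where d12: "d1 \<in> D" "d2 \<in> D" "c0 = d1 \<star> y \<star> d2"
  proof -
    obtain x1 x2 where x: "aD x1 \<noteq> \<z>" "bD x2 \<noteq> \<z>" "c0 = x1 \<star> y \<star> x2"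
      using mult_supp3[OF aDc ys(2) bDc c0(2)] by metis
    have "x1 \<in> D" "x2 \<in> D" using x(1,2) unfolding aD_def bD_def by (auto simp: cut_apply split: if_splits)
    then show thesis using that x(3) by blast
  qed
  have c0H: "c0 \<in> H" unfolding d12(3) using d12 DH ys Hm by blast
  obtain t where t: "t \<in> homog (\<iota> c0)" "(aD \<otimes> s \<otimes> bD \<otimes> t) \<e> \<noteq> \<z>"
    using shift_right[of "aD \<otimes> s \<otimes> bD" c0] c0(2) aDc bDc sc by (metis S.m_closed)
  have tc: "t \<in> carrier S" using t by auto
  \<comment> \<open>This translate makes the identity coefficient of the product of the FC parts
    nonzero. Since \<open>c0\<close> is \<open>y\<close> up to factors from the FC center, the
    translation carries the FC part of \<open>b\<close> to that of \<open>b3\<close>.\<close>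
  define b3 where "b3 = s \<otimes> b \<otimes> t"
  define b3D where "b3D = s \<otimes> bD \<otimes> t"
  have b3g: "b3 \<in> gen H j" unfolding b3_def
    by (intro gen_right[OF separating gen_left[OF separating b(1) ys(2,1)] t(1) Hi[OF c0H]])
  have b3c: "b3 \<in> carrier S" using gen_carrier[OF separating b3g] .
  have b3Dc: "b3D \<in> carrier S" unfolding b3D_def using sc bDc tc by simp
  have ann3: "ann H a b3" unfolding b3_def by (rule ann_sandwich(2)[OF H anab ac bc ys(2,1) t(1) Hi[OF c0H]])
  have b3s: "\<exists>x. b x \<noteq> \<z> \<and> p = y \<star> x \<star> \<iota> c0 \<and> x \<in> carrier G" if "b3 p \<noteq> \<z>" for p
    using sandwich_supp[OF ys(2) bc t(1) that[unfolded b3_def]] by metis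
  have D_iff: "y \<star> x \<star> \<iota> c0 \<in> D \<longleftrightarrow> x \<in> D" if x: "x \<in> H" for x
  proof -
    have G': "x \<in> carrier G" "d1 \<in> carrier G" "d2 \<in> carrier G" using x HG d12 DG by auto
    have e: "y \<star> x \<star> \<iota> c0 = cj y (x \<star> \<iota> d2) \<star> \<iota> d1"
      unfolding d12(3) G.conj_by_def using G' yG by (simp add: G.group_word)
    have e': "cj y (x \<star> \<iota> d2) = y \<star> x \<star> \<iota> c0 \<star> d1"
      unfolding e using G' yG by (simp add: G.m_assoc)
    show ?thesis
    proof
      assume "x \<in> D"
      then show "y \<star> x \<star> \<iota> c0 \<in> D" unfolding e using d12 by (intro Dm Dc Di ys(1))
    next
      assume "y \<star> x \<star> \<iota> c0 \<in> D"
      then have "cj y (x \<star> \<iota> d2) \<in> D" unfolding e' using Dm d12(1) by blast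
      then have "x \<star> \<iota> d2 \<in> D" using Dcan[OF ys(1)] G' by simp
      then have "x \<star> \<iota> d2 \<star> d2 \<in> D" using Dm d12 by blast
      then show "x \<in> D" using G' by (simp add: G.m_assoc)
    qed
  qed
  have b3D: "b3D = cut D b3"
  proof
    fix p
    show "b3D p = cut D b3 p"
    proof (cases "p \<in> D")
      case True
      have "(s \<otimes> b \<otimes> t) p = (s \<otimes> cut D b \<otimes> t) p"
      proof (rule sandwich_cut[OF ys(2) bc t(1)])
        fix z assume "b z \<noteq> \<z>" "y \<star> z \<star> \<iota> c0 = p"
        then show "z \<in> D" using D_iff[of z] True bH in_supp by blast
      qed
      then show ?thesis using True unfolding b3D_def b3_def bD_def by (simp add: cut_apply)
    next
      case False
      have "b3D p = \<z>"
      proof (rule ccontr)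
        assume "b3D p \<noteq> \<z>"
        then obtain z where z: "bD z \<noteq> \<z>" "p = y \<star> z \<star> \<iota> c0"
          using sandwich_supp[OF ys(2) bDc t(1)] unfolding b3D_def by metis
        then have "z \<in> D" unfolding bD_def by (auto simp: cut_apply split: if_splits)
        then show False using D_iff[OF DH] z False by blast
      qed
      then show ?thesis using False by (simp add: cut_apply)
    qed
  qed
  \<comment> \<open>\<open>a\<close> still annihilates \<open>b2\<close>, as the degrees of
    \<open>aD\<close> lie in \<open>H\<close>, and only the FC part of \<open>b3\<close> enters the
    coefficient of \<open>b2\<close> at the identity.\<close>
  define b2 where "b2 = aD \<otimes> b3"
  have b2g: "b2 \<in> gen H j" unfolding b2_def by (rule gen_mult[OF separating aDg b3g])
  have b2c: "b2 \<in> carrier S" using gen_carrier[OF separating b2g] .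
  have ann2: "ann H a b2" unfolding b2_def
    by (rule ann_mid(1)[OF H ann3 ac b3c aDc]) (use gen_supp[OF separating aDg] in blast)
  have e0: "(aD \<otimes> b3D) \<e> \<noteq> \<z>" using t(2) unfolding b3D_def using aDc sc bDc tc by (simp add: S.m_assoc)
  have b2e: "b2 \<e> = (aD \<otimes> b3D) \<e>"
  proof -
    have "(aD \<otimes> b3) \<e> = (cut UNIV aD \<otimes> cut D b3) \<e>"
    proof (rule mult_cut[OF aDc b3c])
      fix x z assume xz: "aD x \<noteq> \<z>" "b3 z \<noteq> \<z>" "x \<star> z = \<e>"
      have x: "x \<in> D" using aDs[OF xz(1)] unfolding Y_def by blast
      have zG: "z \<in> carrier G" using xz supp_carrier[OF b3c] by simp
      have "\<iota> z = x" by (rule G.inv_equality[OF xz(3) zG DG[OF x]])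
      then have "z = \<iota> x" using zG by auto
      then show "x \<in> UNIV \<and> z \<in> D" using Di[OF x] by simp
    qed
    then show ?thesis unfolding b2_def b3D by (simp add: cut_def)
  qed
  define \<gamma> where "\<gamma> = cut {\<e>} b2"
  have \<gamma>: "\<gamma> \<in> homog \<e>" unfolding \<gamma>_def by (rule cut_homog[OF b2c])
  have \<gamma>c: "\<gamma> \<in> carrier S" using \<gamma> by auto
  have pair2: "annihilating_pair H j a b2" unfolding annihilating_pair_def using separating a b2g ann2 e0 b2e by simp
  have \<gamma>': "\<gamma> = cut {\<e>} (aD \<otimes> b3D)" unfolding \<gamma>_def using b2e by (auto simp: cut_def)

  define X3 where "X3 = supp R b3"
  have finX3: "finite X3" unfolding X3_def using finite_supp[OF b3c] .
  have X3H: "x \<in> H" if "x \<in> X3" for x using that gen_supp[OF separating b3g] unfolding X3_def in_supp by blast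
  \<comment> \<open>An equation \<open>g \<star> u \<star> h = g0 \<star> u \<star> h0\<close> means
    \<open>cj u (h \<star> \<iota> h0) = \<iota> g \<star> g0\<close>. The set \<open>Q\<close>
    below collects the arguments \<open>h \<star> \<iota> h0\<close> in question, and
    \<open>F\<close> the values \<open>\<iota> g \<star> g0\<close>.\<close>
  define F where "F = (\<lambda>(g, g0). \<iota> g \<star> g0) ` (supp R a \<times> Y)"
  have finF: "finite F" unfolding F_def using finY finite_supp[OF ac] by simp
  have FG: "F \<subseteq> carrier G" unfolding F_def using aH HG YG by auto
  define Q where "Q = (\<lambda>(h, h0). h \<star> \<iota> h0) ` ((X3 - D) \<times> (X3 \<inter> D))"
  have finQ: "finite Q" unfolding Q_def using finX3 by simp
  have QH: "q \<in> H" if "q \<in> Q" for q using that X3H Hm Hi unfolding Q_def by auto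
  define \<kappa> where "\<kappa> h = restrict (cj h) Y" for h
  have \<kappa>D: "cj u x = cj v x" if "\<kappa> u = \<kappa> v" "x \<in> Y" for u v x
    using fun_cong[OF that(1), of x] that(2) unfolding \<kappa>_def by simp

  \<comment> \<open>The equation of degrees is forced by cancellation: the FC parts alone contribute
    a nonzero coefficient to a product \<open>a \<otimes> r \<otimes> b5\<close> that is zero, so
    some other pair of degrees contributes at the same place.\<close>
  have claim: "\<exists>q\<in>Q. cj u q \<in> F"
    if u: "u \<in> H" "\<kappa> u = \<kappa> \<e>" and r: "r \<in> homog u" "\<alpha> \<otimes> r \<otimes> \<gamma> \<noteq> \<zero>" for u r
  proof -
    have uG: "u \<in> carrier G" using HG u by simp
    have fix_Y: "cj u x = x" if "x \<in> Y" for x using \<kappa>D[OF u(2) that] YG[OF that] by simp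
    have rc: "r \<in> carrier S" using r by auto
    have m1: "\<alpha> \<otimes> r \<in> homog u" by (rule homog_mult_eq[OF \<alpha> r(1)]) (simp add: uG)
    have m2: "\<alpha> \<otimes> r \<otimes> \<gamma> \<in> homog u" by (rule homog_mult_eq[OF m1 \<gamma>]) (simp add: uG)
    obtain v where v: "v \<in> homog (\<iota> u)" "v \<otimes> (\<alpha> \<otimes> r \<otimes> \<gamma>) \<noteq> \<zero>" using homog_ex_left[OF m2 r(2)] by blast
    have vc: "v \<in> carrier S" using v by auto
    define e where "e = v \<otimes> \<alpha> \<otimes> r"
    have "v \<otimes> \<alpha> \<in> homog (\<iota> u)" by (rule homog_mult_eq[OF v(1) \<alpha>]) (simp add: uG)
    then have e: "e \<in> homog \<e>" unfolding e_def by (rule homog_mult_eq[OF _ r(1)]) (simp add: uG)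
    have ec: "e \<in> carrier S" using e by auto
    define a' where "a' = v \<otimes> a \<otimes> r"
    have a'c: "a' \<in> carrier S" unfolding a'_def using vc ac rc by simp
    have a's: "\<exists>x. a x \<noteq> \<z> \<and> p = \<iota> u \<star> x \<star> u \<and> x \<in> carrier G" if "a' p \<noteq> \<z>" for p
      using sandwich_supp[OF v(1) ac r(1) that[unfolded a'_def]] by metis
    have a'Y: "x = p \<and> p \<in> Y" if p: "p \<in> D" "a x \<noteq> \<z>" "p = \<iota> u \<star> x \<star> u" "x \<in> carrier G" for p x
    proof -
      have xe: "x = cj u p" unfolding G.conj_by_def p(3) using uG p(4) by (simp add: G.group_word)
      then have "x \<in> Y" using Dc[OF p(1) u(1)] p(2) in_supp unfolding Y_def by blast
      then have "cj u x = x" by (rule fix_Y)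
      then have "cj (\<iota> u) (cj u x) = cj (\<iota> u) x" by simp
      then have "x = cj (\<iota> u) x" using uG p(4) by (simp add: G.conj_by_conj_by)
      then have "x = p" unfolding G.conj_by_def p(3) using uG by simp
      then show ?thesis using \<open>x \<in> Y\<close> by simp
    qed
    \<comment> \<open>Both terms have FC parts supported in \<open>Y\<close>, because
      \<open>u\<close> centralizes \<open>Y\<close>, and the same coefficient at the identity. So
      \<delta> has a smaller FC part than \<open>a\<close>, which vanishes by minimality; this gives
      the exchange rule \<open>key\<close>.\<close>
    define \<delta> where "\<delta> = e \<otimes> a \<ominus> a' \<otimes> \<alpha>"
    have ea: "e \<otimes> a \<in> carrier S" and a\<alpha>: "a' \<otimes> \<alpha> \<in> carrier S" using ec ac a'c \<alpha>c by auto
    have a'g: "a' \<in> gen H j" unfolding a'_def by (intro gen_right[OF separating gen_left[OF separating a(1) v(1) Hi[OF u(1)]] r(1) u(1)])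
    have \<delta>g: "\<delta> \<in> gen H j" unfolding \<delta>_def a_minus_def
      by (intro gen.gen_add gen_minus[OF separating] gen_left[OF separating a(1) e G.sub_one[OF H]]
          gen_right[OF separating a'g \<alpha> G.sub_one[OF H]])
    have "ann H \<delta> b" unfolding \<delta>_def
    proof (rule ann_sub)
      show "ann H (e \<otimes> a) b" by (rule ann_left[OF anab ac bc ec])
      show "ann H (a' \<otimes> \<alpha>) b" unfolding a'_def
        by (rule ann_mid(2)[OF H ann_sandwich(1)[OF H anab ac bc v(1) Hi[OF u(1)] r(1) u(1)]])
          (use vc ac rc bc \<alpha>c homogD[OF \<alpha>] G.sub_one[OF H] in auto)
    qed (use ea a\<alpha> bc in auto)
    have val: "\<delta> p = (e \<otimes> a) p \<oplus>\<^bsub>R\<^esub> (\<ominus>\<^bsub>R\<^esub> (a' \<otimes> \<alpha>) p)" for p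
      unfolding \<delta>_def a_minus_def using ea a\<alpha> by (simp add: add_apply minus_apply)
    have ea_e: "(e \<otimes> a) \<e> = (e \<otimes> \<alpha>) \<e>"
      using apply_mult_left[OF ac e, of \<e>] unfolding \<alpha>_def by simp
    have "(a' \<otimes> \<alpha>) \<e> = (cut {\<e>} a' \<otimes> \<alpha>) \<e>"
      using apply_mult_right[OF a'c \<alpha>, of \<e>] by simp
    also have "cut {\<e>} a' = e"
    proof
      fix p
      have "a' \<e> = e \<e>" unfolding a'_def e_def \<alpha>_def
      proof (rule sandwich_cut[OF v(1) ac r(1)])
        fix z assume "a z \<noteq> \<z>" "\<iota> u \<star> z \<star> u = \<e>"
        then show "z \<in> {\<e>}" using a'Y[OF D1, of z] supp_carrier[OF ac] by simp
      qed
      then show "cut {\<e>} a' p = e p" using homogD[OF e, of p] by (cases "e p = \<z>") (auto simp: cut_apply)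
    qed
    finally have ae_e: "(a' \<otimes> \<alpha>) \<e> = (e \<otimes> \<alpha>) \<e>" .
    have \<delta>e: "\<delta> \<e> = \<z>" unfolding val ea_e ae_e using coeff ec \<alpha>c by (simp add: R.r_neg)
    have "supp R \<delta> \<inter> D \<subseteq> Y - {\<e>}"
    proof
      fix p assume p: "p \<in> supp R \<delta> \<inter> D"
      have "(e \<otimes> a) p \<noteq> \<z> \<or> (a' \<otimes> \<alpha>) p \<noteq> \<z>"
        using p val[of p] R.minus_equality[of \<z> \<z>] by (auto simp: in_supp)
      then have "p \<in> Y"
      proof
        assume "(e \<otimes> a) p \<noteq> \<z>"
        then obtain x z where xz: "e x \<noteq> \<z>" "a z \<noteq> \<z>" "p = x \<star> z" using mult_supp[OF ec ac] by blast
        have "x = \<e>" "z \<in> carrier G" using homogD[OF e xz(1)] supp_carrier[OF ac xz(2)] by auto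
        then have "p = z" using xz(3) by simp
        then show "p \<in> Y" unfolding Y_def using p xz in_supp by blast
      next
        assume "(a' \<otimes> \<alpha>) p \<noteq> \<z>"
        then obtain x z where xz: "a' x \<noteq> \<z>" "\<alpha> z \<noteq> \<z>" "p = x \<star> z" using mult_supp[OF a'c \<alpha>c] by blast
        have "z = \<e>" "x \<in> carrier G" using homogD[OF \<alpha> xz(2)] supp_carrier[OF a'c xz(1)] by auto
        then have "p = x" using xz(3) by simp
        then show "p \<in> Y" using a's[OF xz(1)] a'Y p by blast
      qed
      moreover have "p \<noteq> \<e>" using p \<delta>e by (auto simp: in_supp)
      ultimately show "p \<in> Y - {\<e>}" by blast
    qed
    then have "card (supp R \<delta> \<inter> D) \<le> card (Y - {\<e>})" using finY by (intro card_mono) auto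
    also have "\<dots> < card Y" using finY a(2) D1 unfolding Y_def by (intro card_Diff1_less) (auto simp: in_supp)
    finally have "card (supp R \<delta> \<inter> G.FC H) < FC_count H a" unfolding FC_count_def Y_def D_def .
    from minimal_cut_zero[OF min \<delta>g \<open>ann H \<delta> b\<close> this] have \<delta>D: "\<delta> d = \<z>" if "d \<in> D" for d
      using that unfolding D_def by blast
    have key: "e \<otimes> aD = v \<otimes> aD \<otimes> r \<otimes> \<alpha>"
    proof
      fix p
      have c: "e \<otimes> aD \<in> carrier S" "v \<otimes> aD \<otimes> r \<in> carrier S" "v \<otimes> aD \<otimes> r \<otimes> \<alpha> \<in> carrier S"
        using ec aDc vc rc \<alpha>c by auto
      show "(e \<otimes> aD) p = (v \<otimes> aD \<otimes> r \<otimes> \<alpha>) p"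
      proof (cases "p \<in> D")
        case True
        have "(e \<otimes> a) p = (a' \<otimes> \<alpha>) p"
        proof -
          have "(e \<otimes> a) p \<in> carrier R" "(a' \<otimes> \<alpha>) p \<in> carrier R" using coeff ea a\<alpha> by auto
          then show ?thesis using \<delta>D[OF True] val[of p] R.minus_equality R.minus_minus by (metis R.add.inv_closed)
        qed
        moreover have "(e \<otimes> a) p = (e \<otimes> aD) p"
        proof -
          have "(e \<otimes> a) p = (cut UNIV e \<otimes> cut D a) p"
          proof (rule mult_cut[OF ec ac])
            fix x z assume xz: "e x \<noteq> \<z>" "a z \<noteq> \<z>" "x \<star> z = p"
            have "x = \<e>" "z \<in> carrier G" using homogD[OF e xz(1)] supp_carrier[OF ac xz(2)] by auto
            then show "x \<in> UNIV \<and> z \<in> D" using xz(3) True by simp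
          qed
          then show ?thesis unfolding aD_def by (simp add: cut_def)
        qed
        moreover have "(a' \<otimes> \<alpha>) p = (v \<otimes> aD \<otimes> r \<otimes> \<alpha>) p"
        proof -
          have pG: "p \<in> carrier G" using DG True .
          have r\<alpha>: "r \<otimes> \<alpha> \<in> homog u" by (rule homog_mult_eq[OF r(1) \<alpha>]) (simp add: uG)
          have "(v \<otimes> a \<otimes> (r \<otimes> \<alpha>)) p = (v \<otimes> cut D a \<otimes> (r \<otimes> \<alpha>)) p"
          proof (rule sandwich_cut[OF v(1) ac r\<alpha>])
            fix z assume z: "a z \<noteq> \<z>" "\<iota> u \<star> z \<star> u = p"
            then have "z = p" using a'Y[OF True z(1)] supp_carrier[OF ac z(1)] by simp
            then show "z \<in> D" using True by simp
          qed
          then show ?thesis unfolding a'_def aD_def using vc ac rc \<alpha>c by (simp add: S.m_assoc)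
        qed
        ultimately show ?thesis by simp
      next
        case False
        have "(e \<otimes> aD) p = \<z>"
        proof (rule ccontr)
          assume "(e \<otimes> aD) p \<noteq> \<z>"
          then obtain x z where xz: "e x \<noteq> \<z>" "aD z \<noteq> \<z>" "p = x \<star> z" using mult_supp[OF ec aDc] by blast
          have "x = \<e>" "z \<in> D" using homogD[OF e xz(1)] aDs[OF xz(2)] unfolding Y_def by auto
          then show False using xz(3) False DG by simp
        qed
        moreover have "(v \<otimes> aD \<otimes> r \<otimes> \<alpha>) p = \<z>"
        proof (rule ccontr)
          assume "(v \<otimes> aD \<otimes> r \<otimes> \<alpha>) p \<noteq> \<z>"
          then obtain x z where xz: "(v \<otimes> aD \<otimes> r) x \<noteq> \<z>" "\<alpha> z \<noteq> \<z>" "p = x \<star> z"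
            using mult_supp[OF c(2) \<alpha>c] by blast
          have z: "z = \<e>" "x \<in> carrier G" using homogD[OF \<alpha> xz(2)] supp_carrier[OF c(2) xz(1)] by auto
          obtain x' where x': "aD x' \<noteq> \<z>" "x = \<iota> u \<star> x' \<star> u" using sandwich_supp[OF v(1) aDc r(1) xz(1)] by metis
          have "x' \<in> D" using aDs[OF x'(1)] unfolding Y_def by blast
          then have "cj (\<iota> u) x' \<in> D" using Dc Hi[OF u(1)] by blast
          then have "x \<in> D" unfolding x'(2) G.conj_by_def using uG by simp
          then show False using False xz(3) z by simp
        qed
        ultimately show ?thesis by simp
      qed
    qed
    define b5 where "b5 = \<alpha> \<otimes> b3"
    have b5c: "b5 \<in> carrier S" unfolding b5_def using \<alpha>c b3c by simp
    have b5s: "p \<in> X3" if "b5 p \<noteq> \<z>" for p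
    proof -
      obtain x z where xz: "\<alpha> x \<noteq> \<z>" "b3 z \<noteq> \<z>" "p = x \<star> z" using mult_supp[OF \<alpha>c b3c] \<open>b5 p \<noteq> \<z>\<close> unfolding b5_def by blast
      have "x = \<e>" "z \<in> carrier G" using homogD[OF \<alpha> xz(1)] supp_carrier[OF b3c xz(2)] by auto
      then show ?thesis using xz unfolding X3_def by (simp add: in_supp)
    qed
    have b5D: "cut D b5 = \<alpha> \<otimes> b3D"
    proof
      fix p
      show "cut D b5 p = (\<alpha> \<otimes> b3D) p"
      proof (cases "p \<in> D")
        case True
        have "(\<alpha> \<otimes> b3) p = (cut UNIV \<alpha> \<otimes> cut D b3) p"
        proof (rule mult_cut[OF \<alpha>c b3c])
          fix x z assume xz: "\<alpha> x \<noteq> \<z>" "b3 z \<noteq> \<z>" "x \<star> z = p"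
          have "x = \<e>" "z \<in> carrier G" using homogD[OF \<alpha> xz(1)] supp_carrier[OF b3c xz(2)] by auto
          then show "x \<in> UNIV \<and> z \<in> D" using xz(3) True by simp
        qed
        then show ?thesis using True unfolding b5_def b3D by (simp add: cut_def)
      next
        case False
        have "(\<alpha> \<otimes> b3D) p = \<z>"
        proof (rule ccontr)
          assume "(\<alpha> \<otimes> b3D) p \<noteq> \<z>"
          then obtain x z where xz: "\<alpha> x \<noteq> \<z>" "b3D z \<noteq> \<z>" "p = x \<star> z" using mult_supp[OF \<alpha>c b3Dc] by blast
          have "x = \<e>" using homogD[OF \<alpha> xz(1)] .
          moreover have "z \<in> D" using xz(2) unfolding b3D by (auto simp: cut_apply split: if_splits)
          ultimately show False using xz(3) False DG by simp
        qed
        then show ?thesis using False by (simp add: cut_apply)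
      qed
    qed
    \<comment> \<open>By \<open>key\<close>, \<open>v\<close> times this product is
      \<open>e \<otimes> (aD \<otimes> b3D)\<close>. Its coefficient at the identity is that of
      \<open>e \<otimes> \<gamma> = v \<otimes> (\<alpha> \<otimes> r \<otimes> \<gamma>)\<close>,
      which \<open>v\<close> was chosen to keep nonzero.\<close>
    have "aD \<otimes> r \<otimes> cut D b5 \<noteq> \<zero>"
    proof
      assume z: "aD \<otimes> r \<otimes> cut D b5 = \<zero>"
      have "e \<otimes> (aD \<otimes> b3D) = (e \<otimes> aD) \<otimes> b3D" using ec aDc b3Dc by (simp add: S.m_assoc)
      also have "\<dots> = v \<otimes> (aD \<otimes> r \<otimes> cut D b5)" unfolding key b5D
        using vc aDc rc \<alpha>c b3Dc by (simp add: S.m_assoc)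
      finally have z': "e \<otimes> (aD \<otimes> b3D) = \<zero>" using z vc by simp
      have "(e \<otimes> (aD \<otimes> b3D)) \<e> = (e \<otimes> \<gamma>) \<e>"
        using apply_mult_left[OF S.m_closed[OF aDc b3Dc] e, of \<e>] unfolding \<gamma>' by simp
      then have "(e \<otimes> \<gamma>) \<e> = \<z>" using z' by (simp add: zero_apply)
      moreover have "e \<otimes> \<gamma> \<in> homog \<e>" using homog_mult_eq[OF e \<gamma>] by simp
      ultimately have "e \<otimes> \<gamma> = \<zero>" using homog_nonzero by blast
      moreover have "e \<otimes> \<gamma> = v \<otimes> (\<alpha> \<otimes> r \<otimes> \<gamma>)" unfolding e_def using vc \<alpha>c rc \<gamma>c by (simp add: S.m_assoc)
      ultimately show False using v(2) by simp
    qed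
    moreover have "aD \<otimes> r \<otimes> cut D b5 \<in> carrier S" using aDc rc b5c by simp
    ultimately obtain p where p: "(aD \<otimes> r \<otimes> cut D b5) p \<noteq> \<z>" using nonzeroE by blast
    have cDb5: "cut D b5 \<in> carrier S" using b5c by simp
    obtain g0 h0 where gh: "aD g0 \<noteq> \<z>" "cut D b5 h0 \<noteq> \<z>" "p = g0 \<star> u \<star> h0" "g0 \<in> carrier G" "h0 \<in> carrier G"
      using mult_supp3[OF aDc r(1) cDb5 p] by metis
    have g0: "g0 \<in> Y" "g0 \<in> D" using aDs[OF gh(1)] unfolding Y_def by auto
    have h0: "h0 \<in> D" "h0 \<in> X3" using gh(2) b5s by (auto simp: cut_apply split: if_splits)
    have "ann H a b5" unfolding b5_def
      by (rule ann_mid(1)[OF H ann3 ac b3c \<alpha>c]) (use homogD[OF \<alpha>] G.sub_one[OF H] in auto)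
    then have "(a \<otimes> r \<otimes> b5) p = \<z>" using annD[of H a b5 u r] u r by (simp add: zero_apply)
    then have "\<not> (\<forall>g h. a g \<noteq> \<z> \<longrightarrow> b5 h \<noteq> \<z> \<longrightarrow> g \<star> u \<star> h = p \<longrightarrow> g \<in> D \<and> h \<in> D)"
      using mult_cut3[OF ac r(1) b5c, of p D D] p unfolding aD_def by auto
    then obtain g h where g: "a g \<noteq> \<z>" "b5 h \<noteq> \<z>" "g \<star> u \<star> h = g0 \<star> u \<star> h0" "\<not> (g \<in> D \<and> h \<in> D)"
      unfolding gh(3) by blast
    have gG: "g \<in> carrier G" "h \<in> carrier G" using supp_carrier ac b5c g by auto
    have hX: "h \<in> X3" using b5s[OF g(2)] .
    have cjq: "cj u (h \<star> \<iota> h0) = \<iota> g \<star> g0"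
    proof -
      have "cj u (h \<star> \<iota> h0) = \<iota> g \<star> (g \<star> u \<star> h) \<star> \<iota> h0 \<star> \<iota> u"
        unfolding G.conj_by_def using gG gh uG by (simp add: G.group_word)
      also have "\<dots> = \<iota> g \<star> g0" unfolding g(3) using gG gh uG by (simp add: G.group_word)
      finally show ?thesis .
    qed
    have "h \<notin> D"
    proof
      assume h: "h \<in> D"
      then have "\<iota> g \<star> g0 \<in> D" using cjq Dc[OF Dm[OF h Di[OF h0(1)]] u(1)] by simp
      then have "g0 \<star> \<iota> (\<iota> g \<star> g0) \<in> D" using g0 Dm Di by blast
      then have "g \<in> D" using gG gh by (simp add: G.group_word)
      then show False using g(4) h by simp
    qed
    then have "h \<star> \<iota> h0 \<in> Q" unfolding Q_def using hX h0 by (intro image_eqI[of _ _ "(h, h0)"]) auto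
    moreover have "\<iota> g \<star> g0 \<in> F" unfolding F_def
      using g(1) g0 by (intro image_eqI[of _ _ "(g, g0)"]) (auto simp: in_supp)
    ultimately show ?thesis using cjq by metis
  qed

  \<comment> \<open>The claim handles the degrees that centralize \<open>Y\<close>. Another class is
    reduced to it by linking \<open>k\<close> to \<alpha> through an element whose degree is in this
    class, as \<open>minimal_reach\<close> permits. Finitely many classes are absorbed one by
    one.\<close>
  have cover: "\<exists>k F'. k \<in> gen H j \<and> k \<in> homog \<e> \<and> k \<noteq> \<zero> \<and> finite F' \<and> F' \<subseteq> carrier G \<and>
      (\<forall>u\<in>H. \<forall>r\<in>homog u. k \<otimes> r \<otimes> \<gamma> \<noteq> \<zero> \<longrightarrow> \<kappa> u \<in> \<kappa> ` Z \<longrightarrow> (\<exists>q\<in>Q. cj u q \<in> F'))"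
    if "finite Z" "Z \<subseteq> H" for Z
    using that
  proof (induction Z rule: finite_induct)
    case empty
    show ?case using \<alpha>g \<alpha> \<alpha>0 by (intro exI[of _ \<alpha>] exI[of _ "{}"]) auto
  next
    case (insert z0 Z)
    have "Z \<subseteq> H" using insert.prems by simp
    from insert.IH[OF this] obtain k F' where kF: "k \<in> gen H j \<and> k \<in> homog \<e> \<and> k \<noteq> \<zero> \<and> finite F' \<and> F' \<subseteq> carrier G \<and>
      (\<forall>u\<in>H. \<forall>r\<in>homog u. k \<otimes> r \<otimes> \<gamma> \<noteq> \<zero> \<longrightarrow> \<kappa> u \<in> \<kappa> ` Z \<longrightarrow> (\<exists>q\<in>Q. cj u q \<in> F'))"
      by (elim exE) (rule that)
    then have k: "k \<in> gen H j" "k \<in> homog \<e>" "k \<noteq> \<zero>" and F': "finite F'" "F' \<subseteq> carrier G" by auto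
    have cov: "\<exists>q\<in>Q. cj u q \<in> F'" if "u \<in> H" "r \<in> homog u" "k \<otimes> r \<otimes> \<gamma> \<noteq> \<zero>" "\<kappa> u \<in> \<kappa> ` Z" for u r
      by (rule kF[THEN conjunct2, THEN conjunct2, THEN conjunct2, THEN conjunct2, THEN conjunct2, rule_format, OF that])
    obtain z r0 where z: "z \<in> H" "r0 \<in> homog z" "\<kappa> z = \<kappa> z0" "k \<otimes> r0 \<otimes> \<alpha> \<noteq> \<zero>"
      using minimal_reach[OF graded_prime min k, of z0] insert.prems unfolding \<kappa>_def \<alpha>_def Y_def D_def by blast
    have zG: "z \<in> carrier G" using z HG by simp
    have kc: "k \<in> carrier S" "r0 \<in> carrier S" using k z by auto
    have m1: "k \<otimes> r0 \<in> homog z" by (rule homog_mult_eq[OF k(2) z(2)]) (simp add: zG)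
    have m2: "k \<otimes> r0 \<otimes> \<alpha> \<in> homog z" by (rule homog_mult_eq[OF m1 \<alpha>]) (simp add: zG)
    obtain t0 where t0: "t0 \<in> homog (\<iota> z)" "k \<otimes> r0 \<otimes> \<alpha> \<otimes> t0 \<noteq> \<zero>" using homog_ex_right[OF m2 z(4)] by blast
    have t0c: "t0 \<in> carrier S" using t0 by auto
    \<comment> \<open>If \<open>k2 \<otimes> r \<otimes> \<gamma>\<close> is nonzero, then
      \<open>k\<close> reaches \<gamma> at \<open>u\<close>, so the earlier cover stays valid, and
      \<alpha> reaches \<gamma> at \<open>\<iota> z \<star> u\<close>, which centralizes
      \<open>Y\<close> when \<open>u\<close> and \<open>z\<close> are in the same class.\<close>
    define k2 where "k2 = k \<otimes> r0 \<otimes> \<alpha> \<otimes> t0"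
    have k2: "k2 \<in> homog \<e>" unfolding k2_def by (rule homog_mult_eq[OF m2 t0(1)]) (simp add: zG)
    have k2g: "k2 \<in> gen H j" unfolding k2_def
      by (rule gen_right[OF separating gen_mult[OF separating gen_right[OF separating k(1) z(2,1)] \<alpha>g] t0(1) Hi[OF z(1)]])
    show ?case
    proof (intro exI[of _ k2] exI[of _ "F' \<union> cj z ` F"] conjI ballI impI)
      show "k2 \<noteq> \<zero>" unfolding k2_def using t0 by simp
      show "finite (F' \<union> cj z ` F)" using F' finF by simp
      show "F' \<union> cj z ` F \<subseteq> carrier G" using F' FG zG by auto
      fix u r assume u: "u \<in> H" and r: "r \<in> homog u" and nz: "k2 \<otimes> r \<otimes> \<gamma> \<noteq> \<zero>" and \<kappa>u: "\<kappa> u \<in> \<kappa> ` insert z0 Z"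
      have uG: "u \<in> carrier G" using u HG by simp
      have rc: "r \<in> carrier S" using r by auto
      show "\<exists>q\<in>Q. cj u q \<in> F' \<union> cj z ` F"
      proof (cases "\<kappa> u \<in> \<kappa> ` Z")
        case True
        have "k2 \<otimes> r \<otimes> \<gamma> = k \<otimes> (r0 \<otimes> \<alpha> \<otimes> t0 \<otimes> r) \<otimes> \<gamma>"
          unfolding k2_def using kc \<alpha>c t0c rc \<gamma>c by (simp add: S.m_assoc)
        moreover have "r0 \<otimes> \<alpha> \<in> homog z" by (rule homog_mult_eq[OF z(2) \<alpha>]) (simp add: zG)
        then have "r0 \<otimes> \<alpha> \<otimes> t0 \<in> homog \<e>" by (rule homog_mult_eq[OF _ t0(1)]) (simp add: zG)
        then have "r0 \<otimes> \<alpha> \<otimes> t0 \<otimes> r \<in> homog u" by (rule homog_mult_eq[OF _ r]) (simp add: uG)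
        ultimately show ?thesis using cov[OF u _ _ True] nz by auto
      next
        case False
        then have eq: "\<kappa> u = \<kappa> z" using \<kappa>u z(3) by auto
        have "k2 \<otimes> r \<otimes> \<gamma> = k \<otimes> r0 \<otimes> (\<alpha> \<otimes> (t0 \<otimes> r) \<otimes> \<gamma>)"
          unfolding k2_def using kc \<alpha>c t0c rc \<gamma>c by (simp add: S.m_assoc)
        then have nz': "\<alpha> \<otimes> (t0 \<otimes> r) \<otimes> \<gamma> \<noteq> \<zero>" using nz kc by auto
        have "\<kappa> (\<iota> z \<star> u) = \<kappa> \<e>" unfolding \<kappa>_def
        proof (rule restrict_ext)
          fix x assume x: "x \<in> Y"
          then have "cj u x = cj z x" using \<kappa>D[OF eq] by simp
          then have "cj (\<iota> z) (cj u x) = cj (\<iota> z) (cj z x)" by simp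
          then show "cj (\<iota> z \<star> u) x = cj \<e> x" using YG[OF x] zG uG by (simp add: G.conj_by_conj_by)
        qed
        then obtain q where q: "q \<in> Q" "cj (\<iota> z \<star> u) q \<in> F"
          using claim[OF Hm[OF Hi[OF z(1)] u] _ homog_mult[OF t0(1) r] nz'] by blast
        have "cj u q = cj z (cj (\<iota> z \<star> u) q)" using QH[OF q(1)] HG zG uG by (simp add: G.conj_by_conj_by G.group_word)
        then show ?thesis using q by blast
      qed
    qed (use k2 k2g in auto)
  qed

  have fin\<kappa>: "finite (\<kappa> ` H)"
  proof -
    have "\<kappa> ` H \<subseteq> Y \<rightarrow>\<^sub>E (\<Union>y\<in>Y. (\<lambda>h. cj h y) ` H)" unfolding \<kappa>_def by (intro image_subsetI restrict_PiE_iff[THEN iffD2]) blast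
    moreover have "finite (\<Union>y\<in>Y. (\<lambda>h. cj h y) ` H)" using finY G.FC_finite unfolding Y_def D_def by blast
    ultimately show ?thesis using finite_PiE[OF finY] finite_subset by metis
  qed
  then obtain Z where Z: "Z \<subseteq> H" "finite Z" "\<kappa> ` H = \<kappa> ` Z" using finite_subset_image[of "\<kappa> ` H" \<kappa> H] by blast

  \<comment> \<open>One \<open>q\<close> with its own target set \<open>Fq\<close> is singled out so
    that this set can be minimized. The choice \<open>\<e>\<close> with empty target singles out
    nothing.\<close>
  define cov where "cov k q Fq F' Q1 \<longleftrightarrow> (\<forall>u\<in>H. \<forall>r\<in>homog u. k \<otimes> r \<otimes> \<gamma> \<noteq> \<zero> \<longrightarrow>
      cj u q \<in> Fq \<or> (\<exists>q'\<in>Q1. cj u q' \<in> F'))" for k q Fq F' Q1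
  define ok where "ok k \<longleftrightarrow> k \<in> gen H j \<and> k \<in> homog \<e> \<and> k \<noteq> \<zero>" for k
  define P1 where "P1 Q1 \<longleftrightarrow> Q1 \<subseteq> Q \<and> (\<exists>k F'. ok k \<and> finite F' \<and> F' \<subseteq> carrier G \<and> cov k \<e> {} F' Q1)" for Q1
  have "P1 Q"
  proof -
    obtain k F' where k: "k \<in> gen H j \<and> k \<in> homog \<e> \<and> k \<noteq> \<zero>" "finite F' \<and> F' \<subseteq> carrier G"
      "\<forall>u\<in>H. \<forall>r\<in>homog u. k \<otimes> r \<otimes> \<gamma> \<noteq> \<zero> \<longrightarrow> \<kappa> u \<in> \<kappa> ` Z \<longrightarrow> (\<exists>q\<in>Q. cj u q \<in> F')"
      using cover[OF Z(2,1)] by blast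
    have "cov k \<e> {} F' Q" unfolding cov_def using k(3) Z(3) by blast
    then show ?thesis unfolding P1_def ok_def using k by blast
  qed
  from ex_has_least_nat[of P1, OF this, of card] obtain Q1 where Q1: "P1 Q1"
    and leastQ: "\<And>Q2. P1 Q2 \<Longrightarrow> card Q1 \<le> card Q2" by blast
  have Q1Q: "Q1 \<subseteq> Q" and finQ1: "finite Q1" using Q1 finQ finite_subset unfolding P1_def by blast+
  obtain k0 F0 where k0: "ok k0" "finite F0" "F0 \<subseteq> carrier G" "cov k0 \<e> {} F0 Q1" using Q1 unfolding P1_def by blast
  have reach: "\<exists>u\<in>H. \<exists>r\<in>homog u. k \<otimes> r \<otimes> \<gamma> \<noteq> \<zero>" if "ok k" for k
  proof -
    have "b2 \<e> \<noteq> \<z>" using e0 b2e by simp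
    then show ?thesis using gen_reach[OF graded_prime separating _ _ _ b2g] that unfolding ok_def \<gamma>_def by metis
  qed
  have "Q1 \<noteq> {}" using reach[OF k0(1)] k0(4) unfolding cov_def by blast
  then obtain q where q: "q \<in> Q1" by blast
  have qQ: "q \<in> Q" using q Q1Q by blast
  have qG: "q \<in> carrier G" using QH[OF qQ] HG by simp
  \<comment> \<open>With the number of elements of \<open>Q1\<close> already minimal, the target of
    one \<open>q\<close> is minimized while the common target \<open>F'\<close> of the others may
    grow freely.\<close>
  define P2 where "P2 = (\<lambda>(k, Fq). ok k \<and> finite Fq \<and> Fq \<subseteq> carrier G \<and>
     (\<exists>F'. finite F' \<and> F' \<subseteq> carrier G \<and> cov k q Fq F' (Q1 - {q})))"
  have "cov k0 q F0 F0 (Q1 - {q})" using k0(4) q unfolding cov_def by blast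
  then have "P2 (k0, F0)" unfolding P2_def using k0(1-3) by blast
  from ex_has_least_nat[of P2, OF this, of "\<lambda>(k, Fq). card Fq"]
  obtain k Fq where kF: "P2 (k, Fq)" and leastF: "\<And>k' Fq'. P2 (k', Fq') \<Longrightarrow> card Fq \<le> card Fq'" by auto
  obtain F1 where F1: "finite F1" "F1 \<subseteq> carrier G" "cov k q Fq F1 (Q1 - {q})" using kF unfolding P2_def by auto
  have k: "k \<in> gen H j" "k \<in> homog \<e>" "k \<noteq> \<zero>" and Fq: "finite Fq" "Fq \<subseteq> carrier G"
    using kF unfolding P2_def ok_def by auto
  have kc: "k \<in> carrier S" using k by auto
  define L where "L = {l \<in> H. cj l ` Fq = Fq}"
  have act1: "cj \<e> f = f" if "f \<in> carrier G" for f using that by simp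
  have actm: "cj (x \<star> y) f = cj x (cj y f)" if "x \<in> H" "y \<in> H" "f \<in> carrier G" for x y f
    using that HG by (simp add: G.conj_by_conj_by)
  have L: "subgroup L G" unfolding L_def by (rule G.stabilizer_subgroup[OF H Fq(2) act1 actm])
  have LH: "L \<subseteq> H" unfolding L_def by blast
  have TL: "\<forall>x\<in>H. \<forall>s\<in>homog x. k \<otimes> s \<otimes> k \<noteq> \<zero> \<longrightarrow> x \<in> L"
  proof (intro ballI impI)
    fix x r0 assume x: "x \<in> H" "r0 \<in> homog x" "k \<otimes> r0 \<otimes> k \<noteq> \<zero>"
    have xG: "x \<in> carrier G" using HG x by simp
    have r0c: "r0 \<in> carrier S" using x by auto
    have m1: "k \<otimes> r0 \<in> homog x" by (rule homog_mult_eq[OF k(2) x(2)]) (simp add: xG)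
    have m: "k \<otimes> r0 \<otimes> k \<in> homog x" by (rule homog_mult_eq[OF m1 k(2)]) (simp add: xG)
    obtain t0 where t0: "t0 \<in> homog (\<iota> x)" "t0 \<otimes> (k \<otimes> r0 \<otimes> k) \<noteq> \<zero>" using homog_ex_left[OF m x(3)] by blast
    have t0c: "t0 \<in> carrier S" using t0 by auto
    \<comment> \<open>Again \<open>k\<close> occurs twice, so what \<open>k3\<close> reaches at
      \<open>u\<close> is reached by \<open>k\<close> at \<open>u\<close> and at
      \<open>x \<star> u\<close>. If \<open>q\<close> covers both, \<open>cj u q\<close> lies in
      \<open>Fq\<close> and in its translate by \<open>\<iota> x\<close>; otherwise another element
      of \<open>Q1\<close> covers, with enlarged target. Minimality of \<open>Fq\<close> then makes
      \<open>x\<close> stabilize it.\<close>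
    define k3 where "k3 = t0 \<otimes> (k \<otimes> r0 \<otimes> k)"
    have k3: "ok k3" unfolding ok_def
    proof (intro conjI)
      show "k3 \<in> gen H j" unfolding k3_def
        by (rule gen_left[OF separating gen_mult[OF separating gen_right[OF separating k(1) x(2,1)] k(1)] t0(1) Hi[OF x(1)]])
      show "k3 \<in> homog \<e>" unfolding k3_def by (rule homog_mult_eq[OF t0(1) m]) (simp add: xG)
      show "k3 \<noteq> \<zero>" unfolding k3_def using t0(2) .
    qed
    have c1: "cj x (cj (\<iota> x) f) = f" "cj (\<iota> x) (cj x f) = f" if "f \<in> carrier G" for f
      using that xG by (simp_all add: G.conj_by_conj_by)
    have "cov k3 q (Fq \<inter> cj (\<iota> x) ` Fq) (F1 \<union> cj (\<iota> x) ` F1) (Q1 - {q})"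
      unfolding cov_def
    proof (intro ballI impI)
      fix u r assume u: "u \<in> H" and r: "r \<in> homog u" and nz: "k3 \<otimes> r \<otimes> \<gamma> \<noteq> \<zero>"
      have uG: "u \<in> carrier G" using u HG by simp
      have rc: "r \<in> carrier S" using r by auto
      have "k3 \<otimes> r \<otimes> \<gamma> = (t0 \<otimes> k \<otimes> r0) \<otimes> (k \<otimes> r \<otimes> \<gamma>)"
        unfolding k3_def using kc r0c t0c rc \<gamma>c by (simp add: S.m_assoc)
      then have "k \<otimes> r \<otimes> \<gamma> \<noteq> \<zero>" using nz kc r0c t0c by auto
      then have A: "cj u q \<in> Fq \<or> (\<exists>q'\<in>Q1 - {q}. cj u q' \<in> F1)" using F1(3) u r unfolding cov_def by blast
      have "k3 \<otimes> r \<otimes> \<gamma> = t0 \<otimes> (k \<otimes> (r0 \<otimes> k \<otimes> r) \<otimes> \<gamma>)"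
        unfolding k3_def using kc r0c t0c rc \<gamma>c by (simp add: S.m_assoc)
      then have nz2: "k \<otimes> (r0 \<otimes> k \<otimes> r) \<otimes> \<gamma> \<noteq> \<zero>" using nz t0c by auto
      have "r0 \<otimes> k \<in> homog x" by (rule homog_mult_eq[OF x(2) k(2)]) (simp add: xG)
      then have "r0 \<otimes> k \<otimes> r \<in> homog (x \<star> u)" using r by (rule homog_mult)
      then have B: "cj (x \<star> u) q \<in> Fq \<or> (\<exists>q'\<in>Q1 - {q}. cj (x \<star> u) q' \<in> F1)"
        using F1(3) Hm[OF x(1) u] nz2 unfolding cov_def by blast
      have bk: "cj u q' \<in> cj (\<iota> x) ` E" if "cj (x \<star> u) q' \<in> E" "q' \<in> Q1" for q' E
      proof -
        have "q' \<in> carrier G" using that Q1Q QH HG by blast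
        then have "cj u q' = cj (\<iota> x) (cj (x \<star> u) q')" using xG uG by (simp add: G.conj_by_conj_by G.group_word)
        then show ?thesis using that by (metis image_eqI)
      qed
      show "cj u q \<in> Fq \<inter> cj (\<iota> x) ` Fq \<or> (\<exists>q'\<in>Q1 - {q}. cj u q' \<in> F1 \<union> cj (\<iota> x) ` F1)"
        using A B bk[of _ Fq] bk[of _ F1] q by blast
    qed
    moreover have "cj (\<iota> x) ` F1 \<subseteq> carrier G" using F1(2) xG by blast
    ultimately have "P2 (k3, Fq \<inter> cj (\<iota> x) ` Fq)"
      unfolding P2_def using k3 Fq F1(1,2)
      by (auto intro!: exI[of _ "F1 \<union> cj (\<iota> x) ` F1"])
    then have "card Fq \<le> card (Fq \<inter> cj (\<iota> x) ` Fq)" by (rule leastF)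
    then have "Fq \<inter> cj (\<iota> x) ` Fq = Fq" using Fq(1) by (intro card_seteq) auto
    then have sub: "Fq \<subseteq> cj (\<iota> x) ` Fq" by blast
    have "cj x ` Fq \<subseteq> Fq"
    proof
      fix f assume "f \<in> cj x ` Fq"
      then obtain f1 where f1: "f1 \<in> Fq" "f = cj x f1" by blast
      then obtain f2 where f2: "f2 \<in> Fq" "f1 = cj (\<iota> x) f2" using sub by blast
      then have "f2 \<in> carrier G" using Fq(2) by blast
      then show "f \<in> Fq" using f1 f2 c1 by simp
    qed
    then show "x \<in> L" unfolding L_def using G.stabilizer_memI[OF H Fq(2,1) act1 actm x(1)] by blast
  qed
  \<comment> \<open>Otherwise \<open>Q1 - {q}\<close> would be a smaller cover.\<close>
  have "\<exists>u\<in>H. \<exists>r\<in>homog u. k \<otimes> r \<otimes> \<gamma> \<noteq> \<zero> \<and> cj u q \<in> Fq"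
  proof (rule ccontr)
    assume "\<not> ?thesis"
    then have "cov k \<e> {} F1 (Q1 - {q})" using F1(3) unfolding cov_def by blast
    then have "P1 (Q1 - {q})" unfolding P1_def ok_def using k F1 Q1Q by blast
    then have "card Q1 \<le> card (Q1 - {q})" by (rule leastQ)
    then show False using card_Diff1_less[OF finQ1 q] by simp
  qed
  then obtain u r where u: "u \<in> H" "r \<in> homog u" "k \<otimes> r \<otimes> cut {\<e>} b2 \<noteq> \<zero>" "cj u q \<in> Fq" unfolding \<gamma>_def by blast
  have uG: "u \<in> carrier G" using u HG by simp
  obtain z r' where z: "z \<in> H" "r' \<in> homog z" "k \<otimes> r' \<otimes> cut {\<e>} a \<noteq> \<zero>"
    using gen_reach[OF graded_prime separating k a] by blast
  obtain a' b' where new: "annihilating_pair L k a' b'" "supp R a' \<subseteq> cj z ` supp R a" "supp R b' \<subseteq> cj u ` supp R b2"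
    using restrict_pair[OF graded_prime pair2 k(1,2) L LH TL z u(1-3)] by blast
  have "coset_count H b \<le> coset_count L b'" using min new(1) unfolding minimal_pair_def by blast
  moreover have "coset_count L b' < coset_count H b"
  proof -
    have good': "separating L k" "b' \<in> gen L k" using new(1) unfolding annihilating_pair_def by auto
    have b'L: "supp R b' \<subseteq> L" using gen_supp[OF good'] in_supp by blast
    obtain h h0 where h: "h \<in> X3" "h \<notin> D" "h0 \<in> X3" "h0 \<in> D" "q = h \<star> \<iota> h0" using qQ unfolding Q_def by auto
    have hG: "h \<in> carrier G" "h0 \<in> carrier G" using h X3H HG by auto
    have inD: "x \<star> \<iota> y \<in> D \<longleftrightarrow> G.FC_coset H x = G.FC_coset H y" if "x \<in> carrier G" "y \<in> carrier G" for x y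
      using G.FC_coset_eq[OF H that] unfolding D_def by simp
    \<comment> \<open>Labels of cosets after the coset of \<open>h\<close> is identified with that
      of \<open>h0\<close>. The two differ, since \<open>h0\<close> lies in the FC center of
      \<open>H\<close> and \<open>h\<close> does not.\<close>
    define m where "m x = (if G.FC_coset H x = G.FC_coset H h then G.FC_coset H h0 else G.FC_coset H x)" for x
    have rep: "\<exists>x. x \<in> X3 \<and> (\<exists>d\<in>D. p = cj u (d \<star> x))" if p: "p \<in> supp R b'" for p
    proof -
      obtain x where x: "b2 x \<noteq> \<z>" "p = cj u x" using p new(3) in_supp by blast
      obtain d w where "aD d \<noteq> \<z>" "b3 w \<noteq> \<z>" "x = d \<star> w" using mult_supp[OF aDc b3c] x(1) unfolding b2_def by blast
      then show ?thesis using x(2) aDs unfolding X3_def Y_def in_supp by blast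
    qed
    then obtain \<rho> where \<rho>: "\<And>p. p \<in> supp R b' \<Longrightarrow> \<rho> p \<in> X3 \<and> (\<exists>d\<in>D. p = cj u (d \<star> \<rho> p))" by metis
    \<comment> \<open>\<open>L\<close> permutes the finite set \<open>Fq\<close>. So
      \<open>cj u q\<close> has finitely many conjugates under \<open>L\<close>, although
      \<open>q\<close> is outside the FC center of \<open>H\<close>: this is what merges the cosets
      of \<open>h\<close> and \<open>h0\<close>.\<close>
    have qL: "cj u q \<in> G.almost_centralizer L"
    proof (rule G.almost_centralizer_I[OF _ Fq(1)])
      show "cj u q \<in> carrier G" using uG qG by simp
      show "cj l (cj u q) \<in> Fq" if "l \<in> L" for l using that u(4) unfolding L_def by blast
    qed
    have DL: "d \<in> G.almost_centralizer L" if "d \<in> D" for d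
      using that G.almost_centralizer_antimono[OF LH] unfolding D_def G.FC_eq[OF H] by blast
    note Am = G.almost_centralizer_mult[OF L] and Ai = G.almost_centralizer_inv[OF L]
    have rel: "cj u (x \<star> \<iota> y) \<in> G.almost_centralizer L" if xy: "x \<in> X3" "y \<in> X3" "m x = m y" for x y
    proof -
      have G': "x \<in> carrier G" "y \<in> carrier G" using xy X3H HG by auto
      have base: "cj u (x \<star> \<iota> h0) \<in> G.almost_centralizer L" if x: "x \<in> X3" "m x = G.FC_coset H h0" for x
      proof -
        have xG: "x \<in> carrier G" using x X3H HG by auto
        show ?thesis
        proof (cases "G.FC_coset H x = G.FC_coset H h")
          case True
          then have d: "x \<star> \<iota> h \<in> D" using inD xG hG by simp
          have "x \<star> \<iota> h0 = (x \<star> \<iota> h) \<star> q" unfolding h(5) using xG hG by (simp add: G.group_word)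
          then have "cj u (x \<star> \<iota> h0) = cj u (x \<star> \<iota> h) \<star> cj u q" using xG hG uG qG by (simp add: G.conj_by_mult)
          then show ?thesis using Am[OF DL[OF Dc[OF d u(1)]] qL] by simp
        next
          case False
          then have "x \<star> \<iota> h0 \<in> D" using x(2) inD xG hG unfolding m_def by simp
          then show ?thesis using DL Dc u(1) by blast
        qed
      qed
      show ?thesis
      proof (cases "m x = G.FC_coset H h0")
        case True
        have "cj u (x \<star> \<iota> y) = cj u (x \<star> \<iota> h0) \<star> \<iota> (cj u (y \<star> \<iota> h0))"
          using G' hG uG by (simp add: G.conj_by_def G.group_word)
        then show ?thesis using Am[OF base[OF xy(1) True] Ai[OF base[OF xy(2)]]] True xy(3) by simp
      next
        case False
        then have "G.FC_coset H x = G.FC_coset H y" using xy(3) unfolding m_def by (auto split: if_splits)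
        then have "x \<star> \<iota> y \<in> D" using inD G' by simp
        then show ?thesis using DL Dc u(1) by blast
      qed
    qed
    \<comment> \<open>Each degree of \<open>b'\<close> is a conjugate of \<open>d \<star> x\<close>
      with \<open>d\<close> in the FC center and \<open>x\<close> in \<open>X3\<close>, and its
      coset modulo the FC center of \<open>L\<close> depends only on the merged label of
      \<open>x\<close>.\<close>
    have "coset_count L b' \<le> card (m ` X3)"
      unfolding coset_count_def
    proof (rule card_image_factor[OF finX3, where g = \<rho>])
      show "\<rho> p \<in> X3" if "p \<in> supp R b'" for p using \<rho>[OF that] by blast
      fix p p' assume p: "p \<in> supp R b'" "p' \<in> supp R b'" and e: "m (\<rho> p) = m (\<rho> p')"
      obtain d d' where d: "d \<in> D" "p = cj u (d \<star> \<rho> p)" "d' \<in> D" "p' = cj u (d' \<star> \<rho> p')" using \<rho> p by metis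
      define x x' where "x = \<rho> p" and "x' = \<rho> p'"
      have X: "x \<in> X3" "x' \<in> X3" unfolding x_def x'_def using \<rho> p by blast+
      have G': "x \<in> carrier G" "x' \<in> carrier G" "d \<in> carrier G" "d' \<in> carrier G" using X X3H HG d DG by auto
      have "p \<star> \<iota> p' = cj u d \<star> cj u (x \<star> \<iota> x') \<star> \<iota> (cj u d')"
        unfolding d(2)[folded x_def] d(4)[folded x'_def] using G' uG by (simp add: G.conj_by_def G.group_word)
      moreover have "cj u (x \<star> \<iota> x') \<in> G.almost_centralizer L" using rel[OF X] e unfolding x_def x'_def by simp
      ultimately have "p \<star> \<iota> p' \<in> G.almost_centralizer L" using Am Ai DL Dc d(1,3) u(1) by metis
      moreover have pL: "p \<in> L" "p' \<in> L" using p b'L by auto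
      ultimately have "p \<star> \<iota> p' \<in> G.FC L" using G.FC_eq[OF L] G.sub_mult[OF L] G.sub_inv[OF L] by blast
      then show "G.FC_coset L p = G.FC_coset L p'" using G.FC_coset_eq[OF L] G.sub_mem[OF L] pL by blast
    qed
    also have "\<dots> < card (G.FC_coset H ` X3)"
    proof (rule psubset_card_mono)
      show "finite (G.FC_coset H ` X3)" using finX3 by simp
      have ne: "G.FC_coset H h0 \<noteq> G.FC_coset H h"
      proof
        assume "G.FC_coset H h0 = G.FC_coset H h"
        then have "h \<star> \<iota> h0 \<in> D" using inD hG by simp
        then have "h \<star> \<iota> h0 \<star> h0 \<in> D" using h(4) Dm by blast
        then show False using h(2) hG by (simp add: G.m_assoc)
      qed
      have sub: "m ` X3 \<subseteq> G.FC_coset H ` X3" unfolding m_def using h(3) by auto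
      have "G.FC_coset H h \<notin> m ` X3" unfolding m_def using ne by auto
      moreover have "G.FC_coset H h \<in> G.FC_coset H ` X3" using h(1) by (rule imageI)
      ultimately have "m ` X3 \<noteq> G.FC_coset H ` X3" by metis
      then show "m ` X3 \<subset> G.FC_coset H ` X3" using sub by (intro psubsetI)
    qed
    also have "\<dots> \<le> coset_count H b"
    proof -
      obtain \<xi> where \<xi>: "\<And>p. p \<in> X3 \<Longrightarrow> b (\<xi> p) \<noteq> \<z> \<and> p = y \<star> \<xi> p \<star> \<iota> c0 \<and> \<xi> p \<in> carrier G"
        using b3s unfolding X3_def in_supp by metis
      show ?thesis unfolding coset_count_def
      proof (rule card_image_factor[OF finite_supp[OF bc], where g = \<xi>])
        show "\<xi> p \<in> supp R b" if "p \<in> X3" for p using \<xi>[OF that] in_supp by blast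
        fix p p' assume p: "p \<in> X3" "p' \<in> X3" "G.FC_coset H (\<xi> p) = G.FC_coset H (\<xi> p')"
        have G': "\<xi> p \<in> carrier G" "\<xi> p' \<in> carrier G" using \<xi> p by auto
        have pG: "p \<in> carrier G" "p' \<in> carrier G" using p X3H HG by auto
        have "\<xi> p \<star> \<iota> (\<xi> p') \<in> D" using inD G' p(3) by simp
        then have "cj y (\<xi> p \<star> \<iota> (\<xi> p')) \<in> D" using Dc ys(1) by blast
        moreover have "p \<star> \<iota> p' = (y \<star> \<xi> p \<star> \<iota> c0) \<star> \<iota> (y \<star> \<xi> p' \<star> \<iota> c0)" using \<xi> p(1,2) by metis
        then have "p \<star> \<iota> p' = cj y (\<xi> p \<star> \<iota> (\<xi> p'))" using G' yG c0(1) by (simp add: G.conj_by_def G.group_word)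
        ultimately have "p \<star> \<iota> p' \<in> D" by (simp only:)
        then show "G.FC_coset H p = G.FC_coset H p'" using inD[OF pG] by blast
      qed
    qed
    finally show ?thesis .
  qed
  ultimately show False by simp
qed

lemma gen_all: "f \<in> carrier S \<Longrightarrow> f \<in> gen (carrier G) \<one>"
proof (induction f rule: carrier_induct)
  case zero
  then show ?case by (rule gen.gen_zero)
next
  case (homog x s)
  have "s \<otimes> \<one> \<otimes> \<one> \<in> gen (carrier G) \<one>" by (rule gen.gen_incl[OF homog(2) homog_one homog(1) G.one_closed])
  then show ?case using homog by (simp add: homog_carrier)
next
  case (add f g)
  then show ?case using gen.gen_add by blast
qed

lemma separating_all: "separating (carrier G) \<one>"
  unfolding separating_def using G.subgroup_self by auto

text \<open>If graded primeness fails, two elements of degree \<open>\<e>\<close> annihilate each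
  other and the trivial subgroup serves as \<open>N\<close>. Otherwise the whole group with
  \<open>j = \<one>\<close> starts the descent, after translation to nonzero coefficients at the
  identity.\<close>

theorem annihilating_pair_finite:
  assumes a: "a \<in> carrier S" "a \<noteq> \<zero>" and b: "b \<in> carrier S" "b \<noteq> \<zero>" and ann: "ann (carrier G) a b"
  shows finite_annihilating_pair
proof (rule ccontr)
  assume no_pair: "\<not> finite_annihilating_pair"
  have graded_prime
    unfolding graded_prime_def
  proof (rule ccontr)
    assume "\<not> (\<forall>a\<in>homog \<e>. \<forall>b\<in>homog \<e>. a \<noteq> \<zero> \<longrightarrow> b \<noteq> \<zero> \<longrightarrow>
     (\<exists>x\<in>carrier G. \<exists>s\<in>homog x. a \<otimes> s \<otimes> b \<noteq> \<zero>))"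
    then obtain c d where cd: "c \<in> homog \<e>" "d \<in> homog \<e>" "c \<noteq> \<zero>" "d \<noteq> \<zero>"
      "\<And>x s. x \<in> carrier G \<Longrightarrow> s \<in> homog x \<Longrightarrow> c \<otimes> s \<otimes> d = \<zero>" by blast
    have "ann (carrier G) c d" unfolding ann_def using cd(5) by blast
    moreover have "supp R c \<subseteq> {\<e>}" "supp R d \<subseteq> {\<e>}" using cd(1,2) unfolding homog_def by auto
    moreover have "\<forall>h\<in>carrier G. \<forall>n\<in>{\<e>}. cj h n \<in> {\<e>}" by simp
    ultimately show False using no_pair separating_all gen_all[OF homog_carrier[OF cd(1)]] gen_all[OF homog_carrier[OF cd(2)]] cd(3,4)
        G.triv_subgroup unfolding finite_annihilating_pair_def by blast
  qed
  obtain x where x: "x \<in> carrier G" "a x \<noteq> \<z>" using nonzeroE[OF a] .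
  obtain y where y: "y \<in> carrier G" "b y \<noteq> \<z>" using nonzeroE[OF b] .
  obtain s where s: "s \<in> homog (\<iota> x)" "(a \<otimes> s) \<e> \<noteq> \<z>" using shift_right[OF a(1) x(2)] .
  obtain t where t: "t \<in> homog (\<iota> y)" "(b \<otimes> t) \<e> \<noteq> \<z>" using shift_right[OF b(1) y(2)] .
  have c: "s \<in> carrier S" "t \<in> carrier S" using s t by auto
  have "ann (carrier G) (a \<otimes> s) b"
    by (rule ann_mid(2)[OF G.subgroup_self ann a(1) b(1) c(1)]) (use supp_carrier c in blast)
  then have "ann (carrier G) (a \<otimes> s) (b \<otimes> t)" by (rule ann_right) (use a b c in auto)
  then have "annihilating_pair (carrier G) \<one> (a \<otimes> s) (b \<otimes> t)"
    unfolding annihilating_pair_def using separating_all gen_all a b c s t by simp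
  then obtain H j a' b' where "minimal_pair H j a' b'" using ex_minimal_pair by blast
  then show False using minimal_pair_False[OF \<open>graded_prime\<close> no_pair] by blast
qed

end

section \<open>Twisted partial actions and crossed products\<close>

context unital_twisted_partial_action
begin

abbreviation rm (infixl "\<bullet>" 70) where "x \<bullet> y \<equiv> x \<otimes>\<^bsub>R\<^esub> y"
abbreviation gm' (infixl "\<star>" 70) where "x \<star> y \<equiv> x \<otimes>\<^bsub>G\<^esub> y"
abbreviation gi' ("\<iota>") where "gi' x \<equiv> inv\<^bsub>G\<^esub> x"
abbreviation ge' ("\<e>") where "ge' \<equiv> \<one>\<^bsub>G\<^esub>"
abbreviation rz' ("\<z>") where "rz' \<equiv> \<zero>\<^bsub>R\<^esub>"
abbreviation u where "u g \<equiv> identity_of R (D g)"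

lemma D_carrier: "g \<in> carrier G \<Longrightarrow> x \<in> D g \<Longrightarrow> x \<in> carrier R"
  using ideal.Icarr[OF D_ideal] .

lemma identity_of_eq:
  assumes "is_identity_of R J v" shows "identity_of R J = v"
  unfolding identity_of_def
proof (rule the_equality[where P = "is_identity_of R J", OF assms])
  fix v' assume v': "is_identity_of R J v'"
  have "v \<bullet> v' = v'" using assms v' unfolding is_identity_of_def by blast
  moreover have "v \<bullet> v' = v" using assms v' unfolding is_identity_of_def by blast
  ultimately show "v' = v" by simp
qed

lemma
  assumes g: "g \<in> carrier G"
  shows u_mem: "u g \<in> D g"
    and u_left: "x \<in> D g \<Longrightarrow> u g \<bullet> x = x"
    and u_right: "x \<in> D g \<Longrightarrow> x \<bullet> u g = x"
    and u_central: "r \<in> carrier R \<Longrightarrow> u g \<bullet> r = r \<bullet> u g"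
proof -
  obtain v where v: "is_identity_of R (D g) v" "\<forall>r\<in>carrier R. v \<bullet> r = r \<bullet> v" using D_identity[OF g] by blast
  have e: "u g = v" by (rule identity_of_eq[OF v(1)])
  show "u g \<in> D g" using v(1) unfolding e is_identity_of_def by blast
  show "u g \<bullet> x = x" "x \<bullet> u g = x" if "x \<in> D g" for x using v(1) that unfolding e is_identity_of_def by blast+
  show "u g \<bullet> r = r \<bullet> u g" if "r \<in> carrier R" for r using v(2) that unfolding e by blast
qed

lemma u_carrier: "g \<in> carrier G \<Longrightarrow> u g \<in> carrier R"
  using D_carrier u_mem by blast

lemma u_one: "u \<e> = \<one>\<^bsub>R\<^esub>"
  by (rule identity_of_eq) (simp add: is_identity_of_def UP1(1))

lemma D_l: "g \<in> carrier G \<Longrightarrow> x \<in> D g \<Longrightarrow> r \<in> carrier R \<Longrightarrow> r \<bullet> x \<in> D g"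
  using ideal.I_l_closed[OF D_ideal] .

lemma D_r: "g \<in> carrier G \<Longrightarrow> x \<in> D g \<Longrightarrow> r \<in> carrier R \<Longrightarrow> x \<bullet> r \<in> D g"
  using ideal.I_r_closed[OF D_ideal] .

lemma D_add: "g \<in> carrier G \<Longrightarrow> x \<in> D g \<Longrightarrow> y \<in> D g \<Longrightarrow> x \<oplus>\<^bsub>R\<^esub> y \<in> D g"
  using additive_subgroup.a_closed[OF ideal.axioms(1)[OF D_ideal]] .

lemma D_zero: "g \<in> carrier G \<Longrightarrow> \<z> \<in> D g"
  using additive_subgroup.zero_closed[OF ideal.axioms(1)[OF D_ideal]] .

lemma D_minus: "g \<in> carrier G \<Longrightarrow> x \<in> D g \<Longrightarrow> \<ominus>\<^bsub>R\<^esub> x \<in> D g"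
  using additive_subgroup.a_inv_closed[OF ideal.axioms(1)[OF D_ideal]] .

text \<open>Multiplication by the central idempotent \<open>u g\<close> projects onto
  \<open>D g\<close>. This replaces the sets of sums in the theorem by intersections.\<close>

lemma ideal_prod_u:
  assumes "ideal I R" "g \<in> carrier G" shows "I \<cdot>\<^bsub>R\<^esub> {u g} = I \<inter> D g"
proof
  show "I \<cdot>\<^bsub>R\<^esub> {u g} \<subseteq> I \<inter> D g"
  proof
    fix x assume "x \<in> I \<cdot>\<^bsub>R\<^esub> {u g}"
    then show "x \<in> I \<inter> D g"
    proof (induction rule: ideal_prod.induct)
      case (prod i j)
      then show ?case
        using ideal.I_r_closed[OF assms(1), of i j] D_l[OF assms(2) u_mem[OF assms(2)]] u_carrier[OF assms(2)]
          ideal.Icarr[OF assms(1)] by blast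
    next
      case (sum s1 s2)
      then show ?case using D_add[OF assms(2)] additive_subgroup.a_closed[OF ideal.axioms(1)[OF assms(1)]] by blast
    qed
  qed
  show "I \<inter> D g \<subseteq> I \<cdot>\<^bsub>R\<^esub> {u g}"
  proof
    fix x assume x: "x \<in> I \<inter> D g"
    then have "x \<bullet> u g \<in> I \<cdot>\<^bsub>R\<^esub> {u g}" by (intro ideal_prod.prod) auto
    then show "x \<in> I \<cdot>\<^bsub>R\<^esub> {u g}" using u_right[OF assms(2)] x by simp
  qed
qed

lemma ideal_prod_D:
  assumes "ideal I R" "g \<in> carrier G" shows "I \<cdot>\<^bsub>R\<^esub> D g = I \<inter> D g"
proof
  show "I \<cdot>\<^bsub>R\<^esub> D g \<subseteq> I \<inter> D g" by (rule R.ideal_prod_inter[OF assms(1) D_ideal[OF assms(2)]])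
  show "I \<inter> D g \<subseteq> I \<cdot>\<^bsub>R\<^esub> D g"
  proof
    fix x assume x: "x \<in> I \<inter> D g"
    then have "x \<bullet> u g \<in> I \<cdot>\<^bsub>R\<^esub> D g" using u_mem[OF assms(2)] by (intro ideal_prod.prod) auto
    then show "x \<in> I \<cdot>\<^bsub>R\<^esub> D g" using u_right[OF assms(2)] x by simp
  qed
qed

lemma D_inter: "g \<in> carrier G \<Longrightarrow> h \<in> carrier G \<Longrightarrow> D g \<cdot>\<^bsub>R\<^esub> D h = D g \<inter> D h"
  by (rule ideal_prod_D[OF D_ideal])

lemma D_inter_identity:
  assumes "g \<in> carrier G" "h \<in> carrier G" shows "is_identity_of R (D g \<inter> D h) (u g \<bullet> u h)"
  unfolding is_identity_of_def
proof (intro conjI ballI)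
  have c: "u g \<in> carrier R" "u h \<in> carrier R" using u_carrier assms by auto
  show "u g \<bullet> u h \<in> D g \<inter> D h" using D_l D_r u_mem assms c by blast
  fix x assume x: "x \<in> D g \<inter> D h"
  then have xc: "x \<in> carrier R" using D_carrier assms by blast
  show "u g \<bullet> u h \<bullet> x = x" using x c xc u_left assms by (simp add: R.m_assoc)
  have "x \<bullet> (u g \<bullet> u h) = x \<bullet> u g \<bullet> u h" using c xc by (simp add: R.m_assoc)
  then show "x \<bullet> (u g \<bullet> u h) = x" using x u_right assms by simp
qed

lemma alpha_facts:
  assumes g: "g \<in> carrier G"
  shows alpha_mem: "x \<in> D (\<iota> g) \<Longrightarrow> \<alpha> g x \<in> D g"
    and alpha_mult: "x \<in> D (\<iota> g) \<Longrightarrow> y \<in> D (\<iota> g) \<Longrightarrow> \<alpha> g (x \<bullet> y) = \<alpha> g x \<bullet> \<alpha> g y"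
    and alpha_add: "x \<in> D (\<iota> g) \<Longrightarrow> y \<in> D (\<iota> g) \<Longrightarrow> \<alpha> g (x \<oplus>\<^bsub>R\<^esub> y) = \<alpha> g x \<oplus>\<^bsub>R\<^esub> \<alpha> g y"
    and alpha_u: "\<alpha> g (u (\<iota> g)) = u g"
    and alpha_bij: "bij_betw (\<alpha> g) (D (\<iota> g)) (D g)"
  using ring_iso_memE[OF alpha_iso[OF g]] unfolding ideal_ring_def by simp_all

lemma alpha_zero: assumes g: "g \<in> carrier G" shows "\<alpha> g \<z> = \<z>"
proof -
  have z: "\<z> \<in> D (\<iota> g)" using D_zero g by simp
  have c: "\<alpha> g \<z> \<in> carrier R" using D_carrier[OF g alpha_mem[OF g z]] .
  have "\<alpha> g \<z> \<oplus>\<^bsub>R\<^esub> \<alpha> g \<z> = \<alpha> g \<z>" using alpha_add[OF g z z] by simp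
  then show ?thesis using c by (simp add: R.add.l_cancel_one)
qed

text \<open>By \<open>UP2\<close> one ideal is mapped onto the other, and a surjective
  multiplicative map preserves identity elements.\<close>

lemma alpha_uu:
  assumes g: "g \<in> carrier G" and h: "h \<in> carrier G"
  shows "\<alpha> g (u (\<iota> g) \<bullet> u h) = u g \<bullet> u (g \<star> h)"
proof -
  have gi: "\<iota> g \<in> carrier G" and gh: "g \<star> h \<in> carrier G" using g h by auto
  have img: "\<alpha> g ` (D (\<iota> g) \<inter> D h) = D g \<inter> D (g \<star> h)" using UP2[OF g h] D_inter[OF gi h] D_inter[OF g gh] by simp
  note id1 = D_inter_identity[OF gi h, unfolded is_identity_of_def] and id2 = D_inter_identity[OF g gh, unfolded is_identity_of_def]
  have "\<alpha> g (u (\<iota> g) \<bullet> u h) \<in> D g \<inter> D (g \<star> h)" using img id1 by blast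
  moreover obtain y where y: "y \<in> D (\<iota> g) \<inter> D h" "u g \<bullet> u (g \<star> h) = \<alpha> g y" using img id2 by blast
  then have "\<alpha> g (u (\<iota> g) \<bullet> u h) \<bullet> \<alpha> g y = \<alpha> g y"
    using alpha_mult[OF g, of "u (\<iota> g) \<bullet> u h" y] id1 by auto
  ultimately show ?thesis using id2 y(2) by metis
qed

abbreviation wi where "wi g h \<equiv> inv\<^bsub>ideal_ring R (D g \<cdot>\<^bsub>R\<^esub> D (g \<star> h))\<^esub> (w g h)"

lemma w_inverse:
  assumes g: "g \<in> carrier G" and h: "h \<in> carrier G"
  shows w_mem: "w g h \<in> D g \<inter> D (g \<star> h)" and wi_mem: "wi g h \<in> D g \<inter> D (g \<star> h)"
    and w_wi: "w g h \<bullet> wi g h = u g \<bullet> u (g \<star> h)" and wi_w: "wi g h \<bullet> w g h = u g \<bullet> u (g \<star> h)"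
proof -
  have gh: "g \<star> h \<in> carrier G" using g h by simp
  define J where "J = D g \<cdot>\<^bsub>R\<^esub> D (g \<star> h)"
  have J: "J = D g \<inter> D (g \<star> h)" unfolding J_def by (rule D_inter[OF g gh])
  have id: "is_identity_of R J (u g \<bullet> u (g \<star> h))" unfolding J by (rule D_inter_identity[OF g gh])
  have one: "identity_of R J = u g \<bullet> u (g \<star> h)" by (rule identity_of_eq[OF id])
  let ?M = "ideal_ring R J"
  have M: "carrier ?M = J" "\<one>\<^bsub>?M\<^esub> = u g \<bullet> u (g \<star> h)" "\<And>x y. x \<otimes>\<^bsub>?M\<^esub> y = x \<bullet> y"
    unfolding ideal_ring_def by (simp_all add: one)
  have Jc: "x \<in> carrier R" if "x \<in> J" for x using that D_carrier[OF g] unfolding J by blast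
  have Jm: "x \<bullet> y \<in> J" if "x \<in> J" "y \<in> J" for x y
    using that(2) D_l[OF g _ Jc[OF that(1)]] D_l[OF gh _ Jc[OF that(1)]] unfolding J by blast
  interpret M: monoid ?M
  proof (rule monoidI)
    show "x \<otimes>\<^bsub>?M\<^esub> y \<in> carrier ?M" if "x \<in> carrier ?M" "y \<in> carrier ?M" for x y
      using that Jm unfolding M by blast
  qed (use id Jc in \<open>auto simp: M is_identity_of_def R.m_assoc\<close>)
  have U: "w g h \<in> Units ?M" unfolding J_def by (rule w_invertible[OF g h])
  show "w g h \<in> D g \<inter> D (g \<star> h)" using M.Units_closed[OF U] M(1) J by simp
  show "wi g h \<in> D g \<inter> D (g \<star> h)" using M.Units_inv_closed[OF U] M(1) J unfolding J_def by simp
  show "w g h \<bullet> wi g h = u g \<bullet> u (g \<star> h)" using M.Units_r_inv[OF U, unfolded M] unfolding J_def .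
  show "wi g h \<bullet> w g h = u g \<bullet> u (g \<star> h)" using M.Units_l_inv[OF U, unfolded M] unfolding J_def .
qed

text \<open>The coefficient of the product of \<open>a\<close> in degree \<open>g\<close> and
  \<open>b\<close> in degree \<open>h\<close>; identities of the crossed product are thus checked in
  \<open>R\<close>.\<close>

definition hom_mult :: "'g \<Rightarrow> 'g \<Rightarrow> 'r \<Rightarrow> 'r \<Rightarrow> 'r" where
  "hom_mult g h a b = a \<bullet> \<alpha> g (b \<bullet> u (\<iota> g)) \<bullet> w g h"

lemma bu_mem: "g \<in> carrier G \<Longrightarrow> b \<in> carrier R \<Longrightarrow> b \<bullet> u (\<iota> g) \<in> D (\<iota> g)"
  using D_l u_mem by simp

lemma abu_mem: "g \<in> carrier G \<Longrightarrow> b \<in> carrier R \<Longrightarrow> \<alpha> g (b \<bullet> u (\<iota> g)) \<in> D g"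
  using alpha_mem bu_mem by blast

lemma hom_mult_mem:
  assumes "g \<in> carrier G" "h \<in> carrier G" "a \<in> carrier R" "b \<in> carrier R"
  shows "hom_mult g h a b \<in> D g" "hom_mult g h a b \<in> D (g \<star> h)" "hom_mult g h a b \<in> carrier R"
proof -
  have c: "a \<bullet> \<alpha> g (b \<bullet> u (\<iota> g)) \<in> carrier R" using D_carrier abu_mem assms by simp
  have w: "w g h \<in> D g \<inter> D (g \<star> h)" using w_mem assms by blast
  show "hom_mult g h a b \<in> D g" unfolding hom_mult_def using D_l[OF assms(1) _ c] w by blast
  show "hom_mult g h a b \<in> D (g \<star> h)" unfolding hom_mult_def using D_l[OF G.m_closed[OF assms(1,2)] _ c] w by blast
  then show "hom_mult g h a b \<in> carrier R" using D_carrier G.m_closed[OF assms(1,2)] by blast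
qed

lemma w_carrier: "g \<in> carrier G \<Longrightarrow> h \<in> carrier G \<Longrightarrow> w g h \<in> carrier R"
  using D_carrier w_mem by blast

lemma hom_mult_add_left:
  assumes "g \<in> carrier G" "h \<in> carrier G" "a \<in> carrier R" "a' \<in> carrier R" "b \<in> carrier R"
  shows "hom_mult g h (a \<oplus>\<^bsub>R\<^esub> a') b = hom_mult g h a b \<oplus>\<^bsub>R\<^esub> hom_mult g h a' b"
  unfolding hom_mult_def using assms D_carrier[OF _ abu_mem] w_carrier by (simp add: R.l_distr)

lemma hom_mult_add_right:
  assumes "g \<in> carrier G" "h \<in> carrier G" "a \<in> carrier R" "b \<in> carrier R" "b' \<in> carrier R"
  shows "hom_mult g h a (b \<oplus>\<^bsub>R\<^esub> b') = hom_mult g h a b \<oplus>\<^bsub>R\<^esub> hom_mult g h a b'"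
proof -
  have "\<alpha> g ((b \<oplus>\<^bsub>R\<^esub> b') \<bullet> u (\<iota> g)) = \<alpha> g (b \<bullet> u (\<iota> g)) \<oplus>\<^bsub>R\<^esub> \<alpha> g (b' \<bullet> u (\<iota> g))"
    using assms u_carrier bu_mem alpha_add by (simp add: R.l_distr)
  then show ?thesis unfolding hom_mult_def using assms D_carrier[OF _ abu_mem] w_carrier by (simp add: R.l_distr R.r_distr)
qed

lemma hom_mult_zero_left: "g \<in> carrier G \<Longrightarrow> h \<in> carrier G \<Longrightarrow> b \<in> carrier R \<Longrightarrow> hom_mult g h \<z> b = \<z>"
  unfolding hom_mult_def using D_carrier[OF _ abu_mem] w_carrier by simp

lemma hom_mult_zero_right: "g \<in> carrier G \<Longrightarrow> h \<in> carrier G \<Longrightarrow> a \<in> carrier R \<Longrightarrow> hom_mult g h a \<z> = \<z>"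
  unfolding hom_mult_def using u_carrier w_carrier alpha_zero by simp

lemma hom_mult_one_left:
  assumes "g \<in> carrier G" "r \<in> carrier R" "a \<in> D g" shows "hom_mult \<e> g r a = r \<bullet> a"
proof -
  have ac: "a \<in> carrier R" using D_carrier assms by blast
  have "r \<bullet> \<alpha> \<e> (a \<bullet> u (\<iota> \<e>)) \<bullet> w \<e> g = r \<bullet> a \<bullet> u g" using assms ac u_one UP1(2) UP4(1) by simp
  then show ?thesis unfolding hom_mult_def using assms ac u_right u_carrier by (simp add: R.m_assoc)
qed

lemma hom_mult_one_right:
  assumes "g \<in> carrier G" "a \<in> carrier R" "r \<in> carrier R" shows "hom_mult g \<e> a r = a \<bullet> \<alpha> g (r \<bullet> u (\<iota> g))"
proof -
  have "\<alpha> g (r \<bullet> u (\<iota> g)) \<in> D g" using abu_mem assms by blast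
  then show ?thesis unfolding hom_mult_def using assms D_carrier[OF assms(1)] u_right u_carrier by (simp add: UP4(2) R.m_assoc)
qed

text \<open>\<open>UP3\<close> applies to \<open>c\<close> times both \<open>u (\<iota> h)\<close>
  and \<open>u (\<iota> (g \<star> h))\<close>. On the left, the second idempotent is already
  present, since \<open>\<alpha> h\<close> turns it into \<open>u (\<iota> g)\<close> inside
  \<open>D h\<close>; on the right, the factor \<open>u (g \<star> h) \<bullet> u g\<close> accounts
  for the restriction.\<close>

lemma alpha_alpha:
  assumes g: "g \<in> carrier G" and h: "h \<in> carrier G" and c: "c \<in> carrier R"
  shows "\<alpha> g (\<alpha> h (c \<bullet> u (\<iota> h)) \<bullet> u (\<iota> g)) =
    w g h \<bullet> (\<alpha> (g \<star> h) (c \<bullet> u (\<iota> (g \<star> h))) \<bullet> (u (g \<star> h) \<bullet> u g)) \<bullet> wi g h"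
proof -
  have G': "\<iota> g \<in> carrier G" "\<iota> h \<in> carrier G" "g \<star> h \<in> carrier G" "\<iota> (g \<star> h) \<in> carrier G" using g h by auto
  have U: "u g \<in> carrier R" "u h \<in> carrier R" "u (\<iota> g) \<in> carrier R" "u (\<iota> h) \<in> carrier R" "u (g \<star> h) \<in> carrier R"
    "u (\<iota> (g \<star> h)) \<in> carrier R" using u_carrier G' g h by auto
  define c' where "c' = c \<bullet> u (\<iota> h) \<bullet> u (\<iota> (g \<star> h))"
  have idem: "u x \<bullet> u x = u x" if "x \<in> carrier G" for x using u_left[OF that u_mem[OF that]] .
  have c'1: "c' = (c \<bullet> u (\<iota> h)) \<bullet> (u (\<iota> h) \<bullet> u (\<iota> (g \<star> h)))"
  proof -
    have "(c \<bullet> u (\<iota> h)) \<bullet> (u (\<iota> h) \<bullet> u (\<iota> (g \<star> h))) = c \<bullet> (u (\<iota> h) \<bullet> u (\<iota> h)) \<bullet> u (\<iota> (g \<star> h))"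
      using c U by (simp add: R.m_assoc)
    then show ?thesis unfolding c'_def idem[OF G'(2)] by simp
  qed
  have c'2: "c' = (c \<bullet> u (\<iota> (g \<star> h))) \<bullet> (u (\<iota> (g \<star> h)) \<bullet> u (\<iota> h))"
  proof -
    have "(c \<bullet> u (\<iota> (g \<star> h))) \<bullet> (u (\<iota> (g \<star> h)) \<bullet> u (\<iota> h)) = c \<bullet> (u (\<iota> (g \<star> h)) \<bullet> u (\<iota> (g \<star> h))) \<bullet> u (\<iota> h)"
      using c U by (simp add: R.m_assoc)
    also have "\<dots> = c \<bullet> (u (\<iota> (g \<star> h)) \<bullet> u (\<iota> h))" unfolding idem[OF G'(4)] using c U by (simp add: R.m_assoc)
    also have "\<dots> = c'" unfolding c'_def u_central[OF G'(4) U(4)] using c U by (simp add: R.m_assoc)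
    finally show ?thesis by simp
  qed
  have uu1: "u (\<iota> h) \<bullet> u (\<iota> (g \<star> h)) \<in> D (\<iota> h)" "u (\<iota> (g \<star> h)) \<bullet> u (\<iota> h) \<in> D (\<iota> (g \<star> h))"
    using D_r[OF G'(2) u_mem[OF G'(2)] U(6)] D_r[OF G'(4) u_mem[OF G'(4)] U(4)] .
  have "\<alpha> h c' = \<alpha> h (c \<bullet> u (\<iota> h)) \<bullet> (u h \<bullet> u (h \<star> \<iota> (g \<star> h)))"
    unfolding c'1 using alpha_mult[OF h bu_mem[OF h c] uu1(1)] alpha_uu[OF h G'(4)] by simp
  also have "h \<star> \<iota> (g \<star> h) = \<iota> g" using g h by (simp add: G.group_word)
  also have "\<alpha> h (c \<bullet> u (\<iota> h)) \<bullet> (u h \<bullet> u (\<iota> g)) = \<alpha> h (c \<bullet> u (\<iota> h)) \<bullet> u (\<iota> g)"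
    using u_right[OF h abu_mem[OF h c]] D_carrier[OF h abu_mem[OF h c]] U by (simp add: R.m_assoc[symmetric])
  finally have l: "\<alpha> h (c \<bullet> u (\<iota> h)) \<bullet> u (\<iota> g) = \<alpha> h c'" by simp
  have "\<alpha> (g \<star> h) c' = \<alpha> (g \<star> h) (c \<bullet> u (\<iota> (g \<star> h))) \<bullet> (u (g \<star> h) \<bullet> u (g \<star> h \<star> \<iota> h))"
    unfolding c'2 using alpha_mult[OF G'(3) bu_mem[OF G'(3) c] uu1(2)] alpha_uu[OF G'(3) G'(2)] by simp
  also have "g \<star> h \<star> \<iota> h = g" using g h by (simp add: G.group_word)
  finally have r: "\<alpha> (g \<star> h) c' = \<alpha> (g \<star> h) (c \<bullet> u (\<iota> (g \<star> h))) \<bullet> (u (g \<star> h) \<bullet> u g)" .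
  have "c' \<in> D (\<iota> h) \<cdot>\<^bsub>R\<^esub> D (\<iota> (g \<star> h))" unfolding D_inter[OF G'(2) G'(4)]
  proof
    show "c' \<in> D (\<iota> h)" unfolding c'_def by (rule D_r[OF G'(2) bu_mem[OF h c] U(6)])
    show "c' \<in> D (\<iota> (g \<star> h))" unfolding c'_def using D_l[OF G'(4) u_mem[OF G'(4)]] c U by simp
  qed
  then show ?thesis unfolding l using UP3[OF g h] r by simp
qed

lemma hom_mult_assoc:
  assumes g: "g \<in> carrier G" and h: "h \<in> carrier G" and l: "l \<in> carrier G"
    and a: "a \<in> carrier R" and b: "b \<in> D h" and c: "c \<in> carrier R"
  shows "hom_mult (g \<star> h) l (hom_mult g h a b) c = hom_mult g (h \<star> l) a (hom_mult h l b c)"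
proof -
  have G': "\<iota> g \<in> carrier G" "\<iota> h \<in> carrier G" "g \<star> h \<in> carrier G" "h \<star> l \<in> carrier G" "\<iota> (g \<star> h) \<in> carrier G"
    "g \<star> h \<star> l \<in> carrier G" "g \<star> (h \<star> l) \<in> carrier G" using g h l by auto
  note U = u_carrier[OF g] u_carrier[OF h] u_carrier[OF G'(1)] u_carrier[OF G'(2)] u_carrier[OF G'(3)]
    u_carrier[OF G'(4)] u_carrier[OF G'(5)] u_carrier[OF G'(6)]
  have bc: "b \<in> carrier R" using D_carrier[OF h b] .
  define X where "X = \<alpha> h (c \<bullet> u (\<iota> h))"
  have X: "X \<in> D h" "X \<in> carrier R" unfolding X_def using abu_mem[OF h c] D_carrier[OF h] by auto
  define A C W W' V v where "A = \<alpha> g (b \<bullet> u (\<iota> g))" and "C = \<alpha> (g \<star> h) (c \<bullet> u (\<iota> (g \<star> h)))"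
    and "W = w g h" and "W' = wi g h" and "V = w (g \<star> h) l" and "v = w h l"
  have cA: "A \<in> carrier R" and cC: "C \<in> carrier R"
    unfolding A_def C_def using D_carrier[OF g abu_mem[OF g bc]] D_carrier[OF G'(3) abu_mem[OF G'(3) c]] by auto
  have cW: "W \<in> carrier R" "V \<in> carrier R" "v \<in> carrier R" unfolding W_def V_def v_def using w_carrier g h l by auto
  have cW': "W' \<in> carrier R" unfolding W'_def using wi_mem[OF g h] D_carrier[OF g] by blast
  have v: "u (h \<star> l) \<bullet> v = v" unfolding v_def using w_mem[OF h l] u_left[OF G'(4)] by blast
  have V: "u (g \<star> h) \<bullet> V = V" "u (g \<star> h \<star> l) \<bullet> V = V"
    unfolding V_def using w_mem[OF G'(3) l] u_left[OF G'(3)] u_left[OF G'(6)] by auto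
  have Wu: "W \<bullet> u g = W" unfolding W_def using w_mem[OF g h] u_right[OF g] by blast
  \<comment> \<open>Chosen in the domain of \<open>UP5\<close> so that \<open>r \<bullet> v\<close>
    is the coefficient of the inner product, cut down to the domain of \<open>\<alpha> g\<close>.
    The additional idempotents are absorbed by \<open>v\<close>, \<open>W\<close> and
    \<open>V\<close>.\<close>
  define r where "r = (b \<bullet> u (\<iota> g)) \<bullet> (X \<bullet> u (\<iota> g)) \<bullet> (u (\<iota> g) \<bullet> u (h \<star> l))"
  have rD: "b \<bullet> u (\<iota> g) \<in> D (\<iota> g)" "X \<bullet> u (\<iota> g) \<in> D (\<iota> g)" "u (\<iota> g) \<bullet> u (h \<star> l) \<in> D (\<iota> g)"
    using bu_mem[OF g bc] bu_mem[OF g X(2)] D_r[OF G'(1) u_mem[OF G'(1)] U(6)] .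
  have r1: "r \<in> D (\<iota> g)" unfolding r_def
    using D_r[OF G'(1) D_r[OF G'(1) rD(1)]] D_carrier[OF G'(1) rD(2)] D_carrier[OF G'(1) rD(3)] by blast
  have r2: "r \<in> D h" unfolding r_def
    using D_r[OF h D_r[OF h D_r[OF h b U(3)] D_carrier[OF G'(1) rD(2)]] D_carrier[OF G'(1) rD(3)]] .
  have "u (\<iota> g) \<bullet> u (h \<star> l) \<in> D (h \<star> l)" by (rule D_l[OF G'(4) u_mem[OF G'(4)] U(3)])
  moreover have "(b \<bullet> u (\<iota> g)) \<bullet> (X \<bullet> u (\<iota> g)) \<in> carrier R" using bc U X by simp
  ultimately have r3: "r \<in> D (h \<star> l)" unfolding r_def by (rule D_l[OF G'(4)])
  have "ideal (D (\<iota> g) \<cdot>\<^bsub>R\<^esub> D h) R" by (rule R.ideal_prod_is_ideal[OF D_ideal[OF G'(1)] D_ideal[OF h]])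
  then have rr: "r \<in> D (\<iota> g) \<cdot>\<^bsub>R\<^esub> D h \<cdot>\<^bsub>R\<^esub> D (h \<star> l)"
    using ideal_prod_D[OF _ G'(4)] D_inter[OF G'(1) h] r1 r2 r3 by simp
  have rc: "r \<in> carrier R" using D_carrier[OF h r2] .
  have rv: "r \<bullet> v = (b \<bullet> X \<bullet> v) \<bullet> u (\<iota> g)"
  proof -
    have idem: "u (\<iota> g) \<bullet> (u (\<iota> g) \<bullet> y) = u (\<iota> g) \<bullet> y" if "y \<in> carrier R" for y
      using u_left[OF G'(1) D_r[OF G'(1) u_mem[OF G'(1)] that]] .
    have mv: "u (\<iota> g) \<bullet> (X \<bullet> y) = X \<bullet> (u (\<iota> g) \<bullet> y)" if "y \<in> carrier R" for y
      using u_central[OF G'(1) X(2)] that U X by (simp add: R.m_assoc[symmetric])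
    have "r \<bullet> v = b \<bullet> (u (\<iota> g) \<bullet> (X \<bullet> (u (\<iota> g) \<bullet> (u (\<iota> g) \<bullet> (u (h \<star> l) \<bullet> v)))))"
      unfolding r_def using bc X U cW by (simp add: R.m_assoc)
    also have "\<dots> = b \<bullet> (X \<bullet> (u (\<iota> g) \<bullet> v))" using v cW U X by (simp add: idem mv)
    also have "\<dots> = b \<bullet> (X \<bullet> (v \<bullet> u (\<iota> g)))" using u_central[OF G'(1) cW(3)] by simp
    finally show ?thesis using bc X cW U by (simp add: R.m_assoc)
  qed
  have "\<alpha> g r = A \<bullet> \<alpha> g (X \<bullet> u (\<iota> g)) \<bullet> (u g \<bullet> u (g \<star> (h \<star> l)))"
    unfolding r_def A_def
    using alpha_mult[OF g D_r[OF G'(1) rD(1) D_carrier[OF G'(1) rD(2)]] rD(3)] alpha_mult[OF g rD(1,2)] alpha_uu[OF g G'(4)]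
    by simp
  also have "\<alpha> g (X \<bullet> u (\<iota> g)) = W \<bullet> (C \<bullet> (u (g \<star> h) \<bullet> u g)) \<bullet> W'"
    unfolding X_def W_def C_def W'_def by (rule alpha_alpha[OF g h c])
  also have "g \<star> (h \<star> l) = g \<star> h \<star> l" using g h l by (simp add: G.m_assoc)
  finally have \<alpha>r: "\<alpha> g r = A \<bullet> (W \<bullet> (C \<bullet> (u (g \<star> h) \<bullet> u g)) \<bullet> W') \<bullet> (u g \<bullet> u (g \<star> h \<star> l))" .
  have up5: "\<alpha> g (r \<bullet> v) \<bullet> w g (h \<star> l) = \<alpha> g r \<bullet> W \<bullet> V"
    unfolding v_def W_def V_def by (rule UP5[OF g h l rr])
  have uc: "u x \<bullet> (y \<bullet> t) = y \<bullet> (u x \<bullet> t)" if "x \<in> carrier G" "y \<in> carrier R" "t \<in> carrier R" for x y t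
    using u_central[OF that(1,2)] that u_carrier[OF that(1)] by (simp add: R.m_assoc[symmetric])
  have "\<alpha> g r \<bullet> W \<bullet> V = A \<bullet> (W \<bullet> (C \<bullet> (u (g \<star> h) \<bullet> (u g \<bullet> (W' \<bullet> (u g \<bullet> (u (g \<star> h \<star> l) \<bullet> (W \<bullet> V))))))))"
    unfolding \<alpha>r using cA cC cW cW' U by (simp add: R.m_assoc)
  also have "u (g \<star> h \<star> l) \<bullet> (W \<bullet> V) = W \<bullet> V" using uc[OF G'(6) cW(1,2)] V by simp
  also have "u g \<bullet> (W \<bullet> V) = W \<bullet> V" using cW U Wu u_central[OF g cW(1)] by (simp add: R.m_assoc[symmetric])
  also have "W' \<bullet> (W \<bullet> V) = u g \<bullet> V"
  proof -
    have "W' \<bullet> (W \<bullet> V) = u g \<bullet> u (g \<star> h) \<bullet> V"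
      using wi_w[OF g h] cW cW' unfolding W'_def W_def by (simp add: R.m_assoc[symmetric])
    then show ?thesis using V U cW by (simp add: R.m_assoc)
  qed
  also have "u g \<bullet> (u g \<bullet> V) = u g \<bullet> V" using u_left[OF g u_mem[OF g]] U cW by (simp add: R.m_assoc[symmetric])
  also have "u (g \<star> h) \<bullet> (u g \<bullet> V) = u g \<bullet> V" using uc[OF G'(3) U(1) cW(2)] V by simp
  also have "C \<bullet> (u g \<bullet> V) = u g \<bullet> (C \<bullet> V)" using uc[OF g cC cW(2)] by simp
  also have "W \<bullet> (u g \<bullet> (C \<bullet> V)) = W \<bullet> (C \<bullet> V)" using Wu cW cC U by (simp add: R.m_assoc[symmetric])
  finally have fin: "\<alpha> g (r \<bullet> v) \<bullet> w g (h \<star> l) = A \<bullet> (W \<bullet> (C \<bullet> V))" using up5 by simp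
  have "hom_mult h l b c = b \<bullet> X \<bullet> v" unfolding hom_mult_def X_def v_def ..
  then have "hom_mult g (h \<star> l) a (hom_mult h l b c) = a \<bullet> \<alpha> g (r \<bullet> v) \<bullet> w g (h \<star> l)"
    unfolding rv unfolding hom_mult_def by simp
  also have "\<dots> = a \<bullet> (\<alpha> g (r \<bullet> v) \<bullet> w g (h \<star> l))"
  proof -
    have "\<alpha> g (r \<bullet> v) \<in> carrier R" using D_carrier[OF g alpha_mem[OF g D_r[OF G'(1) r1 cW(3)]]] .
    then show ?thesis using a w_carrier[OF g G'(4)] by (simp add: R.m_assoc)
  qed
  also have "\<dots> = hom_mult (g \<star> h) l (hom_mult g h a b) c"
    unfolding fin unfolding hom_mult_def A_def[symmetric] W_def[symmetric] C_def[symmetric] V_def[symmetric]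
    using a cA cW cC by (simp add: R.m_assoc)
  finally show ?thesis by simp
qed

text \<open>The preimage under \<open>\<alpha> g\<close> of the inverse of
  \<open>w g (\<iota> g)\<close>. Placed in degree \<open>\<iota> g\<close>, it inverts the element
  \<open>u g\<close> of degree \<open>g\<close> up to idempotents.\<close>

definition vv :: "'g \<Rightarrow> 'r" where "vv g = (SOME x. x \<in> D (\<iota> g) \<and> \<alpha> g x = wi g (\<iota> g))"

lemma
  assumes g: "g \<in> carrier G"
  shows vv_mem: "vv g \<in> D (\<iota> g)" and alpha_vv: "\<alpha> g (vv g) = wi g (\<iota> g)"
proof -
  have "wi g (\<iota> g) \<in> D g" using wi_mem[OF g, of "\<iota> g"] g by blast
  then have "\<exists>x. x \<in> D (\<iota> g) \<and> \<alpha> g x = wi g (\<iota> g)"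
    using alpha_bij[OF g] unfolding bij_betw_def by (metis imageE)
  then have "vv g \<in> D (\<iota> g) \<and> \<alpha> g (vv g) = wi g (\<iota> g)" unfolding vv_def by (rule someI_ex)
  then show "vv g \<in> D (\<iota> g)" "\<alpha> g (vv g) = wi g (\<iota> g)" by auto
qed

lemma hom_mult_vv:
  assumes g: "g \<in> carrier G" and a: "a \<in> D g" shows "hom_mult g (\<iota> g) a (vv g) = a"
proof -
  have gi: "\<iota> g \<in> carrier G" using g by simp
  have ac: "a \<in> carrier R" using D_carrier[OF g a] .
  have m: "w g (\<iota> g) \<in> carrier R" "wi g (\<iota> g) \<in> carrier R" using w_mem[OF g gi] wi_mem[OF g gi] D_carrier[OF g] by auto
  have "hom_mult g (\<iota> g) a (vv g) = a \<bullet> wi g (\<iota> g) \<bullet> w g (\<iota> g)"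
    unfolding hom_mult_def using u_right[OF gi vv_mem[OF g]] alpha_vv[OF g] by simp
  also have "\<dots> = a \<bullet> (u g \<bullet> u \<e>)" using ac m wi_w[OF g gi] g by (simp add: R.m_assoc)
  also have "\<dots> = a" using u_one u_carrier[OF g] u_right[OF g a] by simp
  finally show ?thesis .
qed

text \<open>The inverse property on the other side follows from associativity:
  \<open>\<alpha> g\<close> takes the value \<open>u g\<close> both at this product and at
  \<open>u (\<iota> g)\<close>, and it is injective.\<close>

lemma hom_mult_vv_u: assumes g: "g \<in> carrier G" shows "hom_mult (\<iota> g) g (vv g) (u g) = u (\<iota> g)"
proof -
  have gi: "\<iota> g \<in> carrier G" using g by simp
  define e where "e = hom_mult (\<iota> g) g (vv g) (u g)"
  have c: "vv g \<in> carrier R" "u g \<in> carrier R" using D_carrier[OF gi vv_mem[OF g]] u_carrier[OF g] by auto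
  have e: "e \<in> D (\<iota> g)" unfolding e_def by (rule hom_mult_mem(1)[OF gi g c])
  have "hom_mult g \<e> (u g) e = hom_mult (g \<star> \<iota> g) g (hom_mult g (\<iota> g) (u g) (vv g)) (u g)"
    unfolding e_def using hom_mult_assoc[OF g gi g c(2) vv_mem[OF g] c(2)] g by simp
  also have "\<dots> = u g" using hom_mult_vv[OF g u_mem[OF g]] hom_mult_one_left[OF g c(2) u_mem[OF g]] u_left[OF g u_mem[OF g]] g by simp
  finally have "hom_mult g \<e> (u g) e = u g" .
  moreover have "hom_mult g \<e> (u g) e = \<alpha> g e"
    using hom_mult_one_right[OF g c(2) D_carrier[OF gi e]] u_right[OF gi e] u_left[OF g alpha_mem[OF g e]] by simp
  ultimately have "\<alpha> g e = \<alpha> g (u (\<iota> g))" using alpha_u[OF g] by simp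
  then show ?thesis using alpha_bij[OF g] e u_mem[OF gi] unfolding e_def bij_betw_def inj_on_def by blast
qed

end

section \<open>The crossed product as a graded ring\<close>

context unital_twisted_partial_action
begin

abbreviation CP where "CP N \<equiv> crossed_product G R \<alpha> D w N"

lemma CP_simps:
  "carrier (CP N) = {f. finite (supp R f) \<and> (\<forall>g\<in>N. f g \<in> D g) \<and> (\<forall>g. g \<notin> N \<longrightarrow> f g = \<z>)}"
  "\<one>\<^bsub>CP N\<^esub> = delta R \<one>\<^bsub>R\<^esub> \<e>" "\<zero>\<^bsub>CP N\<^esub> = (\<lambda>_. \<z>)"
  "f \<oplus>\<^bsub>CP N\<^esub> f' = (\<lambda>k. f k \<oplus>\<^bsub>R\<^esub> f' k)"
  by (simp_all add: crossed_product_def)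

lemma CP_mult:
  "(f \<otimes>\<^bsub>CP N\<^esub> f') k =
    (\<Oplus>\<^bsub>R\<^esub>p\<in>{(g, h). g \<in> supp R f \<and> h \<in> supp R f' \<and> g \<star> h = k}. hom_mult (fst p) (snd p) (f (fst p)) (f' (snd p)))"
  by (simp add: crossed_product_def hom_mult_def case_prod_unfold)

lemma finsum_D:
  assumes "k \<in> carrier G" "finite A" "\<And>p. p \<in> A \<Longrightarrow> F p \<in> D k"
  shows "finsum R F A \<in> D k"
  using assms(2,3)
proof (induction A rule: finite_induct)
  case (insert p A)
  then have "finsum R F (insert p A) = F p \<oplus>\<^bsub>R\<^esub> finsum R F A"
    using D_carrier[OF assms(1)] by (intro R.finsum_insert) auto
  then show ?case using D_add[OF assms(1)] insert by simp
qed (simp add: D_zero[OF assms(1)])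

context
  fixes N assumes N: "subgroup N G"
begin

lemma N_carrier: "g \<in> N \<Longrightarrow> g \<in> carrier G" using subgroup.mem_carrier[OF N] .

lemma CP_mem: "f \<in> carrier (CP N) \<Longrightarrow> g \<in> carrier G \<Longrightarrow> f g \<in> D g"
  unfolding CP_simps by (cases "g \<in> N") (auto simp: D_zero)

lemma CP_coeff: "f \<in> carrier (CP N) \<Longrightarrow> f g \<in> carrier R"
  unfolding CP_simps using D_carrier[OF N_carrier] by (cases "g \<in> N") auto

lemma CP_supp: "f \<in> carrier (CP N) \<Longrightarrow> supp R f \<subseteq> N"
  unfolding CP_simps supp_def by auto

lemma CP_finite: "f \<in> carrier (CP N) \<Longrightarrow> finite (supp R f)"
  unfolding CP_simps by auto

text \<open>A fixed finite rectangle containing the supports gives all products in a distributive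
  law the same index set.\<close>

lemma CP_mult_over:
  assumes f: "f \<in> carrier (CP N)" "supp R f \<subseteq> A" "finite A" "A \<subseteq> carrier G"
    and f': "f' \<in> carrier (CP N)" "supp R f' \<subseteq> B" "finite B" "B \<subseteq> carrier G"
  shows "(f \<otimes>\<^bsub>CP N\<^esub> f') k =
    (\<Oplus>\<^bsub>R\<^esub>p\<in>{p \<in> A \<times> B. fst p \<star> snd p = k}. hom_mult (fst p) (snd p) (f (fst p)) (f' (snd p)))"
  unfolding CP_mult
proof (rule R.add.finprod_mono_neutral_cong_left)
  show "finite {p \<in> A \<times> B. fst p \<star> snd p = k}" using f f' by simp
  show "{(g, h). g \<in> supp R f \<and> h \<in> supp R f' \<and> g \<star> h = k} \<subseteq> {p \<in> A \<times> B. fst p \<star> snd p = k}" using f f' by auto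
  show "hom_mult (fst p) (snd p) (f (fst p)) (f' (snd p)) = \<z>"
    if p: "p \<in> {p \<in> A \<times> B. fst p \<star> snd p = k} - {(g, h). g \<in> supp R f \<and> h \<in> supp R f' \<and> g \<star> h = k}" for p
  proof -
    have "f (fst p) = \<z> \<or> f' (snd p) = \<z>" using p unfolding supp_def by (cases p) auto
    moreover have "fst p \<in> carrier G" "snd p \<in> carrier G" using p f f' by auto
    ultimately show ?thesis using hom_mult_zero_left hom_mult_zero_right CP_coeff f(1) f'(1) by metis
  qed
  show "(\<lambda>p. hom_mult (fst p) (snd p) (f (fst p)) (f' (snd p))) \<in> {p \<in> A \<times> B. fst p \<star> snd p = k} \<rightarrow> carrier R"
    using f f' CP_coeff hom_mult_mem(3) by (intro Pi_I) (auto simp: subset_iff)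
qed simp

lemma CP_mult_supp:
  assumes "(f \<otimes>\<^bsub>CP N\<^esub> f') p \<noteq> \<z>"
  shows "\<exists>x y. f x \<noteq> \<z> \<and> f' y \<noteq> \<z> \<and> p = x \<star> y"
proof (rule ccontr)
  assume "\<not> ?thesis"
  then have e: "{(g, h). g \<in> supp R f \<and> h \<in> supp R f' \<and> g \<star> h = p} = {}" unfolding supp_def by auto
  have "(f \<otimes>\<^bsub>CP N\<^esub> f') p = \<z>" unfolding CP_mult e by simp
  then show False using assms by simp
qed

lemma CP_add_closed:
  assumes f: "f \<in> carrier (CP N)" and f': "f' \<in> carrier (CP N)" shows "f \<oplus>\<^bsub>CP N\<^esub> f' \<in> carrier (CP N)"
proof -
  have "supp R (\<lambda>k. f k \<oplus>\<^bsub>R\<^esub> f' k) \<subseteq> supp R f \<union> supp R f'" unfolding supp_def by auto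
  then have "finite (supp R (\<lambda>k. f k \<oplus>\<^bsub>R\<^esub> f' k))" using CP_finite f f' finite_subset by blast
  then show ?thesis using f f' N_carrier D_add unfolding CP_simps by auto
qed

lemma CP_minus_closed:
  assumes f: "f \<in> carrier (CP N)" shows "(\<lambda>k. \<ominus>\<^bsub>R\<^esub> f k) \<in> carrier (CP N)"
proof -
  have "\<ominus>\<^bsub>R\<^esub> \<z> = \<z>" using R.minus_equality[of \<z> \<z>] by simp
  moreover have "supp R (\<lambda>k. \<ominus>\<^bsub>R\<^esub> f k) \<subseteq> supp R f" unfolding supp_def using calculation by auto
  then have "finite (supp R (\<lambda>k. \<ominus>\<^bsub>R\<^esub> f k))" using CP_finite f finite_subset by blast
  ultimately show ?thesis using f N_carrier D_minus unfolding CP_simps by auto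
qed

lemma CP_mult_closed:
  assumes f: "f \<in> carrier (CP N)" and f': "f' \<in> carrier (CP N)" shows "f \<otimes>\<^bsub>CP N\<^esub> f' \<in> carrier (CP N)"
proof -
  let ?m = "f \<otimes>\<^bsub>CP N\<^esub> f'"
  note s = CP_supp[OF f] CP_supp[OF f'] and fin = CP_finite[OF f] CP_finite[OF f']
  have "supp R ?m \<subseteq> (\<lambda>(x, y). x \<star> y) ` (supp R f \<times> supp R f')"
  proof
    fix p assume "p \<in> supp R ?m"
    then obtain x y where "f x \<noteq> \<z>" "f' y \<noteq> \<z>" "p = x \<star> y" using CP_mult_supp unfolding supp_def by blast
    then show "p \<in> (\<lambda>(x, y). x \<star> y) ` (supp R f \<times> supp R f')" unfolding supp_def by auto
  qed
  then have "finite (supp R ?m)" using fin finite_subset by blast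
  moreover have "?m k \<in> D k" if k: "k \<in> N" for k
    unfolding CP_mult
  proof (rule finsum_D[OF N_carrier[OF k]])
    have "{(g, h). g \<in> supp R f \<and> h \<in> supp R f' \<and> g \<star> h = k} \<subseteq> supp R f \<times> supp R f'" by auto
    then show "finite {(g, h). g \<in> supp R f \<and> h \<in> supp R f' \<and> g \<star> h = k}" using fin finite_subset by blast
    fix p assume "p \<in> {(g, h). g \<in> supp R f \<and> h \<in> supp R f' \<and> g \<star> h = k}"
    then obtain g h where p: "p = (g, h)" "g \<in> supp R f" "h \<in> supp R f'" "g \<star> h = k" by blast
    then have "g \<in> carrier G" "h \<in> carrier G" using s N_carrier by auto
    then show "hom_mult (fst p) (snd p) (f (fst p)) (f' (snd p)) \<in> D k"
      using hom_mult_mem(2)[of g h "f g" "f' h"] CP_coeff f f' p by simp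
  qed
  moreover have "?m k = \<z>" if k: "k \<notin> N" for k
  proof (rule ccontr)
    assume "?m k \<noteq> \<z>"
    then obtain x y where "f x \<noteq> \<z>" "f' y \<noteq> \<z>" "k = x \<star> y" using CP_mult_supp by blast
    then show False using k s subgroup.m_closed[OF N] unfolding supp_def by auto
  qed
  ultimately show ?thesis unfolding CP_simps(1) by simp
qed

lemma CP_l_distr:
  assumes f: "f \<in> carrier (CP N)" and f': "f' \<in> carrier (CP N)" and k: "k \<in> carrier (CP N)"
  shows "(f \<oplus>\<^bsub>CP N\<^esub> f') \<otimes>\<^bsub>CP N\<^esub> k = f \<otimes>\<^bsub>CP N\<^esub> k \<oplus>\<^bsub>CP N\<^esub> f' \<otimes>\<^bsub>CP N\<^esub> k"
proof
  fix x
  define A where "A = supp R f \<union> supp R f'"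
  define B where "B = supp R k"
  have A: "finite A" "A \<subseteq> carrier G" "supp R f \<subseteq> A" "supp R f' \<subseteq> A"
    unfolding A_def using CP_finite f f' CP_supp N_carrier by blast+
  have sA: "supp R (f \<oplus>\<^bsub>CP N\<^esub> f') \<subseteq> A" unfolding A_def CP_simps supp_def by auto
  have B: "finite B" "B \<subseteq> carrier G" "supp R k \<subseteq> B" unfolding B_def using CP_finite[OF k] CP_supp[OF k] N_carrier by blast+
  let ?I = "{p \<in> A \<times> B. fst p \<star> snd p = x}"
  have cl: "(\<lambda>p. hom_mult (fst p) (snd p) (h (fst p)) (k (snd p))) \<in> ?I \<rightarrow> carrier R" if "h \<in> carrier (CP N)" for h
    using A B CP_coeff that k hom_mult_mem(3) by (intro Pi_I) (auto simp: subset_iff)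
  have "((f \<oplus>\<^bsub>CP N\<^esub> f') \<otimes>\<^bsub>CP N\<^esub> k) x = (\<Oplus>\<^bsub>R\<^esub>p\<in>?I. hom_mult (fst p) (snd p) ((f \<oplus>\<^bsub>CP N\<^esub> f') (fst p)) (k (snd p)))"
    by (rule CP_mult_over[OF CP_add_closed[OF f f'] sA A(1,2) k B(3,1,2)])
  also have "\<dots> = (\<Oplus>\<^bsub>R\<^esub>p\<in>?I. hom_mult (fst p) (snd p) (f (fst p)) (k (snd p)) \<oplus>\<^bsub>R\<^esub> hom_mult (fst p) (snd p) (f' (fst p)) (k (snd p)))"
  proof (rule R.finsum_cong')
    show "hom_mult (fst p) (snd p) ((f \<oplus>\<^bsub>CP N\<^esub> f') (fst p)) (k (snd p)) =
      hom_mult (fst p) (snd p) (f (fst p)) (k (snd p)) \<oplus>\<^bsub>R\<^esub> hom_mult (fst p) (snd p) (f' (fst p)) (k (snd p))" if "p \<in> ?I" for p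
      unfolding CP_simps(4) using that A B CP_coeff f f' k by (intro hom_mult_add_left) auto
  qed (use cl[OF f] cl[OF f'] in auto)
  also have "\<dots> = (\<Oplus>\<^bsub>R\<^esub>p\<in>?I. hom_mult (fst p) (snd p) (f (fst p)) (k (snd p))) \<oplus>\<^bsub>R\<^esub> (\<Oplus>\<^bsub>R\<^esub>p\<in>?I. hom_mult (fst p) (snd p) (f' (fst p)) (k (snd p)))"
    by (rule R.finsum_addf[OF cl[OF f] cl[OF f']])
  also have "\<dots> = (f \<otimes>\<^bsub>CP N\<^esub> k) x \<oplus>\<^bsub>R\<^esub> (f' \<otimes>\<^bsub>CP N\<^esub> k) x"
    using CP_mult_over[OF f A(3,1,2) k B(3,1,2)] CP_mult_over[OF f' A(4,1,2) k B(3,1,2)] by simp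
  finally show "((f \<oplus>\<^bsub>CP N\<^esub> f') \<otimes>\<^bsub>CP N\<^esub> k) x = (f \<otimes>\<^bsub>CP N\<^esub> k \<oplus>\<^bsub>CP N\<^esub> f' \<otimes>\<^bsub>CP N\<^esub> k) x"
    unfolding CP_simps(4) .
qed

lemma CP_r_distr:
  assumes f: "f \<in> carrier (CP N)" and f': "f' \<in> carrier (CP N)" and k: "k \<in> carrier (CP N)"
  shows "k \<otimes>\<^bsub>CP N\<^esub> (f \<oplus>\<^bsub>CP N\<^esub> f') = k \<otimes>\<^bsub>CP N\<^esub> f \<oplus>\<^bsub>CP N\<^esub> k \<otimes>\<^bsub>CP N\<^esub> f'"
proof
  fix x
  define A where "A = supp R f \<union> supp R f'"
  define B where "B = supp R k"
  have A: "finite A" "A \<subseteq> carrier G" "supp R f \<subseteq> A" "supp R f' \<subseteq> A"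
    unfolding A_def using CP_finite f f' CP_supp N_carrier by blast+
  have sA: "supp R (f \<oplus>\<^bsub>CP N\<^esub> f') \<subseteq> A" unfolding A_def CP_simps supp_def by auto
  have B: "finite B" "B \<subseteq> carrier G" "supp R k \<subseteq> B" unfolding B_def using CP_finite[OF k] CP_supp[OF k] N_carrier by blast+
  let ?I = "{p \<in> B \<times> A. fst p \<star> snd p = x}"
  have cl: "(\<lambda>p. hom_mult (fst p) (snd p) (k (fst p)) (h (snd p))) \<in> ?I \<rightarrow> carrier R" if "h \<in> carrier (CP N)" for h
    using A B CP_coeff that k hom_mult_mem(3) by (intro Pi_I) (auto simp: subset_iff)
  have "(k \<otimes>\<^bsub>CP N\<^esub> (f \<oplus>\<^bsub>CP N\<^esub> f')) x = (\<Oplus>\<^bsub>R\<^esub>p\<in>?I. hom_mult (fst p) (snd p) (k (fst p)) ((f \<oplus>\<^bsub>CP N\<^esub> f') (snd p)))"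
    by (rule CP_mult_over[OF k B(3,1,2) CP_add_closed[OF f f'] sA A(1,2)])
  also have "\<dots> = (\<Oplus>\<^bsub>R\<^esub>p\<in>?I. hom_mult (fst p) (snd p) (k (fst p)) (f (snd p)) \<oplus>\<^bsub>R\<^esub> hom_mult (fst p) (snd p) (k (fst p)) (f' (snd p)))"
  proof (rule R.finsum_cong')
    show "hom_mult (fst p) (snd p) (k (fst p)) ((f \<oplus>\<^bsub>CP N\<^esub> f') (snd p)) =
      hom_mult (fst p) (snd p) (k (fst p)) (f (snd p)) \<oplus>\<^bsub>R\<^esub> hom_mult (fst p) (snd p) (k (fst p)) (f' (snd p))" if "p \<in> ?I" for p
      unfolding CP_simps(4) using that A B CP_coeff f f' k by (intro hom_mult_add_right) auto
  qed (use cl[OF f] cl[OF f'] in auto)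
  also have "\<dots> = (\<Oplus>\<^bsub>R\<^esub>p\<in>?I. hom_mult (fst p) (snd p) (k (fst p)) (f (snd p))) \<oplus>\<^bsub>R\<^esub> (\<Oplus>\<^bsub>R\<^esub>p\<in>?I. hom_mult (fst p) (snd p) (k (fst p)) (f' (snd p)))"
    by (rule R.finsum_addf[OF cl[OF f] cl[OF f']])
  also have "\<dots> = (k \<otimes>\<^bsub>CP N\<^esub> f) x \<oplus>\<^bsub>R\<^esub> (k \<otimes>\<^bsub>CP N\<^esub> f') x"
    using CP_mult_over[OF k B(3,1,2) f A(3,1,2)] CP_mult_over[OF k B(3,1,2) f' A(4,1,2)] by simp
  finally show "(k \<otimes>\<^bsub>CP N\<^esub> (f \<oplus>\<^bsub>CP N\<^esub> f')) x = (k \<otimes>\<^bsub>CP N\<^esub> f \<oplus>\<^bsub>CP N\<^esub> k \<otimes>\<^bsub>CP N\<^esub> f') x"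
    unfolding CP_simps(4) .
qed

lemma delta_mem: "g \<in> N \<Longrightarrow> r \<in> D g \<Longrightarrow> delta R r g \<in> carrier (CP N)"
  unfolding CP_simps delta_def supp_def using D_zero N_carrier by auto

lemma delta_mult:
  assumes g: "g \<in> N" "a \<in> D g" and h: "h \<in> N" "b \<in> D h"
  shows "delta R a g \<otimes>\<^bsub>CP N\<^esub> delta R b h = delta R (hom_mult g h a b) (g \<star> h)"
proof
  fix k
  have G': "g \<in> carrier G" "h \<in> carrier G" using g h N_carrier by auto
  have c: "hom_mult g h a b \<in> carrier R" using hom_mult_mem(3) G' D_carrier g h by blast
  have "(delta R a g \<otimes>\<^bsub>CP N\<^esub> delta R b h) k =
    (\<Oplus>\<^bsub>R\<^esub>p\<in>{p \<in> {g} \<times> {h}. fst p \<star> snd p = k}. hom_mult (fst p) (snd p) (delta R a g (fst p)) (delta R b h (snd p)))"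
    by (rule CP_mult_over[OF delta_mem[OF g] _ _ _ delta_mem[OF h]]) (use G' in \<open>auto simp: supp_def delta_def\<close>)
  also have "\<dots> = delta R (hom_mult g h a b) (g \<star> h) k"
  proof (cases "g \<star> h = k")
    case True
    then have "{p \<in> {g} \<times> {h}. fst p \<star> snd p = k} = {(g, h)}" by auto
    then show ?thesis using True c by (simp add: delta_def)
  next
    case False
    then have e: "{p \<in> {g} \<times> {h}. fst p \<star> snd p = k} = {}" by auto
    show ?thesis unfolding e using False by (simp add: delta_def)
  qed
  finally show "(delta R a g \<otimes>\<^bsub>CP N\<^esub> delta R b h) k = delta R (hom_mult g h a b) (g \<star> h) k" .
qed

lemma CP_induct [consumes 1, case_names zero delta add]:
  assumes "f \<in> carrier (CP N)" and "P (\<lambda>_. \<z>)"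
    and "\<And>g r. g \<in> N \<Longrightarrow> r \<in> D g \<Longrightarrow> P (delta R r g)"
    and "\<And>f f'. f \<in> carrier (CP N) \<Longrightarrow> f' \<in> carrier (CP N) \<Longrightarrow> P f \<Longrightarrow> P f' \<Longrightarrow> P (f \<oplus>\<^bsub>CP N\<^esub> f')"
  shows "P f"
  using assms(1)
proof (induction "card (supp R f)" arbitrary: f rule: less_induct)
  case less
  show ?case
  proof (cases "supp R f = {}")
    case True
    then have "f = (\<lambda>_. \<z>)" unfolding supp_def by auto
    then show ?thesis using assms(2) by simp
  next
    case False
    then obtain x where x: "x \<in> supp R f" by blast
    define f' where "f' = (\<lambda>k. if k = x then \<z> else f k)"
    have xN: "x \<in> N" using CP_supp[OF less.prems] x by blast
    have sub: "supp R f' \<subseteq> supp R f - {x}" unfolding f'_def supp_def by auto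
    then have fin: "finite (supp R f')" using CP_finite[OF less.prems] finite_subset by blast
    have f': "f' \<in> carrier (CP N)" using less.prems fin xN D_zero N_carrier unfolding f'_def CP_simps by auto
    have "supp R f' \<subset> supp R f" using sub x by blast
    then have "P f'" using less.hyps[OF psubset_card_mono[OF CP_finite[OF less.prems]] f'] by simp
    moreover have d: "f x \<in> D x" using CP_mem[OF less.prems] N_carrier[OF xN] by simp
    moreover have "f = delta R (f x) x \<oplus>\<^bsub>CP N\<^esub> f'"
      unfolding CP_simps delta_def f'_def using CP_coeff[OF less.prems] by (intro ext) simp
    ultimately show ?thesis using assms(3)[OF xN d] assms(4)[OF delta_mem[OF xN d] f'] by simp
  qed
qed

lemma CP_zero_mult:
  assumes "f \<in> carrier (CP N)"
  shows "(\<lambda>_. \<z>) \<otimes>\<^bsub>CP N\<^esub> f = (\<lambda>_. \<z>)" "f \<otimes>\<^bsub>CP N\<^esub> (\<lambda>_. \<z>) = (\<lambda>_. \<z>)"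
  using CP_mult_supp[of "\<lambda>_. \<z>" f] CP_mult_supp[of f "\<lambda>_. \<z>"] by blast+

lemma CP_zero_mem: "(\<lambda>_. \<z>) \<in> carrier (CP N)"
  unfolding CP_simps supp_def using D_zero N_carrier by simp

lemma CP_assoc:
  assumes f: "f \<in> carrier (CP N)" and g: "g \<in> carrier (CP N)" and h: "h \<in> carrier (CP N)"
  shows "f \<otimes>\<^bsub>CP N\<^esub> g \<otimes>\<^bsub>CP N\<^esub> h = f \<otimes>\<^bsub>CP N\<^esub> (g \<otimes>\<^bsub>CP N\<^esub> h)"
  using f
proof (induction f rule: CP_induct)
  case zero
  then show ?case using CP_zero_mult g h CP_mult_closed by simp
next
  case (add f f')
  then show ?case using g h CP_mult_closed by (simp add: CP_l_distr)
next
  case (delta x a)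
  note xa = delta and dx = delta_mem[OF delta]
  show ?case using g
  proof (induction g rule: CP_induct)
    case zero
    then show ?case using CP_zero_mult dx h CP_mult_closed by simp
  next
    case (add f f')
    then show ?case using dx h CP_mult_closed by (simp add: CP_l_distr CP_r_distr)
  next
    case (delta y b)
    note yb = delta and dy = delta_mem[OF delta]
    show ?case using h
    proof (induction h rule: CP_induct)
      case zero
      then show ?case using CP_zero_mult dx dy CP_mult_closed by simp
    next
      case (add f f')
      then show ?case using dx dy CP_mult_closed by (simp add: CP_r_distr)
    next
      case (delta z c)
      have G': "x \<in> carrier G" "y \<in> carrier G" "z \<in> carrier G" using xa yb delta N_carrier by auto
      have c: "a \<in> carrier R" "b \<in> carrier R" "c \<in> carrier R" using D_carrier G' xa yb delta by auto
      have m: "x \<star> y \<in> N" "y \<star> z \<in> N" using subgroup.m_closed[OF N] xa yb delta by auto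
      have "hom_mult (x \<star> y) z (hom_mult x y a b) c = hom_mult x (y \<star> z) a (hom_mult y z b c)"
        by (rule hom_mult_assoc[OF G' c(1) yb(2) c(3)])
      moreover have "x \<star> y \<star> z = x \<star> (y \<star> z)" using G' by (simp add: G.m_assoc)
      ultimately show ?case
        using delta_mult[OF xa yb] delta_mult[OF yb delta] delta_mult[OF m(1) hom_mult_mem(2)[OF G'(1,2) c(1,2)] delta]
          delta_mult[OF xa m(2) hom_mult_mem(2)[OF G'(2,3) c(2,3)]] by simp
    qed
  qed
qed

lemma one_mem: "delta R \<one>\<^bsub>R\<^esub> \<e> \<in> carrier (CP N)"
  using delta_mem[OF subgroup.one_closed[OF N]] UP1(1) by simp

lemma CP_one:
  assumes "f \<in> carrier (CP N)"
  shows "delta R \<one>\<^bsub>R\<^esub> \<e> \<otimes>\<^bsub>CP N\<^esub> f = f" "f \<otimes>\<^bsub>CP N\<^esub> delta R \<one>\<^bsub>R\<^esub> \<e> = f"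
proof -
  have "delta R \<one>\<^bsub>R\<^esub> \<e> \<otimes>\<^bsub>CP N\<^esub> f = f \<and> f \<otimes>\<^bsub>CP N\<^esub> delta R \<one>\<^bsub>R\<^esub> \<e> = f"
    using assms
  proof (induction f rule: CP_induct)
    case zero
    then show ?case using CP_zero_mult one_mem by simp
  next
    case (delta g r)
    have eN: "\<e> \<in> N" "\<one>\<^bsub>R\<^esub> \<in> D \<e>" using subgroup.one_closed[OF N] UP1(1) by auto
    have gG: "g \<in> carrier G" using N_carrier delta by simp
    have rc: "r \<in> carrier R" using D_carrier gG delta by blast
    have "hom_mult g \<e> r \<one>\<^bsub>R\<^esub> = r" using hom_mult_one_right[OF gG rc, of "\<one>\<^bsub>R\<^esub>"] u_carrier gG alpha_u u_right delta by simp
    moreover have "hom_mult \<e> g \<one>\<^bsub>R\<^esub> r = r" using hom_mult_one_left[OF gG _ delta(2), of "\<one>\<^bsub>R\<^esub>"] rc by simp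
    ultimately show ?case using delta_mult[OF eN delta] delta_mult[OF delta eN] gG by simp
  next
    case (add f f')
    then show ?case using one_mem CP_l_distr CP_r_distr by simp
  qed
  then show "delta R \<one>\<^bsub>R\<^esub> \<e> \<otimes>\<^bsub>CP N\<^esub> f = f" "f \<otimes>\<^bsub>CP N\<^esub> delta R \<one>\<^bsub>R\<^esub> \<e> = f" by auto
qed

lemma CP_ring: "ring (CP N)"
proof (rule ringI)
  show "abelian_group (CP N)"
  proof (rule abelian_groupI)
    show "x \<oplus>\<^bsub>CP N\<^esub> y \<in> carrier (CP N)" if "x \<in> carrier (CP N)" "y \<in> carrier (CP N)" for x y
      using CP_add_closed that .
    show "\<zero>\<^bsub>CP N\<^esub> \<in> carrier (CP N)" using CP_zero_mem unfolding CP_simps(3) .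
    show "x \<oplus>\<^bsub>CP N\<^esub> y \<oplus>\<^bsub>CP N\<^esub> z = x \<oplus>\<^bsub>CP N\<^esub> (y \<oplus>\<^bsub>CP N\<^esub> z)"
      if "x \<in> carrier (CP N)" "y \<in> carrier (CP N)" "z \<in> carrier (CP N)" for x y z
      unfolding CP_simps(4) using that CP_coeff by (intro ext) (simp add: R.a_assoc)
    show "x \<oplus>\<^bsub>CP N\<^esub> y = y \<oplus>\<^bsub>CP N\<^esub> x" if "x \<in> carrier (CP N)" "y \<in> carrier (CP N)" for x y
      unfolding CP_simps(4) using that CP_coeff by (intro ext) (simp add: R.a_comm)
    show "\<zero>\<^bsub>CP N\<^esub> \<oplus>\<^bsub>CP N\<^esub> x = x" if "x \<in> carrier (CP N)" for x
      unfolding CP_simps(3,4) using that CP_coeff by (intro ext) simp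
    show "\<exists>y\<in>carrier (CP N). y \<oplus>\<^bsub>CP N\<^esub> x = \<zero>\<^bsub>CP N\<^esub>" if "x \<in> carrier (CP N)" for x
      by (rule bexI[OF _ CP_minus_closed[OF that]])
        (unfold CP_simps(3,4), use that CP_coeff in \<open>intro ext, simp add: R.l_neg\<close>)
  qed
  show "monoid (CP N)"
    by (rule monoidI) (use CP_mult_closed CP_assoc CP_one one_mem CP_simps(2) in auto)
qed (use CP_l_distr CP_r_distr in auto)

end

lemma homog_is_delta:
  assumes "f \<in> carrier (CP (carrier G))" "supp R f \<subseteq> {g}" shows "f = delta R (f g) g"
  using assms(2) unfolding delta_def supp_def by (intro ext) auto

text \<open>The local units are \<open>u c\<close> in degree \<open>c\<close> and
  \<open>vv c\<close> in degree \<open>\<iota> c\<close>. Their products are the idempotents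
  \<open>u c\<close> and \<open>u (\<iota> c)\<close> in degree \<open>\<e>\<close>, which act as
  left and right identity on the component of degree \<open>c\<close>.\<close>

lemma CP_graded: "graded (CP (carrier G)) G R"
proof -
  note carrier_subgroup = G.subgroup_self
  interpret S: ring "CP (carrier G)" by (rule CP_ring[OF carrier_subgroup])
  show ?thesis
  proof unfold_locales
    fix f x
    assume f: "f \<in> carrier (CP (carrier G))"
    show "f x \<in> carrier R" using CP_coeff[OF carrier_subgroup f] .
    show "finite (supp R f)" using CP_finite[OF carrier_subgroup f] .
    show "x \<in> carrier G" if "f x \<noteq> \<z>" using CP_supp[OF carrier_subgroup f] that unfolding supp_def by blast
    fix E
    have "supp R (\<lambda>x. if x \<in> E then f x else \<z>) \<subseteq> supp R f" unfolding supp_def by auto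
    then have "finite (supp R (\<lambda>x. if x \<in> E then f x else \<z>))" using CP_finite[OF carrier_subgroup f] finite_subset by blast
    then show "(\<lambda>x. if x \<in> E then f x else \<z>) \<in> carrier (CP (carrier G))"
      using f D_zero unfolding CP_simps by auto
  next
    show "\<zero>\<^bsub>CP (carrier G)\<^esub> = (\<lambda>_. \<z>)" by (rule CP_simps(3))
    fix f g show "f \<oplus>\<^bsub>CP (carrier G)\<^esub> g = (\<lambda>x. f x \<oplus>\<^bsub>R\<^esub> g x)" by (rule CP_simps(4))
  next
    fix x assume "\<one>\<^bsub>CP (carrier G)\<^esub> x \<noteq> \<z>"
    then show "x = \<e>" unfolding CP_simps delta_def by (auto split: if_splits)
  next
    fix f g p assume "(f \<otimes>\<^bsub>CP (carrier G)\<^esub> g) p \<noteq> \<z>"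
    then show "\<exists>x y. f x \<noteq> \<z> \<and> g y \<noteq> \<z> \<and> p = x \<star> y" by (rule CP_mult_supp[OF carrier_subgroup])
  next
    fix c assume c: "c \<in> carrier G"
    have ci: "\<iota> c \<in> carrier G" using c by simp
    define s t where "s = delta R (u c) c" and "t = delta R (vv c) (\<iota> c)"
    have s: "s \<in> carrier (CP (carrier G))" "supp R s \<subseteq> {c}"
      unfolding s_def using delta_mem[OF carrier_subgroup c u_mem[OF c]] by (auto simp: supp_def delta_def)
    have t: "t \<in> carrier (CP (carrier G))" "supp R t \<subseteq> {\<iota> c}"
      unfolding t_def using delta_mem[OF carrier_subgroup ci vv_mem[OF c]] by (auto simp: supp_def delta_def)
    have st: "s \<otimes>\<^bsub>CP (carrier G)\<^esub> t = delta R (u c) \<e>"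
      unfolding s_def t_def using delta_mult[OF carrier_subgroup c u_mem[OF c] ci vv_mem[OF c]] hom_mult_vv[OF c u_mem[OF c]] c by simp
    have ts: "t \<otimes>\<^bsub>CP (carrier G)\<^esub> s = delta R (u (\<iota> c)) \<e>"
      unfolding s_def t_def using delta_mult[OF carrier_subgroup ci vv_mem[OF c] c u_mem[OF c]] hom_mult_vv_u[OF c] c by simp
    have "s \<otimes>\<^bsub>CP (carrier G)\<^esub> (t \<otimes>\<^bsub>CP (carrier G)\<^esub> f) = f \<and> f \<otimes>\<^bsub>CP (carrier G)\<^esub> t \<otimes>\<^bsub>CP (carrier G)\<^esub> s = f"
      if f: "f \<in> carrier (CP (carrier G))" "supp R f \<subseteq> {c}" for f
    proof -
      have fd: "f = delta R (f c) c" by (rule homog_is_delta[OF f])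
      have fc: "f c \<in> D c" using CP_mem[OF carrier_subgroup f(1) c] .
      have fcR: "f c \<in> carrier R" using D_carrier[OF c fc] .
      have uD: "u c \<in> D \<e>" "u (\<iota> c) \<in> D \<e>" unfolding UP1(1) using u_carrier c by auto
      have "s \<otimes>\<^bsub>CP (carrier G)\<^esub> (t \<otimes>\<^bsub>CP (carrier G)\<^esub> f) = delta R (u c) \<e> \<otimes>\<^bsub>CP (carrier G)\<^esub> delta R (f c) c"
        using st s t f fd by (simp add: S.m_assoc[symmetric])
      also have "\<dots> = f" using delta_mult[OF carrier_subgroup G.one_closed uD(1) c fc] hom_mult_one_left[OF c u_carrier[OF c] fc]
          u_left[OF c fc] c fd by simp
      finally have 1: "s \<otimes>\<^bsub>CP (carrier G)\<^esub> (t \<otimes>\<^bsub>CP (carrier G)\<^esub> f) = f" .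
      have "f \<otimes>\<^bsub>CP (carrier G)\<^esub> t \<otimes>\<^bsub>CP (carrier G)\<^esub> s = delta R (f c) c \<otimes>\<^bsub>CP (carrier G)\<^esub> delta R (u (\<iota> c)) \<e>"
        using ts s t f fd by (simp add: S.m_assoc)
      also have "\<dots> = f" using delta_mult[OF carrier_subgroup c fc G.one_closed uD(2)] hom_mult_one_right[OF c fcR u_carrier[OF ci]]
          u_right[OF ci u_mem[OF ci]] alpha_u[OF c] u_right[OF c fc] c fd by simp
      finally show ?thesis using 1 by simp
    qed
    then show "\<exists>s\<in>carrier (CP (carrier G)). \<exists>t\<in>carrier (CP (carrier G)). supp R s \<subseteq> {c} \<and> supp R t \<subseteq> {\<iota> c} \<and>
        (\<forall>f\<in>carrier (CP (carrier G)). supp R f \<subseteq> {c} \<longrightarrow>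
          s \<otimes>\<^bsub>CP (carrier G)\<^esub> (t \<otimes>\<^bsub>CP (carrier G)\<^esub> f) = f \<and> f \<otimes>\<^bsub>CP (carrier G)\<^esub> t \<otimes>\<^bsub>CP (carrier G)\<^esub> s = f)"
      using s t by blast
  qed
qed

end

section \<open>Primeness\<close>

context ring begin

text \<open>\<open>ideal_prod\<close> consists of nonempty sums, so it contains \<zero> only if both
  factors are inhabited; \<open>a\<close> and \<open>b\<close> witness this.\<close>

lemma ideal_prod_zero:
  assumes "a \<in> A" "b \<in> B" and z: "\<And>a b. a \<in> A \<Longrightarrow> b \<in> B \<Longrightarrow> a \<otimes> b = \<zero>"
  shows "A \<cdot> B = {\<zero>}"
proof
  show "A \<cdot> B \<subseteq> {\<zero>}"
  proof
    fix x assume "x \<in> A \<cdot> B"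
    then show "x \<in> {\<zero>}" by (induction rule: ideal_prod.induct) (use z in auto)
  qed
  show "{\<zero>} \<subseteq> A \<cdot> B" using ideal_prod.prod[OF assms(1,2), of R] z[OF assms(1,2)] by simp
qed

lemma ideal_prod_zeroD: "A \<cdot> B = {\<zero>} \<Longrightarrow> a \<in> A \<Longrightarrow> b \<in> B \<Longrightarrow> a \<otimes> b = \<zero>"
  using ideal_prod.prod[of a A b B R] by simp

lemma ideal_of_closed:
  assumes "A \<subseteq> carrier R" "\<zero> \<in> A" "\<And>a b. a \<in> A \<Longrightarrow> b \<in> A \<Longrightarrow> a \<oplus> b \<in> A"
    and l: "\<And>a x. a \<in> A \<Longrightarrow> x \<in> carrier R \<Longrightarrow> x \<otimes> a \<in> A"
    and r: "\<And>a x. a \<in> A \<Longrightarrow> x \<in> carrier R \<Longrightarrow> a \<otimes> x \<in> A"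
  shows "ideal A R"
proof (rule idealI)
  show "subgroup A (add_monoid R)"
  proof (rule add.subgroupI)
    fix a assume a: "a \<in> A"
    then have "(\<ominus> \<one>) \<otimes> a \<in> A" by (intro l) auto
    then show "\<ominus> a \<in> A" using a assms(1) by (simp add: l_minus subset_iff)
  qed (use assms in auto)
qed (use ring_axioms l r in auto)

end

context graded begin

lemma gen_mult_closed:
  assumes separating: "separating H j" and a: "a \<in> gen H j" and x: "x \<in> carrier S" "supp R x \<subseteq> H"
  shows "x \<otimes> a \<in> gen H j" "a \<otimes> x \<in> gen H j"
proof -
  have ac: "a \<in> carrier S" by (rule gen_carrier[OF separating a])
  have *: "cut H x \<otimes> a \<in> gen H j \<and> a \<otimes> cut H x \<in> gen H j"
    using x(1)
  proof (induction x rule: carrier_induct)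
    case zero
    have "cut H \<zero> = \<zero>" by (auto simp: cut_def zero_fun)
    then show ?case using ac gen.gen_zero by simp
  next
    case (homog y s)
    show ?case
    proof (cases "y \<in> H")
      case True
      then have "cut H s = s" using homog homogD by (intro cut_id) auto
      then show ?thesis using gen_left[OF separating a homog(2) True] gen_right[OF separating a homog(2) True] by simp
    next
      case False
      have "cut H s = \<zero>" unfolding cut_def zero_fun using False homogD[OF homog(2)] by (intro ext) metis
      then show ?thesis using ac gen.gen_zero by simp
    qed
  next
    case (add f g)
    then show ?case using ac gen.gen_add by (simp add: cut_add S.l_distr S.r_distr)
  qed
  have "cut H x = x" by (rule cut_id[OF x(1)]) (use x(2) in_supp in blast)
  then show "x \<otimes> a \<in> gen H j" "a \<otimes> x \<in> gen H j" using * by auto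
qed

lemma ann_add:
  assumes "a \<in> carrier S" "a' \<in> carrier S" "b \<in> carrier S" "b' \<in> carrier S"
  shows "ann H a b \<Longrightarrow> ann H a' b \<Longrightarrow> ann H (a \<oplus> a') b" "ann H a b \<Longrightarrow> ann H a b' \<Longrightarrow> ann H a (b \<oplus> b')"
  unfolding ann_def using assms by (simp_all add: S.l_distr S.r_distr homog_carrier)

lemma ann_zero: "a \<in> carrier S \<Longrightarrow> ann H a \<zero>" "a \<in> carrier S \<Longrightarrow> ann H \<zero> a"
  unfolding ann_def by (simp_all add: homog_carrier)

lemma cut_insert:
  assumes "f \<in> carrier S" "x \<notin> E" shows "cut (insert x E) f = cut {x} f \<oplus> cut E f"
proof
  fix y
  show "cut (insert x E) f y = (cut {x} f \<oplus> cut E f) y"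
    unfolding add_apply[OF cut_closed[OF assms(1)] cut_closed[OF assms(1)]]
    using assms(2) coeff[OF assms(1)] by (simp add: cut_apply)
qed

lemma ann_mult_zero:
  assumes a: "a \<in> carrier S" and b: "b \<in> carrier S" and ann: "ann (carrier G) a b" and s: "s \<in> carrier S"
  shows "a \<otimes> s \<otimes> b = \<zero>"
  using s
proof (induction s rule: carrier_induct)
  case zero
  then show ?case using a b by simp
next
  case (homog x s)
  then show ?case using ann by (simp add: ann_def)
next
  case (add f g)
  then show ?case using a b by (simp add: S.l_distr S.r_distr)
qed

end

section \<open>Annihilating pairs and ideals of the crossed product\<close>

context unital_twisted_partial_action begin

abbreviation "S \<equiv> CP (carrier G)"

no_notation gm' (infixl "\<star>" 70) and gi' ("\<iota>") and ge' ("\<e>") and rz' ("\<z>")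

interpretation C: graded S G R by (rule CP_graded)

lemma carrier_subgroup: "subgroup (carrier G) G" by (rule G.subgroup_self)

lemma CP_sub: "subgroup N G \<Longrightarrow> carrier (CP N) = {f \<in> carrier S. supp R f \<subseteq> N}"
proof -
  assume N: "subgroup N G"
  have "f \<in> carrier S \<and> supp R f \<subseteq> N" if f: "f \<in> carrier (CP N)" for f
    using f CP_supp[OF N f] CP_mem[OF N f] CP_supp[OF N f] N_carrier[OF N] unfolding CP_simps supp_def by blast
  moreover have "f \<in> carrier (CP N)" if "f \<in> carrier S" "supp R f \<subseteq> N" for f
    using that N_carrier[OF N] unfolding CP_simps supp_def by blast
  ultimately show ?thesis by blast
qed

lemma CP_ops: "f \<otimes>\<^bsub>CP N\<^esub> f' = f \<otimes>\<^bsub>S\<^esub> f'" "f \<oplus>\<^bsub>CP N\<^esub> f' = f \<oplus>\<^bsub>S\<^esub> f'" "\<zero>\<^bsub>CP N\<^esub> = \<zero>\<^bsub>S\<^esub>"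
  by (simp_all add: crossed_product_def)

lemma delta_homog: "g \<in> carrier G \<Longrightarrow> r \<in> D g \<Longrightarrow> delta R r g \<in> C.homog g"
  using delta_mem[OF carrier_subgroup] unfolding C.homog_def supp_def delta_def by auto

lemma homog_delta: "s \<in> C.homog g \<Longrightarrow> s = delta R (s g) g"
  unfolding C.homog_def by (intro homog_is_delta) auto

lemma delta_e_homog: "r \<in> carrier R \<Longrightarrow> delta R r \<e> \<in> C.homog \<e>"
  using delta_homog[of \<e>] UP1(1) by simp

lemma delta_inj: "delta R r g = delta R r' g \<Longrightarrow> r = r'"
  unfolding delta_def by metis

lemma delta_zero: "delta R \<z> g = \<zero>\<^bsub>S\<^esub>" unfolding delta_def CP_simps by auto

lemma delta_e_mult:
  "g \<in> carrier G \<Longrightarrow> r \<in> carrier R \<Longrightarrow> a \<in> D g \<Longrightarrow> delta R r \<e> \<otimes>\<^bsub>S\<^esub> delta R a g = delta R (r \<bullet> a) g"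
  using delta_mult[OF carrier_subgroup G.one_closed _ _ , of r g a] UP1(1) hom_mult_one_left by simp

lemma delta_mult_e:
  assumes "g \<in> carrier G" "a \<in> D g" "r \<in> carrier R"
  shows "delta R a g \<otimes>\<^bsub>S\<^esub> delta R r \<e> = delta R (a \<bullet> \<alpha> g (r \<bullet> u (\<iota> g))) g"
  using delta_mult[OF carrier_subgroup assms(1,2) G.one_closed, of r] assms UP1(1) hom_mult_one_right[OF assms(1) D_carrier[OF assms(1,2)] assms(3)] by simp

abbreviation us where "us g \<equiv> delta R (u g) g"
abbreviation vs where "vs g \<equiv> delta R (vv g) (\<iota> g)"

lemma us_homog: "g \<in> carrier G \<Longrightarrow> us g \<in> C.homog g" by (rule delta_homog[OF _ u_mem])
lemma vs_homog: "g \<in> carrier G \<Longrightarrow> vs g \<in> C.homog (\<iota> g)" using delta_homog[of "\<iota> g"] vv_mem by simp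

text \<open>With \<open>vs g\<close> in place of an inverse, conjugation by \<open>us g\<close>
  implements \<open>\<alpha> g\<close> in degree \<open>\<e>\<close>. This links invariance of
  ideals under \<alpha> to closure under homogeneous multiplication.\<close>

lemma us_conj:
  assumes g: "g \<in> carrier G" and i: "i \<in> D (\<iota> g)"
  shows "us g \<otimes>\<^bsub>S\<^esub> delta R i \<e> \<otimes>\<^bsub>S\<^esub> vs g = delta R (\<alpha> g i) \<e>"
proof -
  have gi: "\<iota> g \<in> carrier G" using g by simp
  have ic: "i \<in> carrier R" by (rule D_carrier[OF gi i])
  have \<alpha>i: "\<alpha> g i \<in> D g" by (rule alpha_mem[OF g i])
  have "us g \<otimes>\<^bsub>S\<^esub> delta R i \<e> = delta R (\<alpha> g i) g"
    using delta_mult_e[OF g u_mem[OF g] ic] u_right[OF gi i] u_left[OF g \<alpha>i] by simp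
  then show ?thesis using delta_mult[OF carrier_subgroup g \<alpha>i gi vv_mem[OF g]] hom_mult_vv[OF g \<alpha>i] g by simp
qed

lemma delta_vs:
  assumes g: "g \<in> carrier G" and i: "i \<in> D g" shows "delta R i g \<otimes>\<^bsub>S\<^esub> vs g = delta R i \<e>"
  using delta_mult[OF carrier_subgroup g i _ vv_mem[OF g]] hom_mult_vv[OF g i] g by simp

lemma vs_us:
  assumes g: "g \<in> carrier G" shows "vs g \<otimes>\<^bsub>S\<^esub> us g = delta R (u (\<iota> g)) \<e>"
  using delta_mult[OF carrier_subgroup _ vv_mem[OF g] g u_mem[OF g]] hom_mult_vv_u[OF g] g by simp

lemma vs_conj:
  assumes g: "g \<in> carrier G" and r: "r \<in> D (\<iota> g)"
  shows "vs g \<otimes>\<^bsub>S\<^esub> delta R (\<alpha> g r) \<e> \<otimes>\<^bsub>S\<^esub> us g = delta R r \<e>"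
proof -
  have gi: "\<iota> g \<in> carrier G" using g by simp
  have rc: "r \<in> carrier R" and uc: "u (\<iota> g) \<in> carrier R" using D_carrier[OF gi r] u_carrier[OF gi] by auto
  have c: "us g \<in> carrier S" "vs g \<in> carrier S" "delta R r \<e> \<in> carrier S"
    using us_homog[OF g] vs_homog[OF g] delta_e_homog[OF rc] by auto
  have "vs g \<otimes>\<^bsub>S\<^esub> delta R (\<alpha> g r) \<e> \<otimes>\<^bsub>S\<^esub> us g = (vs g \<otimes>\<^bsub>S\<^esub> us g) \<otimes>\<^bsub>S\<^esub> delta R r \<e> \<otimes>\<^bsub>S\<^esub> (vs g \<otimes>\<^bsub>S\<^esub> us g)"
    unfolding us_conj[OF g r, symmetric] using c by (simp add: C.S.m_assoc)
  also have "\<dots> = delta R (u (\<iota> g) \<bullet> r \<bullet> u (\<iota> g)) \<e>"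
    unfolding vs_us[OF g] using delta_e_mult[OF G.one_closed] UP1(1) rc uc by simp
  finally show ?thesis using u_left[OF gi r] u_right[OF gi r] by simp
qed

definition nonprime_data :: bool where
  "nonprime_data \<longleftrightarrow> (\<exists>N H I A B.
      subgroup H G \<and> N \<lhd> (G\<lparr>carrier := H\<rparr>) \<and> finite N \<and>
      ideal I R \<and>
      (\<forall>h\<in>H. \<alpha> h ` (I \<cdot>\<^bsub>R\<^esub> {u (inv\<^bsub>G\<^esub> h)}) = I \<cdot>\<^bsub>R\<^esub> {u h}) \<and>
      (\<forall>g\<in>carrier G - H. I \<cdot>\<^bsub>R\<^esub> (\<alpha> g ` (I \<cdot>\<^bsub>R\<^esub> {u (inv\<^bsub>G\<^esub> g)})) = {\<zero>\<^bsub>R\<^esub>}) \<and>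
      ideal A (CP N) \<and> A \<noteq> {\<zero>\<^bsub>CP N\<^esub>} \<and>
      ideal B (CP N) \<and> B \<noteq> {\<zero>\<^bsub>CP N\<^esub>} \<and>
      A \<subseteq> (\<lambda>r. delta R r \<one>\<^bsub>G\<^esub>) ` I \<cdot>\<^bsub>CP N\<^esub> carrier (CP N) \<and>
      B \<subseteq> (\<lambda>r. delta R r \<one>\<^bsub>G\<^esub>) ` I \<cdot>\<^bsub>CP N\<^esub> carrier (CP N) \<and>
      (\<forall>h\<in>H. A \<cdot>\<^bsub>S\<^esub> {delta R (u h) h} \<cdot>\<^bsub>S\<^esub> B = {\<zero>\<^bsub>S\<^esub>}))"

lemma finite_annihilating_pair_nonprime_data:
  assumes finite_annihilating_pair: "C.finite_annihilating_pair" shows nonprime_data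
proof -
  obtain N H j a b where separating: "C.separating H j" and N: "subgroup N G" "N \<subseteq> H" "finite N"
    and Nc: "\<And>h n. h \<in> H \<Longrightarrow> n \<in> N \<Longrightarrow> C.cj h n \<in> N"
    and ab: "a \<in> C.gen H j" "b \<in> C.gen H j" "a \<noteq> \<zero>\<^bsub>S\<^esub>" "b \<noteq> \<zero>\<^bsub>S\<^esub>" "supp R a \<subseteq> N" "supp R b \<subseteq> N" and ann: "C.ann H a b"
    using finite_annihilating_pair unfolding C.finite_annihilating_pair_def by blast
  note H = C.H_sub[OF separating] and gc = C.gen_carrier[OF separating]
  note HG = G.sub_mem[OF H]
  have ac: "a \<in> carrier S" and bc: "b \<in> carrier S" using gc ab by auto
  have "N \<lhd> (G\<lparr>carrier := H\<rparr>)"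
  proof -
    interpret GH: group "G\<lparr>carrier := H\<rparr>" by (rule G.subgroup_imp_group[OF H])
    show ?thesis unfolding GH.normal_inv_iff
      using G.subgroup_incl[OF N(1) H N(2)] Nc G.m_inv_consistent[OF H] by (auto simp: G.conj_by_def)
  qed
  \<comment> \<open>The degree \<open>\<e>\<close> part of \<open>gen H j\<close>. Conjugation by
    \<open>us h\<close> preserves it for \<open>h\<close> in \<open>H\<close>, and
    \<open>gen_kill\<close> gives the vanishing against its translates outside
    \<open>H\<close>.\<close>
  define I where "I = {r \<in> carrier R. delta R r \<e> \<in> C.gen H j}"
  have IR: "ideal I R"
  proof (rule R.ideal_of_closed)
    show "I \<subseteq> carrier R" unfolding I_def by blast
    show "\<z> \<in> I" unfolding I_def using C.gen.gen_zero[of H j] by (simp add: delta_zero)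
    show "r \<oplus>\<^bsub>R\<^esub> r' \<in> I" if "r \<in> I" "r' \<in> I" for r r'
    proof -
      have "delta R (r \<oplus>\<^bsub>R\<^esub> r') \<e> = delta R r \<e> \<oplus>\<^bsub>S\<^esub> delta R r' \<e>" unfolding CP_simps delta_def by auto
      then show ?thesis using that C.gen.gen_add unfolding I_def by simp
    qed
    fix r x assume r: "r \<in> I" "x \<in> carrier R"
    then have rc: "r \<in> carrier R" "delta R r \<e> \<in> C.gen H j" unfolding I_def by auto
    have "delta R (x \<bullet> r) \<e> = delta R x \<e> \<otimes>\<^bsub>S\<^esub> delta R r \<e>" "delta R (r \<bullet> x) \<e> = delta R r \<e> \<otimes>\<^bsub>S\<^esub> delta R x \<e>"
      using delta_e_mult[OF G.one_closed] rc r UP1(1) by auto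
    then show "x \<bullet> r \<in> I" "r \<bullet> x \<in> I"
      using C.gen_left[OF separating rc(2) delta_e_homog[OF r(2)] G.sub_one[OF H]]
        C.gen_right[OF separating rc(2) delta_e_homog[OF r(2)] G.sub_one[OF H]] rc r unfolding I_def by auto
  qed
  have inv: "\<alpha> h ` (I \<cdot>\<^bsub>R\<^esub> {u (\<iota> h)}) = I \<cdot>\<^bsub>R\<^esub> {u h}" if h: "h \<in> H" for h
  proof -
    have hG: "h \<in> carrier G" and hi: "\<iota> h \<in> carrier G" and hiH: "\<iota> h \<in> H" using HG h G.sub_inv[OF H] by auto
    have "\<alpha> h ` (I \<inter> D (\<iota> h)) = I \<inter> D h"
    proof
      show "\<alpha> h ` (I \<inter> D (\<iota> h)) \<subseteq> I \<inter> D h"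
      proof
        fix x assume "x \<in> \<alpha> h ` (I \<inter> D (\<iota> h))"
        then obtain i where i: "i \<in> I" "i \<in> D (\<iota> h)" "x = \<alpha> h i" by blast
        have "us h \<otimes>\<^bsub>S\<^esub> delta R i \<e> \<otimes>\<^bsub>S\<^esub> vs h \<in> C.gen H j"
          using i by (intro C.gen_right[OF separating C.gen_left[OF separating _ us_homog[OF hG] h] vs_homog[OF hG] hiH]) (simp add: I_def)
        then show "x \<in> I \<inter> D h" using us_conj[OF hG i(2)] alpha_mem[OF hG i(2)] D_carrier[OF hG] i unfolding I_def by simp
      qed
      show "I \<inter> D h \<subseteq> \<alpha> h ` (I \<inter> D (\<iota> h))"
      proof
        fix x assume x: "x \<in> I \<inter> D h"
        then obtain r where r: "r \<in> D (\<iota> h)" "x = \<alpha> h r" using alpha_bij[OF hG] unfolding bij_betw_def by blast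
        have "vs h \<otimes>\<^bsub>S\<^esub> delta R x \<e> \<otimes>\<^bsub>S\<^esub> us h \<in> C.gen H j"
          using x by (intro C.gen_right[OF separating C.gen_left[OF separating _ vs_homog[OF hG] hiH] us_homog[OF hG] h]) (simp add: I_def)
        then have "r \<in> I" using vs_conj[OF hG r(1)] r D_carrier[OF hi r(1)] unfolding I_def by simp
        then show "x \<in> \<alpha> h ` (I \<inter> D (\<iota> h))" using r by blast
      qed
    qed
    then show ?thesis using ideal_prod_u[OF IR hG] ideal_prod_u[OF IR hi] by simp
  qed
  have out: "I \<cdot>\<^bsub>R\<^esub> (\<alpha> g ` (I \<cdot>\<^bsub>R\<^esub> {u (\<iota> g)})) = {\<z>}" if g: "g \<in> carrier G - H" for g
  proof -
    have gG: "g \<in> carrier G" and gi: "\<iota> g \<in> carrier G" using g by auto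
    have zI: "\<z> \<in> I" using additive_subgroup.zero_closed[OF ideal.axioms(1)[OF IR]] .
    show ?thesis unfolding ideal_prod_u[OF IR gi]
    proof (rule R.ideal_prod_zero)
      show "\<z> \<in> I" by fact
      show "\<alpha> g \<z> \<in> \<alpha> g ` (I \<inter> D (\<iota> g))" using zI D_zero[OF gi] by blast
      fix i y assume i: "i \<in> I" and "y \<in> \<alpha> g ` (I \<inter> D (\<iota> g))"
      then obtain i' where i': "i' \<in> I" "i' \<in> D (\<iota> g)" "y = \<alpha> g i'" by blast
      have ic: "i \<in> carrier R" "delta R i \<e> \<in> C.gen H j" "i' \<in> carrier R" "delta R i' \<e> \<in> C.gen H j"
        using i i' unfolding I_def by auto
      have y: "y \<in> carrier R" "y \<in> D \<e>" unfolding i'(3) UP1(1) using D_carrier[OF gG alpha_mem[OF gG i'(2)]] by auto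
      have c: "us g \<in> carrier S" "vs g \<in> carrier S" "delta R i \<e> \<in> carrier S" "delta R i' \<e> \<in> carrier S"
        using us_homog[OF gG] vs_homog[OF gG] gc ic by auto
      have "delta R (i \<bullet> y) \<e> = delta R i \<e> \<otimes>\<^bsub>S\<^esub> (us g \<otimes>\<^bsub>S\<^esub> delta R i' \<e> \<otimes>\<^bsub>S\<^esub> vs g)"
        unfolding us_conj[OF gG i'(2)] i'(3)[symmetric] using delta_e_mult[OF G.one_closed ic(1) y(2)] by simp
      also have "\<dots> = delta R i \<e> \<otimes>\<^bsub>S\<^esub> us g \<otimes>\<^bsub>S\<^esub> delta R i' \<e> \<otimes>\<^bsub>S\<^esub> vs g" using c by (simp add: C.S.m_assoc)
      also have "\<dots> = \<zero>\<^bsub>S\<^esub>" using C.gen_kill[OF separating ic(2,4) gG _ us_homog[OF gG]] g c by simp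
      finally have "delta R (i \<bullet> y) \<e> = delta R \<z> \<e>" by (simp add: delta_zero)
      then show "i \<bullet> y = \<z>" by (rule delta_inj)
    qed
  qed
  have RN: "ring (CP N)" by (rule CP_ring[OF N(1)])
  interpret SN: ring "CP N" by (rule RN)
  note CN = CP_sub[OF N(1)] and SO = CP_ops[where N = N]
  \<comment> \<open>\<open>A\<close> is the annihilator of \<open>b\<close>, and \<open>B\<close>
    that of \<open>A\<close>, both within \<open>gen H j\<close> and the crossed product with
    \<open>N\<close>. They are ideals of the latter since all of its degrees lie in
    \<open>H\<close>.\<close>
  define A where "A = {x \<in> carrier (CP N). x \<in> C.gen H j \<and> C.ann H x b}"
  define B where "B = {x \<in> carrier (CP N). x \<in> C.gen H j \<and> (\<forall>a'\<in>A. C.ann H a' x)}"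
  have AS: "x \<in> carrier S" if "x \<in> A" for x using that unfolding A_def CN by simp
  have BS: "x \<in> carrier S" if "x \<in> B" for x using that unfolding B_def CN by simp
  have NH: "supp R x \<subseteq> H" "x \<in> carrier S" if "x \<in> carrier (CP N)" for x using that N(2) unfolding CN by auto
  have sH: "y \<in> H" if "x \<in> carrier (CP N)" "x y \<noteq> \<z>" for x y using NH(1)[OF that(1)] that(2) unfolding supp_def by blast
  have idA: "ideal A (CP N)"
  proof (rule SN.ideal_of_closed)
    show "A \<subseteq> carrier (CP N)" unfolding A_def by blast
    show "\<zero>\<^bsub>CP N\<^esub> \<in> A" unfolding A_def using C.gen.gen_zero[of H j] C.ann_zero bc SN.zero_closed unfolding SO(3) by simp
    show "x \<oplus>\<^bsub>CP N\<^esub> y \<in> A" if "x \<in> A" "y \<in> A" for x y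
      using that SN.a_closed[of x y] C.gen.gen_add[of x H j y] C.ann_add(1)[of x y b b H] AS bc unfolding A_def SO(2) by blast
    fix x y assume x: "x \<in> A" and y: "y \<in> carrier (CP N)"
    then have x': "x \<in> carrier (CP N)" "x \<in> C.gen H j" "C.ann H x b" unfolding A_def by auto
    show "y \<otimes>\<^bsub>CP N\<^esub> x \<in> A" unfolding A_def
      using SN.m_closed[OF y x'(1)] C.gen_mult_closed(1)[OF separating x'(2) NH(2,1)[OF y]] C.ann_left[OF x'(3) AS[OF x] bc NH(2)[OF y]]
      unfolding SO(1) by simp
    show "x \<otimes>\<^bsub>CP N\<^esub> y \<in> A" unfolding A_def
      using SN.m_closed[OF x'(1) y] C.gen_mult_closed(2)[OF separating x'(2) NH(2,1)[OF y]]
        C.ann_mid(2)[OF H x'(3) AS[OF x] bc NH(2)[OF y] sH[OF y]]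
      unfolding SO(1) by simp
  qed
  have idB: "ideal B (CP N)"
  proof (rule SN.ideal_of_closed)
    show "B \<subseteq> carrier (CP N)" unfolding B_def by blast
    show "\<zero>\<^bsub>CP N\<^esub> \<in> B" unfolding B_def using C.gen.gen_zero[of H j] C.ann_zero AS SN.zero_closed unfolding SO(3) by simp
    show "x \<oplus>\<^bsub>CP N\<^esub> y \<in> B" if "x \<in> B" "y \<in> B" for x y
      using that SN.a_closed[of x y] C.gen.gen_add[of x H j y] C.ann_add(2)[OF _ bc, of _ x y H] AS BS unfolding B_def SO(2) by blast
    fix x y assume x: "x \<in> B" and y: "y \<in> carrier (CP N)"
    then have x': "x \<in> carrier (CP N)" "x \<in> C.gen H j" "\<And>a'. a' \<in> A \<Longrightarrow> C.ann H a' x" unfolding B_def by auto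
    show "y \<otimes>\<^bsub>CP N\<^esub> x \<in> B" unfolding B_def
      using SN.m_closed[OF y x'(1)] C.gen_mult_closed(1)[OF separating x'(2) NH(2,1)[OF y]]
        C.ann_mid(1)[OF H x'(3) AS BS[OF x] NH(2)[OF y] sH[OF y]]
      unfolding SO(1) by simp
    show "x \<otimes>\<^bsub>CP N\<^esub> y \<in> B" unfolding B_def
      using SN.m_closed[OF x'(1) y] C.gen_mult_closed(2)[OF separating x'(2) NH(2,1)[OF y]]
        C.ann_right[OF x'(3) AS BS[OF x] NH(2)[OF y]]
      unfolding SO(1) by simp
  qed
  have aA: "a \<in> A" unfolding A_def CN using ab ac ann by simp
  have bB: "b \<in> B" unfolding B_def CN using ab bc unfolding A_def by simp
  \<comment> \<open>The component of \<open>x\<close> at \<open>y\<close> is \<open>x y\<close> in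
    degree \<open>\<e>\<close> times \<open>us y\<close>. Multiplication by \<open>vs y\<close>
    brings it to degree \<open>\<e>\<close> within \<open>gen H j\<close>, so \<open>x y\<close>
    lies in \<open>I\<close>.\<close>
  have sub: "x \<in> (\<lambda>r. delta R r \<e>) ` I \<cdot>\<^bsub>CP N\<^esub> carrier (CP N)" if x: "x \<in> carrier (CP N)" "x \<in> C.gen H j" for x
  proof -
    let ?P = "(\<lambda>r. delta R r \<e>) ` I \<cdot>\<^bsub>CP N\<^esub> carrier (CP N)"
    have xc: "x \<in> carrier S" using NH(2)[OF x(1)] .
    have "C.cut E x \<in> ?P" if "finite E" "E \<subseteq> N" for E
      using that
    proof (induction E rule: finite_induct)
      case empty
      have zI: "\<z> \<in> I" using additive_subgroup.zero_closed[OF ideal.axioms(1)[OF IR]] .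
      have "delta R \<z> \<e> \<otimes>\<^bsub>CP N\<^esub> \<zero>\<^bsub>CP N\<^esub> \<in> ?P" by (rule ideal_prod.prod) (use zI in auto)
      moreover have "delta R \<z> \<e> \<otimes>\<^bsub>CP N\<^esub> \<zero>\<^bsub>CP N\<^esub> = C.cut {} x"
        unfolding delta_zero SO C.S.l_null[OF C.S.zero_closed] by (simp add: C.cut_def C.zero_fun)
      ultimately show ?case by simp
    next
      case (insert y E)
      have yN: "y \<in> N" and yH: "y \<in> H" and yG: "y \<in> carrier G" using insert.prems N(2) HG by auto
      have xy: "x y \<in> D y" using CP_mem[OF carrier_subgroup xc yG] .
      have xyR: "x y \<in> carrier R" by (rule D_carrier[OF yG xy])
      have e: "C.cut {y} x = delta R (x y) y" unfolding C.cut_def delta_def by auto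
      have "C.cut {y} x \<otimes>\<^bsub>S\<^esub> vs y \<in> C.gen H j"
        by (rule C.gen_right[OF separating C.gen_cut[OF separating x(2)] vs_homog[OF yG] G.sub_inv[OF H yH]])
      then have "x y \<in> I" unfolding I_def e using delta_vs[OF yG xy] xyR by simp
      then have "delta R (x y) \<e> \<otimes>\<^bsub>CP N\<^esub> us y \<in> ?P" by (intro ideal_prod.prod imageI delta_mem[OF N(1) yN u_mem[OF yG]])
      moreover have "delta R (x y) \<e> \<otimes>\<^bsub>CP N\<^esub> us y = C.cut {y} x"
        unfolding e SO using delta_e_mult[OF yG xyR u_mem[OF yG]] u_right[OF yG xy] by simp
      ultimately have "C.cut {y} x \<oplus>\<^bsub>CP N\<^esub> C.cut E x \<in> ?P" using insert by (intro ideal_prod.sum) auto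
      then show ?case unfolding SO C.cut_insert[OF xc insert.hyps(2)] .
    qed
    from this[OF CP_finite[OF N(1) x(1)] CP_supp[OF N(1) x(1)]] have "C.cut (supp R x) x \<in> ?P" .
    moreover have "C.cut (supp R x) x = x" by (rule C.cut_id[OF xc]) (simp add: C.in_supp)
    ultimately show ?thesis by simp
  qed
  have ABzero: "A \<cdot>\<^bsub>S\<^esub> {us h} \<cdot>\<^bsub>S\<^esub> B = {\<zero>\<^bsub>S\<^esub>}" if h: "h \<in> H" for h
  proof (rule C.S.ideal_prod_zero)
    have hs: "us h \<in> carrier S" "us h \<in> C.homog h" using us_homog[OF HG[OF h]] by auto
    show "a \<otimes>\<^bsub>S\<^esub> us h \<in> A \<cdot>\<^bsub>S\<^esub> {us h}" by (rule ideal_prod.prod) (use aA in auto)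
    show "b \<in> B" by fact
    fix y x assume y: "y \<in> A \<cdot>\<^bsub>S\<^esub> {us h}" and x: "x \<in> B"
    have "y \<in> carrier S \<and> y \<otimes>\<^bsub>S\<^esub> x = \<zero>\<^bsub>S\<^esub>"
      using y
    proof (induction rule: ideal_prod.induct)
      case (prod i k)
      then have "k = us h" "C.ann H i x" using x unfolding B_def by auto
      then show ?case using C.annD[OF _ h hs(2)] AS[OF prod(1)] hs by simp
    next
      case (sum s1 s2)
      then show ?case using BS[OF x] by (simp add: C.S.l_distr)
    qed
    then show "y \<otimes>\<^bsub>S\<^esub> x = \<zero>\<^bsub>S\<^esub>" by simp
  qed
  have "A \<noteq> {\<zero>\<^bsub>CP N\<^esub>}" "B \<noteq> {\<zero>\<^bsub>CP N\<^esub>}" unfolding SO(3) using aA bB ab by auto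
  moreover have "A \<subseteq> (\<lambda>r. delta R r \<e>) ` I \<cdot>\<^bsub>CP N\<^esub> carrier (CP N)" using sub unfolding A_def by blast
  moreover have "B \<subseteq> (\<lambda>r. delta R r \<e>) ` I \<cdot>\<^bsub>CP N\<^esub> carrier (CP N)" using sub unfolding B_def by blast
  moreover have "\<forall>h\<in>H. \<alpha> h ` (I \<cdot>\<^bsub>R\<^esub> {u (\<iota> h)}) = I \<cdot>\<^bsub>R\<^esub> {u h}" using inv by (rule ballI)
  moreover have "\<forall>g\<in>carrier G - H. I \<cdot>\<^bsub>R\<^esub> (\<alpha> g ` (I \<cdot>\<^bsub>R\<^esub> {u (\<iota> g)})) = {\<z>}" using out by (rule ballI)
  moreover have "\<forall>h\<in>H. A \<cdot>\<^bsub>S\<^esub> {us h} \<cdot>\<^bsub>S\<^esub> B = {\<zero>\<^bsub>S\<^esub>}" using ABzero by (rule ballI)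
  ultimately show ?thesis unfolding nonprime_data_def
    using H \<open>N \<lhd> (G\<lparr>carrier := H\<rparr>)\<close> N(3) IR idA idB
    by (intro exI[of _ N] exI[of _ H] exI[of _ I] exI[of _ A] exI[of _ B] conjI)
qed

text \<open>In degrees in \<open>H\<close> the two ideals annihilate each other by
  \<open>AB\<close>. In other degrees both contribute a factor from \<open>I\<close>, and everything
  of such a degree between two of these factors vanishes by \<open>out\<close>.\<close>

lemma not_prime_from_ideals:
  assumes H: "subgroup H G" and NH: "N \<lhd> (G\<lparr>carrier := H\<rparr>)" and I: "ideal I R"
    and out: "\<And>g. g \<in> carrier G - H \<Longrightarrow> I \<cdot>\<^bsub>R\<^esub> (\<alpha> g ` (I \<cdot>\<^bsub>R\<^esub> {u (\<iota> g)})) = {\<z>}"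
    and A: "ideal A (CP N)" "A \<noteq> {\<zero>\<^bsub>CP N\<^esub>}" and B: "ideal B (CP N)" "B \<noteq> {\<zero>\<^bsub>CP N\<^esub>}"
    and AI: "A \<subseteq> (\<lambda>r. delta R r \<e>) ` I \<cdot>\<^bsub>CP N\<^esub> carrier (CP N)"
    and BI: "B \<subseteq> (\<lambda>r. delta R r \<e>) ` I \<cdot>\<^bsub>CP N\<^esub> carrier (CP N)"
    and AB: "\<And>h. h \<in> H \<Longrightarrow> A \<cdot>\<^bsub>S\<^esub> {us h} \<cdot>\<^bsub>S\<^esub> B = {\<zero>\<^bsub>S\<^esub>}"
  shows "\<not> prime_ring S"
proof
  assume prime: "prime_ring S"
  note HG = G.sub_mem[OF H]
  have NsH: "subgroup N (G\<lparr>carrier := H\<rparr>)" using NH by (rule normal_imp_subgroup)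
  have N: "subgroup N G" by (rule G.incl_subgroup[OF H NsH])
  have NsubH: "N \<subseteq> H" using subgroup.subset[OF NsH] by simp
  note CN = CP_sub[OF N] and SO = CP_ops[where N = N]
  have AS: "a \<in> carrier S" "a \<in> carrier (CP N)" if "a \<in> A" for a using ideal.Icarr[OF A(1) that] unfolding CN by auto
  have BS: "b \<in> carrier S" "b \<in> carrier (CP N)" if "b \<in> B" for b using ideal.Icarr[OF B(1) that] unfolding CN by auto
  have Ic: "i \<in> carrier R" if "i \<in> I" for i using ideal.Icarr[OF I that] .
  have dI: "delta R i \<e> \<in> carrier S" if "i \<in> I" for i using delta_e_homog[OF Ic[OF that]] by blast
  have kill: "delta R i \<e> \<otimes>\<^bsub>S\<^esub> c \<otimes>\<^bsub>S\<^esub> delta R i' \<e> = \<zero>\<^bsub>S\<^esub>"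
    if i: "i \<in> I" "i' \<in> I" and y: "y \<in> carrier G" "y \<notin> H" and c: "c \<in> C.homog y" for i i' y c
  proof -
    have cc: "c \<in> carrier S" using c by auto
    have cy: "c y \<in> D y" using CP_mem[OF carrier_subgroup cc y(1)] .
    have icy: "i \<bullet> c y \<in> D y" by (rule D_l[OF y(1) cy Ic[OF i(1)]])
    have "delta R i \<e> \<otimes>\<^bsub>S\<^esub> c = delta R (i \<bullet> c y) y"
      using delta_e_mult[OF y(1) Ic[OF i(1)] cy] homog_delta[OF c] by simp
    then have "delta R i \<e> \<otimes>\<^bsub>S\<^esub> c \<otimes>\<^bsub>S\<^esub> delta R i' \<e> = delta R ((i \<bullet> c y) \<bullet> \<alpha> y (i' \<bullet> u (\<iota> y))) y"
      using delta_mult_e[OF y(1) icy Ic[OF i(2)]] by simp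
    also have "(i \<bullet> c y) \<bullet> \<alpha> y (i' \<bullet> u (\<iota> y)) = \<z>"
    proof (rule R.ideal_prod_zeroD[OF out])
      show "y \<in> carrier G - H" using y by simp
      show "i \<bullet> c y \<in> I" by (rule ideal.I_r_closed[OF I i(1) D_carrier[OF y(1) cy]])
      show "\<alpha> y (i' \<bullet> u (\<iota> y)) \<in> \<alpha> y ` (I \<cdot>\<^bsub>R\<^esub> {u (\<iota> y)})"
        by (intro imageI ideal_prod.prod i(2)) simp
    qed
    finally show ?thesis by (simp add: delta_zero)
  qed
  \<comment> \<open>In products from \<open>A\<close>, a factor \<open>n\<close> from the crossed
    product with \<open>N\<close> follows the one from \<open>I\<close>. As \<open>N\<close> lies in
    \<open>H\<close>, it moves degrees outside \<open>H\<close> only to degrees outside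
    \<open>H\<close>.\<close>
  have kill2: "delta R i \<e> \<otimes>\<^bsub>S\<^esub> n \<otimes>\<^bsub>S\<^esub> s \<otimes>\<^bsub>S\<^esub> delta R i' \<e> = \<zero>\<^bsub>S\<^esub>"
    if i: "i \<in> I" "i' \<in> I" and n: "n \<in> carrier (CP N)" and x: "x \<in> carrier G" "x \<notin> H" "s \<in> C.homog x" for i i' n x s
    using n
  proof (induction n rule: CP_induct[OF N, consumes 1, case_names zero delta add])
    case zero
    have "(\<lambda>_. \<z>) = \<zero>\<^bsub>S\<^esub>" unfolding CP_simps ..
    then show ?case using dI i x by (simp add: C.homog_carrier)
  next
    case (delta g r)
    have gG: "g \<in> carrier G" and gH: "g \<in> H" using delta NsubH HG by auto
    have d: "delta R r g \<in> C.homog g" by (rule delta_homog[OF gG delta(2)])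
    have "g \<star> x \<notin> H"
    proof
      assume "g \<star> x \<in> H"
      then have "\<iota> g \<star> (g \<star> x) \<in> H" using G.sub_mult[OF H] G.sub_inv[OF H gH] by blast
      then show False using x gG by (simp add: G.group_word)
    qed
    then have "delta R i \<e> \<otimes>\<^bsub>S\<^esub> (delta R r g \<otimes>\<^bsub>S\<^esub> s) \<otimes>\<^bsub>S\<^esub> delta R i' \<e> = \<zero>\<^bsub>S\<^esub>"
      using kill[OF i _ _ C.homog_mult[OF d x(3)]] gG x by simp
    then show ?case using dI i d x by (simp add: C.S.m_assoc C.homog_carrier)
  next
    case (add f f')
    then have "f \<in> carrier S" "f' \<in> carrier S" unfolding CN by auto
    then show ?case using add dI i x unfolding SO by (simp add: C.S.l_distr C.S.r_distr C.homog_carrier)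
  qed
  have ASB: "a \<otimes>\<^bsub>S\<^esub> s \<otimes>\<^bsub>S\<^esub> b = \<zero>\<^bsub>S\<^esub>" if a: "a \<in> A" and b: "b \<in> B" and x: "x \<in> carrier G" "s \<in> C.homog x" for a b x s
  proof (cases "x \<in> H")
    case True
    have sx: "s x \<in> D x" using CP_mem[OF carrier_subgroup _ x(1)] x(2) by blast
    have sxR: "s x \<in> carrier R" by (rule D_carrier[OF x(1) sx])
    \<comment> \<open>\<open>AB\<close> speaks of \<open>us x\<close> only. The coefficient of
      \<open>s\<close> is split off and absorbed by \<open>A\<close>, an ideal of a ring containing
      \<open>R\<close>.\<close>
    have sd: "s = delta R (s x) \<e> \<otimes>\<^bsub>S\<^esub> us x"
      using delta_e_mult[OF x(1) sxR u_mem[OF x(1)]] u_right[OF x(1) sx] homog_delta[OF x(2)] by simp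
    have dN: "delta R (s x) \<e> \<in> carrier (CP N)" using delta_mem[OF N subgroup.one_closed[OF N]] sxR UP1(1) by simp
    have "a \<otimes>\<^bsub>S\<^esub> delta R (s x) \<e> \<in> A" using ideal.I_r_closed[OF A(1) a dN] unfolding SO .
    then have "a \<otimes>\<^bsub>S\<^esub> delta R (s x) \<e> \<otimes>\<^bsub>S\<^esub> us x \<in> A \<cdot>\<^bsub>S\<^esub> {us x}" by (intro ideal_prod.prod) auto
    then have "a \<otimes>\<^bsub>S\<^esub> delta R (s x) \<e> \<otimes>\<^bsub>S\<^esub> us x \<otimes>\<^bsub>S\<^esub> b = \<zero>\<^bsub>S\<^esub>" by (rule C.S.ideal_prod_zeroD[OF AB[OF True] _ b])
    moreover have "a \<otimes>\<^bsub>S\<^esub> s = a \<otimes>\<^bsub>S\<^esub> delta R (s x) \<e> \<otimes>\<^bsub>S\<^esub> us x"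
      using sd AS[OF a] dN us_homog[OF x(1)] unfolding CN by (simp add: C.S.m_assoc C.homog_carrier)
    ultimately show ?thesis by simp
  next
    case False
    have sc: "s \<in> carrier S" using x by auto
    have inner: "delta R i \<e> \<otimes>\<^bsub>S\<^esub> n \<otimes>\<^bsub>S\<^esub> s \<otimes>\<^bsub>S\<^esub> b' = \<zero>\<^bsub>S\<^esub> \<and> b' \<in> carrier S"
      if i: "i \<in> I" and n: "n \<in> carrier (CP N)" and b': "b' \<in> (\<lambda>r. delta R r \<e>) ` I \<cdot>\<^bsub>CP N\<^esub> carrier (CP N)" for i n b'
      using b'
    proof (induction rule: ideal_prod.induct)
      case (prod d n')
      then obtain i' where i': "i' \<in> I" "d = delta R i' \<e>" by blast
      have c: "n \<in> carrier S" "n' \<in> carrier S" using n prod unfolding CN by auto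
      have "delta R i \<e> \<otimes>\<^bsub>S\<^esub> n \<otimes>\<^bsub>S\<^esub> s \<otimes>\<^bsub>S\<^esub> (delta R i' \<e> \<otimes>\<^bsub>S\<^esub> n') = delta R i \<e> \<otimes>\<^bsub>S\<^esub> n \<otimes>\<^bsub>S\<^esub> s \<otimes>\<^bsub>S\<^esub> delta R i' \<e> \<otimes>\<^bsub>S\<^esub> n'"
        using dI i i' c sc by (simp add: C.S.m_assoc)
      also have "\<dots> = \<zero>\<^bsub>S\<^esub>" using kill2[OF i i'(1) n x(1) False x(2)] c by simp
      finally show ?case unfolding SO i'(2) using dI[OF i'(1)] c by simp
    next
      case (sum s1 s2)
      have c: "n \<in> carrier S" using n unfolding CN by auto
      show ?case using sum dI[OF i] c sc unfolding SO by (simp add: C.S.r_distr)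
    qed
    have "a' \<otimes>\<^bsub>S\<^esub> s \<otimes>\<^bsub>S\<^esub> b = \<zero>\<^bsub>S\<^esub> \<and> a' \<in> carrier S"
      if a': "a' \<in> (\<lambda>r. delta R r \<e>) ` I \<cdot>\<^bsub>CP N\<^esub> carrier (CP N)" for a'
      using a'
    proof (induction rule: ideal_prod.induct)
      case (prod d n)
      then obtain i where i: "i \<in> I" "d = delta R i \<e>" by blast
      have c: "n \<in> carrier S" using prod unfolding CN by auto
      show ?case unfolding SO i(2) using inner[OF i(1) prod(2), of b] BI b dI[OF i(1)] c by blast
    next
      case (sum s1 s2)
      then show ?case using sc BS[OF b] unfolding SO by (simp add: C.S.l_distr)
    qed
    then show ?thesis using a AI by blast
  qed
  have ASB': "a \<otimes>\<^bsub>S\<^esub> s \<otimes>\<^bsub>S\<^esub> b = \<zero>\<^bsub>S\<^esub>" if "a \<in> A" "b \<in> B" "s \<in> carrier S" for a b s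
    by (rule C.ann_mult_zero) (use that ASB AS BS in \<open>auto simp: C.ann_def\<close>)
  \<comment> \<open>\<open>A\<close> and \<open>B\<close> are ideals of the crossed product with
    \<open>N\<close> only. The left annihilator of all \<open>s \<otimes> b\<close> and the right
    annihilator of that annihilator are ideals of the whole ring containing \<open>A\<close> and
    \<open>B\<close>, with product zero.\<close>
  define A' where "A' = {a \<in> carrier S. \<forall>b\<in>B. \<forall>s\<in>carrier S. a \<otimes>\<^bsub>S\<^esub> s \<otimes>\<^bsub>S\<^esub> b = \<zero>\<^bsub>S\<^esub>}"
  define B' where "B' = {b \<in> carrier S. \<forall>a\<in>A'. a \<otimes>\<^bsub>S\<^esub> b = \<zero>\<^bsub>S\<^esub>}"
  have A': "ideal A' S"
  proof (rule C.S.ideal_of_closed)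
    show "A' \<subseteq> carrier S" unfolding A'_def by blast
    show "\<zero>\<^bsub>S\<^esub> \<in> A'" unfolding A'_def using BS by simp
    show "x \<oplus>\<^bsub>S\<^esub> y \<in> A'" if "x \<in> A'" "y \<in> A'" for x y using that BS unfolding A'_def by (simp add: C.S.l_distr)
    fix x y assume x: "x \<in> A'" and y: "y \<in> carrier S"
    have xc: "x \<in> carrier S" using x unfolding A'_def by blast
    have "y \<otimes>\<^bsub>S\<^esub> x \<otimes>\<^bsub>S\<^esub> s \<otimes>\<^bsub>S\<^esub> b = \<zero>\<^bsub>S\<^esub>" if b: "b \<in> B" "s \<in> carrier S" for b s
    proof -
      have "y \<otimes>\<^bsub>S\<^esub> x \<otimes>\<^bsub>S\<^esub> s \<otimes>\<^bsub>S\<^esub> b = y \<otimes>\<^bsub>S\<^esub> (x \<otimes>\<^bsub>S\<^esub> s \<otimes>\<^bsub>S\<^esub> b)" using xc y b BS by (simp add: C.S.m_assoc)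
      then show ?thesis using x y b unfolding A'_def by simp
    qed
    then show "y \<otimes>\<^bsub>S\<^esub> x \<in> A'" unfolding A'_def using xc y by simp
    have "x \<otimes>\<^bsub>S\<^esub> y \<otimes>\<^bsub>S\<^esub> s \<otimes>\<^bsub>S\<^esub> b = \<zero>\<^bsub>S\<^esub>" if b: "b \<in> B" "s \<in> carrier S" for b s
    proof -
      have "x \<otimes>\<^bsub>S\<^esub> y \<otimes>\<^bsub>S\<^esub> s = x \<otimes>\<^bsub>S\<^esub> (y \<otimes>\<^bsub>S\<^esub> s)" using xc y b by (simp add: C.S.m_assoc)
      then show ?thesis using x y b unfolding A'_def by simp
    qed
    then show "x \<otimes>\<^bsub>S\<^esub> y \<in> A'" unfolding A'_def using xc y by simp
  qed
  have A'c: "a \<in> carrier S" if "a \<in> A'" for a using that unfolding A'_def by blast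
  have B': "ideal B' S"
  proof (rule C.S.ideal_of_closed)
    show "B' \<subseteq> carrier S" unfolding B'_def by blast
    show "\<zero>\<^bsub>S\<^esub> \<in> B'" unfolding B'_def using A'c by simp
    show "x \<oplus>\<^bsub>S\<^esub> y \<in> B'" if "x \<in> B'" "y \<in> B'" for x y using that A'c unfolding B'_def by (simp add: C.S.r_distr)
    fix x y assume x: "x \<in> B'" and y: "y \<in> carrier S"
    have xc: "x \<in> carrier S" using x unfolding B'_def by blast
    have "a \<otimes>\<^bsub>S\<^esub> (y \<otimes>\<^bsub>S\<^esub> x) = \<zero>\<^bsub>S\<^esub>" if a: "a \<in> A'" for a
    proof -
      have "a \<otimes>\<^bsub>S\<^esub> (y \<otimes>\<^bsub>S\<^esub> x) = a \<otimes>\<^bsub>S\<^esub> y \<otimes>\<^bsub>S\<^esub> x" using xc y A'c[OF a] by (simp add: C.S.m_assoc)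
      then show ?thesis using x ideal.I_r_closed[OF A' a y] unfolding B'_def by simp
    qed
    then show "y \<otimes>\<^bsub>S\<^esub> x \<in> B'" unfolding B'_def using xc y by simp
    have "a \<otimes>\<^bsub>S\<^esub> (x \<otimes>\<^bsub>S\<^esub> y) = \<zero>\<^bsub>S\<^esub>" if a: "a \<in> A'" for a
    proof -
      have "a \<otimes>\<^bsub>S\<^esub> (x \<otimes>\<^bsub>S\<^esub> y) = a \<otimes>\<^bsub>S\<^esub> x \<otimes>\<^bsub>S\<^esub> y" using xc y A'c[OF a] by (simp add: C.S.m_assoc)
      then show ?thesis using x a y unfolding B'_def by simp
    qed
    then show "x \<otimes>\<^bsub>S\<^esub> y \<in> B'" unfolding B'_def using xc y by simp
  qed
  have "A \<subseteq> A'" unfolding A'_def using AS ASB' by blast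
  moreover obtain a where "a \<in> A" "a \<noteq> \<zero>\<^bsub>S\<^esub>"
    using A additive_subgroup.zero_closed[OF ideal.axioms(1)[OF A(1)]] unfolding SO(3) by blast
  ultimately have "A' \<noteq> {\<zero>\<^bsub>S\<^esub>}" by blast
  have "B \<subseteq> B'"
  proof
    fix b assume b: "b \<in> B"
    have "a \<otimes>\<^bsub>S\<^esub> b = \<zero>\<^bsub>S\<^esub>" if a: "a \<in> A'" for a
    proof -
      have "a \<otimes>\<^bsub>S\<^esub> \<one>\<^bsub>S\<^esub> \<otimes>\<^bsub>S\<^esub> b = \<zero>\<^bsub>S\<^esub>" using a b unfolding A'_def by blast
      then show ?thesis using A'c[OF a] by simp
    qed
    then show "b \<in> B'" unfolding B'_def using BS[OF b] by simp
  qed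
  moreover obtain b where "b \<in> B" "b \<noteq> \<zero>\<^bsub>S\<^esub>"
    using B additive_subgroup.zero_closed[OF ideal.axioms(1)[OF B(1)]] unfolding SO(3) by blast
  ultimately have "B' \<noteq> {\<zero>\<^bsub>S\<^esub>}" by blast
  have "A' \<cdot>\<^bsub>S\<^esub> B' = {\<zero>\<^bsub>S\<^esub>}"
    by (rule C.S.ideal_prod_zero[OF additive_subgroup.zero_closed[OF ideal.axioms(1)[OF A']]
          additive_subgroup.zero_closed[OF ideal.axioms(1)[OF B']]]) (simp add: B'_def)
  then show False using prime A' B' \<open>A' \<noteq> {\<zero>\<^bsub>S\<^esub>}\<close> \<open>B' \<noteq> {\<zero>\<^bsub>S\<^esub>}\<close> unfolding prime_ring_def by blast
qed

lemma nonprime_data_not_prime: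
  assumes nonprime_data shows "\<not> prime_ring S"
proof -
  obtain N H I A B where *: "subgroup H G" "N \<lhd> (G\<lparr>carrier := H\<rparr>)" "ideal I R"
    "\<forall>g\<in>carrier G - H. I \<cdot>\<^bsub>R\<^esub> (\<alpha> g ` (I \<cdot>\<^bsub>R\<^esub> {u (\<iota> g)})) = {\<z>}"
    "ideal A (CP N)" "A \<noteq> {\<zero>\<^bsub>CP N\<^esub>}" "ideal B (CP N)" "B \<noteq> {\<zero>\<^bsub>CP N\<^esub>}"
    "A \<subseteq> (\<lambda>r. delta R r \<e>) ` I \<cdot>\<^bsub>CP N\<^esub> carrier (CP N)" "B \<subseteq> (\<lambda>r. delta R r \<e>) ` I \<cdot>\<^bsub>CP N\<^esub> carrier (CP N)"
    "\<forall>h\<in>H. A \<cdot>\<^bsub>S\<^esub> {us h} \<cdot>\<^bsub>S\<^esub> B = {\<zero>\<^bsub>S\<^esub>}"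
    using assms unfolding nonprime_data_def
    apply (elim exE conjE)
    subgoal premises p for N H I A B
      by (rule p(1)[of H N I A B, OF p(2,3,5,7,8,9,10,11,12,13,14)])
    done
  show ?thesis
    by (rule not_prime_from_ideals[of H N I A B])
      (use * in blast)+
qed

text \<open>\<open>one_neq_zero\<close> excludes the zero ring, so failure of primeness yields two
  nonzero ideals with product zero. Nonzero elements of them annihilate each other through all
  degrees.\<close>

lemma not_prime_nonprime_data:
  assumes np: "\<not> prime_ring S" shows nonprime_data
proof -
  have "\<one>\<^bsub>S\<^esub> \<noteq> \<zero>\<^bsub>S\<^esub>"
  proof
    assume "\<one>\<^bsub>S\<^esub> = \<zero>\<^bsub>S\<^esub>"
    then have "\<one>\<^bsub>S\<^esub> \<e> = \<zero>\<^bsub>S\<^esub> \<e>" by simp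
    then show False using one_neq_zero by (simp add: CP_simps delta_def)
  qed
  then have "{\<zero>\<^bsub>S\<^esub>} \<noteq> carrier S" using C.S.one_closed by blast
  then obtain A B where AB: "ideal A S" "ideal B S" "A \<cdot>\<^bsub>S\<^esub> B = {\<zero>\<^bsub>S\<^esub>}" "A \<noteq> {\<zero>\<^bsub>S\<^esub>}" "B \<noteq> {\<zero>\<^bsub>S\<^esub>}"
    using np C.S.zeroideal unfolding prime_ring_def by blast
  obtain a where a: "a \<in> A" "a \<noteq> \<zero>\<^bsub>S\<^esub>"
    using AB additive_subgroup.zero_closed[OF ideal.axioms(1)[OF AB(1)]] by blast
  obtain b where b: "b \<in> B" "b \<noteq> \<zero>\<^bsub>S\<^esub>"
    using AB additive_subgroup.zero_closed[OF ideal.axioms(1)[OF AB(2)]] by blast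
  have "C.ann (carrier G) a b" unfolding C.ann_def
  proof (intro ballI)
    fix h s assume "h \<in> carrier G" "s \<in> C.homog h"
    then have "a \<otimes>\<^bsub>S\<^esub> s \<in> A" using ideal.I_r_closed[OF AB(1) a(1)] by blast
    then show "a \<otimes>\<^bsub>S\<^esub> s \<otimes>\<^bsub>S\<^esub> b = \<zero>\<^bsub>S\<^esub>" using C.S.ideal_prod_zeroD[OF AB(3) _ b(1)] by blast
  qed
  then have "C.finite_annihilating_pair" using C.annihilating_pair_finite ideal.Icarr[OF AB(1) a(1)] ideal.Icarr[OF AB(2) b(1)] a b by blast
  then show nonprime_data by (rule finite_annihilating_pair_nonprime_data)
qed

end

theorem theorem13p10:
  fixes G :: "('g, 'm) monoid_scheme" and R :: "('r, 'n) ring_scheme"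
    and \<alpha> :: "'g \<Rightarrow> 'r \<Rightarrow> 'r" and D :: "'g \<Rightarrow> 'r set" and w :: "'g \<Rightarrow> 'g \<Rightarrow> 'r"
  assumes "unital_twisted_partial_action G R \<alpha> D w"
  defines "S \<equiv> crossed_product G R \<alpha> D w"
    and "u \<equiv> \<lambda>g. identity_of R (D g)"
  shows "\<not> prime_ring (S (carrier G)) \<longleftrightarrow>
    (\<exists>N H I A B.
      subgroup H G \<and> N \<lhd> (G\<lparr>carrier := H\<rparr>) \<and> finite N \<and>
      ideal I R \<and>
      (\<forall>h\<in>H. \<alpha> h ` (I \<cdot>\<^bsub>R\<^esub> {u (inv\<^bsub>G\<^esub> h)}) = I \<cdot>\<^bsub>R\<^esub> {u h}) \<and>
      (\<forall>g\<in>carrier G - H. I \<cdot>\<^bsub>R\<^esub> (\<alpha> g ` (I \<cdot>\<^bsub>R\<^esub> {u (inv\<^bsub>G\<^esub> g)})) = {\<zero>\<^bsub>R\<^esub>}) \<and>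
      ideal A (S N) \<and> A \<noteq> {\<zero>\<^bsub>S N\<^esub>} \<and>
      ideal B (S N) \<and> B \<noteq> {\<zero>\<^bsub>S N\<^esub>} \<and>
      A \<subseteq> (\<lambda>r. delta R r \<one>\<^bsub>G\<^esub>) ` I \<cdot>\<^bsub>S N\<^esub> carrier (S N) \<and>
      B \<subseteq> (\<lambda>r. delta R r \<one>\<^bsub>G\<^esub>) ` I \<cdot>\<^bsub>S N\<^esub> carrier (S N) \<and>
      (\<forall>h\<in>H. A \<cdot>\<^bsub>S (carrier G)\<^esub> {delta R (u h) h} \<cdot>\<^bsub>S (carrier G)\<^esub> B
               = {\<zero>\<^bsub>S (carrier G)\<^esub>}))"
proof -
  interpret unital_twisted_partial_action G R \<alpha> D w by fact
  show ?thesis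
    using nonprime_data_not_prime not_prime_nonprime_data unfolding nonprime_data_def S_def u_def by blast
qed

end
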